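(* Let $u$ be a Dirichlet harmonic function on $\mathbb R_+\times K$. (1) If $1<p\le\infty$, then $u$ is the Dirichlet Poisson integral of some $f\in L^p(K,\mu)$ if and only if $$\sup_{t>0}\|u(t,\cdot)\|_{L^p(K,\mu)}<\infty.$$ (2) $u$ is the Dirichlet Poisson integral of some finite Borel measure on $K$ if and only if $$\sup_{t>0}\|u(t,\cdot)\|_{L^1(K,\mu)}<\infty.$$
   Context: Setting. $(K,S,\{F_i\}_{i\in S})$ is a self-similar structure ($S$ finite, $K$ compact metrizable, $F_i:K\to K$ continuous injections, with a continuous surjection $\pi:S^{\mathbb N}\to K$ satisfying $\pi(i\omega)=F_i(\pi(\omega))$). $W_m=S^m$, $W_*=\bigcup_{m\ge0}W_m$; for $w=w_1\cdots w_m$, $F_w=F_{w_1}\circ\cdots\circ F_{w_m}$, and $r_w=r_{w_1}\cdots r_{w_m}$ for numbers $r_i$. The critical set is $\mathcal C=\bigcup_{i\ne j}F_i(K)\cap F_j(K)$ and the boundary is $V_0=\{p\in K:\ F_w(p)\in\mathcal C\text{ for some nonempty word }w\}$. $K$ is assumed post-critically finite: $V_0$ is finite, and $V_0\neq\emptyset$. $V_m=\bigcup_{w\in W_m}F_w(V_0)$. A regular harmonic structure $(D,\mathbf r)$ is fixed: $\mathbf r=(r_i)_{i\in S}$ with $0<r_i<1$; $D$ is a real symmetric matrix indexed by $V_0$ with nonnegative off-diagonal entries, nonpositive definite, with kernel exactly the constants; with $\mathcal E_0(u,v)=-\sum_{p,q}u(p)D_{pq}v(q)$ and $\mathcal E_m(u,v)=\sum_{w\in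 W_m}r_w^{-1}\mathcal E_0(u\circ F_w|_{V_0},v\circ F_w|_{V_0})$, one has $\mathcal E_0(u,u)=\min\{\mathcal E_1(v,v):v|_{V_0}=u\}$. The Dirichlet form is $\mathcal E(u,v)=\lim_m\mathcal E_m(u|_{V_m},v|_{V_m})$ on $\mathcal F=\{u\in C(K):\lim_m\mathcal E_m(u,u)<\infty\}$, and $\mathcal F_0=\{u\in\mathcal F:u|_{V_0}=0\}$. $d$ is the unique real number with $\sum_{i\in S}r_i^d=1$, and $\mu$ is the self-similar (Bernoulli) probability measure on $K$ with weights $\mu_i=r_i^d$. $\mathbb R_+=(0,\infty)$. Laplacian: $u\in\mathcal D$ and $\Delta u=g$ mean $u\in\mathcal F$, $g\in C(K)$ and $\mathcal E(u,v)=-\int_Kgv\,d\mu$ for all $v\in\mathcal F_0$. $\mathcal D_D=\{u\in\mathcal D:u|_{V_0}=0\}$. There are Dirichlet eigenvalues $0<\lambda^D_1\le\lambda^D_2\le\cdots$ (with multiplicity) and real-valued $\phi^D_n\in\mathcal D_D$ with $\Delta\phi^D_n=-\lambda^D_n\phi^D_n$ such that $\{\phi^D_n\}_{n\ge1}$ is a complete orthonormal system of $L^2(K,\mu)$. Dirichlet Poisson kernel: $P^D(t,x,y)=\sum_{n\ge1}e^{-\sqrt{\lambda^D_n}\,t}\phi^D_n(x)\phi^D_n(y)$ on $\mathbb R_+\times K\times K$ (uniformly convergent on $[T,\infty)\times K\times K$ for every $T>0$). The Dirichlet Poisson integral of $f\in L^1(K,\mu)$ is $\mathcal P^D_tf(x)=\int_KP^D(t,x,y)f(y)\,d\mu(y)$,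 and that of a finite Borel measure $\nu$ on $K$ (signed or complex, i.e. of finite total variation) is $\mathcal P^D_t\nu(x)=\int_KP^D(t,x,y)\,d\nu(y)$. "$u$ is the Dirichlet Poisson integral of $f$" (or $\nu$) means $u(t,x)=\mathcal P^D_tf(x)$ (or $\mathcal P^D_t\nu(x)$) for all $(t,x)\in\mathbb R_+\times K$. A continuous function $u$ on $\mathbb R_+\times K$ is a harmonic function if (i) $u(\cdot,x)\in C^2(\mathbb R_+)$ for each $x\in K$; (ii) $u(t,\cdot)\in\mathcal D$ for each $t>0$; (iii) $\frac{\partial^2u}{\partial t^2}(t,x)+\Delta u(t,x)=0$ for each $(t,x)\in\mathbb R_+\times(K\setminus V_0)$, with $\Delta$ acting in $x$. It is a Dirichlet harmonic function if moreover $u(t,p)=0$ for all $t>0$ and $p\in V_0$. *)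

theory Defs
  imports "HOL-Probability.Probability"
begin

text \<open>
  Conventions. The compact metrizable space is a subset \<open>K\<close> of a metric type (only its topology is
  used), and functions on \<open>K\<close> are total functions whose values outside \<open>K\<close> never matter.
  Words are lists over \<open>S\<close>, so \<open>F\<^sub>w\<close> is \<open>foldr F w\<close> and \<open>r\<^sub>w\<close> is \<open>prod_list (map r w)\<close>;
  infinite words are functions \<open>nat \<Rightarrow> 'i\<close>, and \<open>i\<omega>\<close> is \<open>case_nat i \<omega>\<close>.

  Scalar-valued functions take values in a type \<open>'b\<close> of sort
  \<open>{real_normed_field, euclidean_space}\<close>. By the Frobenius theorem this means the real or the
  complex numbers, and it lets the real-valued theory (with signed measures) and the complex-valued
  one (with complex measures) be treated by the same definitions.
\<close>

section \<open>Self-similar structures and harmonic structures\<close>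

definition self_similar_structure ::
  "'k::metric_space set \<Rightarrow> 'i set \<Rightarrow> ('i \<Rightarrow> 'k \<Rightarrow> 'k) \<Rightarrow> ((nat \<Rightarrow> 'i) \<Rightarrow> 'k) \<Rightarrow> bool" where
  "self_similar_structure K S F \<pi> \<longleftrightarrow>
     finite S \<and> compact K \<and>
     (\<forall>i\<in>S. continuous_on K (F i) \<and> inj_on (F i) K \<and> F i ` K \<subseteq> K) \<and>
     continuous_map (product_topology (\<lambda>_. discrete_topology S) UNIV) (top_of_set K) \<pi> \<and>
     \<pi> ` (UNIV \<rightarrow> S) = K \<and>
     (\<forall>i\<in>S. \<forall>\<omega>\<in>UNIV \<rightarrow> S. \<pi> (case_nat i \<omega>) = F i (\<pi> \<omega>))"

definition critical_set :: "'k set \<Rightarrow> 'i set \<Rightarrow> ('i \<Rightarrow> 'k \<Rightarrow> 'k) \<Rightarrow> 'k set" where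
  "critical_set K S F = (\<Union>i\<in>S. \<Union>j\<in>S - {i}. F i ` K \<inter> F j ` K)"

definition boundary_set :: "'k set \<Rightarrow> 'i set \<Rightarrow> ('i \<Rightarrow> 'k \<Rightarrow> 'k) \<Rightarrow> 'k set" where
  "boundary_set K S F = {p \<in> K. \<exists>w. w \<noteq> [] \<and> set w \<subseteq> S \<and> foldr F w p \<in> critical_set K S F}"

definition words :: "'i set \<Rightarrow> nat \<Rightarrow> 'i list set" where
  "words S m = {w. length w = m \<and> set w \<subseteq> S}"

definition E0 :: "'k set \<Rightarrow> ('k \<Rightarrow> 'k \<Rightarrow> real) \<Rightarrow>
    ('k \<Rightarrow> 'b) \<Rightarrow> ('k \<Rightarrow> 'b) \<Rightarrow> 'b::real_normed_field" where
  "E0 V0 D u v = - (\<Sum>p\<in>V0. \<Sum>q\<in>V0. u p * of_real (D p q) * v q)"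

definition Em :: "'i set \<Rightarrow> ('i \<Rightarrow> 'k \<Rightarrow> 'k) \<Rightarrow> 'k set \<Rightarrow> ('k \<Rightarrow> 'k \<Rightarrow> real) \<Rightarrow> ('i \<Rightarrow> real) \<Rightarrow> nat \<Rightarrow>
    ('k \<Rightarrow> 'b) \<Rightarrow> ('k \<Rightarrow> 'b) \<Rightarrow> 'b::real_normed_field" where
  "Em S F V0 D r m u v =
     (\<Sum>w\<in>words S m. E0 V0 D (u \<circ> foldr F w) (v \<circ> foldr F w) /\<^sub>R prod_list (map r w))"

text \<open>
  The bilinear form \<^term>\<open>Em\<close> does not measure the energy of a complex function. The inner product
  \<open>a \<bullet> b\<close> is \<open>a * b\<close> for reals and \<open>Re (a * cnj b)\<close> for complex numbers, so the following is
  \<open>\<E>\<^sub>m(u,u)\<close> for real \<open>u\<close>, and \<open>\<E>\<^sub>m(u, cnj u) = \<E>\<^sub>m(Re u,Re u) + \<E>\<^sub>m(Im u,Im u)\<close> for complex \<open>u\<close>.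
\<close>

definition energy :: "'i set \<Rightarrow> ('i \<Rightarrow> 'k \<Rightarrow> 'k) \<Rightarrow> 'k set \<Rightarrow> ('k \<Rightarrow> 'k \<Rightarrow> real) \<Rightarrow> ('i \<Rightarrow> real) \<Rightarrow> nat \<Rightarrow>
    ('k \<Rightarrow> 'b::real_inner) \<Rightarrow> real" where
  "energy S F V0 D r m u =
     (\<Sum>w\<in>words S m. - (\<Sum>p\<in>V0. \<Sum>q\<in>V0. D p q * (u (foldr F w p) \<bullet> u (foldr F w q)))
        / prod_list (map r w))"

lemma energy_real: "energy S F V0 D r m (u :: 'k \<Rightarrow> real) = Em S F V0 D r m u u"
  unfolding energy_def Em_def E0_def
  by (simp add: divide_inverse mult_ac)

lemma energy_complex:
  "complex_of_real (energy S F V0 D r m u) = Em S F V0 D r m u (\<lambda>x. cnj (u x))"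
  if "\<And>p q. p \<in> V0 \<Longrightarrow> q \<in> V0 \<Longrightarrow> D p q = D q p"
proof -
  have "complex_of_real (\<Sum>p\<in>V0. \<Sum>q\<in>V0. D p q * (f p \<bullet> f q)) =
      (\<Sum>p\<in>V0. \<Sum>q\<in>V0. f p * of_real (D p q) * cnj (f q))" for f :: "_ \<Rightarrow> complex"
  proof -
    have "(\<Sum>p\<in>V0. \<Sum>q\<in>V0. D p q * (Im (f p) * Re (f q))) =
        (\<Sum>p\<in>V0. \<Sum>q\<in>V0. D p q * (Re (f p) * Im (f q)))"
      by (subst sum.swap) (intro sum.cong refl, simp add: that mult_ac)
    then show ?thesis
      by (simp add: complex_eq_iff inner_complex_def sum_subtractf algebra_simps)
  qed
  note * = this
  show ?thesis
    unfolding energy_def Em_def E0_def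
    by (subst of_real_sum, intro sum.cong refl)
      (simp only: o_def of_real_divide of_real_minus * scaleR_conv_of_real of_real_inverse
        of_real_mult[of _ "inverse _"] divide_inverse, rule mult.commute)
qed

definition regular_harmonic_structure :: "'i set \<Rightarrow> ('i \<Rightarrow> 'k \<Rightarrow> 'k) \<Rightarrow> 'k set \<Rightarrow>
    ('k \<Rightarrow> 'k \<Rightarrow> real) \<Rightarrow> ('i \<Rightarrow> real) \<Rightarrow> bool" where
  "regular_harmonic_structure S F V0 D r \<longleftrightarrow>
     (\<forall>i\<in>S. 0 < r i \<and> r i < 1) \<and>
     (\<forall>p\<in>V0. \<forall>q\<in>V0. D p q = D q p) \<and>
     (\<forall>p\<in>V0. \<forall>q\<in>V0. p \<noteq> q \<longrightarrow> 0 \<le> D p q) \<and>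
     (\<forall>u. (\<Sum>p\<in>V0. \<Sum>q\<in>V0. u p * D p q * u q) \<le> 0) \<and>
     (\<forall>u. (\<forall>p\<in>V0. (\<Sum>q\<in>V0. D p q * u q) = 0) \<longleftrightarrow> (\<exists>c. \<forall>p\<in>V0. u p = c)) \<and>
     (\<forall>u :: 'k \<Rightarrow> real.
        (\<exists>v. (\<forall>p\<in>V0. v p = u p) \<and> Em S F V0 D r 1 v v = E0 V0 D u u) \<and>
        (\<forall>v. (\<forall>p\<in>V0. v p = u p) \<longrightarrow> E0 V0 D u u \<le> Em S F V0 D r 1 v v))"

section \<open>Dirichlet form and Laplacian\<close>

text \<open>The energies increase with \<open>m\<close>, so a finite limit means convergence in the reals.\<close>

definition form_domain :: "'k::metric_space set \<Rightarrow> 'i set \<Rightarrow> ('i \<Rightarrow> 'k \<Rightarrow> 'k) \<Rightarrow> 'k set \<Rightarrow>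
    ('k \<Rightarrow> 'k \<Rightarrow> real) \<Rightarrow> ('i \<Rightarrow> real) \<Rightarrow> ('k \<Rightarrow> 'b::real_inner) set" where
  "form_domain K S F V0 D r =
     {u. continuous_on K u \<and> convergent (\<lambda>m. energy S F V0 D r m u)}"

definition form_domain0 :: "'k::metric_space set \<Rightarrow> 'i set \<Rightarrow> ('i \<Rightarrow> 'k \<Rightarrow> 'k) \<Rightarrow> 'k set \<Rightarrow>
    ('k \<Rightarrow> 'k \<Rightarrow> real) \<Rightarrow> ('i \<Rightarrow> real) \<Rightarrow> ('k \<Rightarrow> 'b::real_inner) set" where
  "form_domain0 K S F V0 D r = {u \<in> form_domain K S F V0 D r. \<forall>p\<in>V0. u p = 0}"

definition dirichlet_form :: "'i set \<Rightarrow> ('i \<Rightarrow> 'k \<Rightarrow> 'k) \<Rightarrow> 'k set \<Rightarrow> ('k \<Rightarrow> 'k \<Rightarrow> real) \<Rightarrow>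
    ('i \<Rightarrow> real) \<Rightarrow> ('k \<Rightarrow> 'b) \<Rightarrow> ('k \<Rightarrow> 'b) \<Rightarrow> 'b::real_normed_field" where
  "dirichlet_form S F V0 D r u v = lim (\<lambda>m. Em S F V0 D r m u v)"

text \<open>The self-similar measure with weights \<open>r\<^sub>i powr d\<close> is the image of the Bernoulli measure.\<close>

definition self_similar_measure :: "'k::metric_space set \<Rightarrow> 'i set \<Rightarrow> ((nat \<Rightarrow> 'i) \<Rightarrow> 'k) \<Rightarrow>
    ('i \<Rightarrow> real) \<Rightarrow> real \<Rightarrow> 'k measure" where
  "self_similar_measure K S \<pi> r d =
     distr (\<Pi>\<^sub>M n\<in>(UNIV :: nat set). point_measure S (\<lambda>i. ennreal (r i powr d)))
       (restrict_space borel K) \<pi>"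

text \<open>\<open>u \<in> \<D>\<close> and \<open>\<Delta>u = g\<close>; on \<open>K\<close> the function \<open>g\<close> is determined by \<open>u\<close>.\<close>

definition has_laplacian :: "'k::metric_space set \<Rightarrow> 'i set \<Rightarrow> ('i \<Rightarrow> 'k \<Rightarrow> 'k) \<Rightarrow> 'k set \<Rightarrow>
    ('k \<Rightarrow> 'k \<Rightarrow> real) \<Rightarrow> ('i \<Rightarrow> real) \<Rightarrow> 'k measure \<Rightarrow>
    ('k \<Rightarrow> 'b::{real_normed_field,euclidean_space}) \<Rightarrow> ('k \<Rightarrow> 'b) \<Rightarrow> bool" where
  "has_laplacian K S F V0 D r \<mu> u g \<longleftrightarrow>
     u \<in> form_domain K S F V0 D r \<and> continuous_on K g \<and>
     (\<forall>v \<in> form_domain0 K S F V0 D r.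
        dirichlet_form S F V0 D r u v = - (\<integral>x. g x * v x \<partial>\<mu>))"

section \<open>Lebesgue norms and measures of finite variation\<close>

definition Lp_norm :: "'k measure \<Rightarrow> ennreal \<Rightarrow> ('k \<Rightarrow> 'b::real_normed_vector) \<Rightarrow> ennreal" where
  "Lp_norm M p f =
     (if p = \<infinity> then esssup M (\<lambda>x. ennreal (norm (f x)))
      else let I = (\<integral>\<^sup>+x. ennreal (norm (f x) powr enn2real p) \<partial>M)
           in if I = \<infinity> then \<infinity> else ennreal (enn2real I powr (1 / enn2real p)))"

definition Lp_space :: "'k measure \<Rightarrow> ennreal \<Rightarrow> ('k \<Rightarrow> 'b::real_normed_vector) set" where
  "Lp_space M p = {f \<in> borel_measurable M. Lp_norm M p f < \<infinity>}"

text \<open>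
  A finite (signed or complex) Borel measure on \<open>K\<close> is a countably additive set function on the
  Borel sets of \<open>K\<close>; its total variation is then automatically finite.
\<close>

definition finite_variation_measure ::
  "'k::metric_space set \<Rightarrow> ('k set \<Rightarrow> 'b::euclidean_space) \<Rightarrow> bool" where
  "finite_variation_measure K \<nu> \<longleftrightarrow>
     \<nu> {} = 0 \<and>
     (\<forall>A :: nat \<Rightarrow> 'k set.
        range A \<subseteq> sets (restrict_space borel K) \<longrightarrow> disjoint_family A \<longrightarrow>
        (\<lambda>n. \<nu> (A n)) sums \<nu> (\<Union>n. A n))"

text \<open>
  Integration against a signed measure goes through its Jordan decomposition, whose positive part
  is \<open>\<nu>\<^sup>+(A) = sup {\<nu>(B) | B \<subseteq> A}\<close> and whose negative part is \<open>(-\<nu>)\<^sup>+\<close>. The supremum may be taken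
  in the extended nonnegative reals because \<open>B = {}\<close> is admissible.
\<close>

definition positive_variation ::
  "'k::metric_space set \<Rightarrow> ('k set \<Rightarrow> real) \<Rightarrow> 'k measure" where
  "positive_variation K \<nu> =
     measure_of K (sets (restrict_space borel K))
       (\<lambda>A. SUP B\<in>{B \<in> sets (restrict_space borel K). B \<subseteq> A}. ennreal (\<nu> B))"

definition signed_integral ::
  "'k::metric_space set \<Rightarrow> ('k set \<Rightarrow> real) \<Rightarrow> ('k \<Rightarrow> real) \<Rightarrow> real" where
  "signed_integral K \<nu> g =
     (\<integral>x. g x \<partial>positive_variation K \<nu>) - (\<integral>x. g x \<partial>positive_variation K (\<lambda>A. - \<nu> A))"

text \<open>For complex \<open>\<nu>\<close> this is \<open>\<integral> g d(Re \<nu>) + \<i> \<integral> g d(Im \<nu>)\<close>; the integrands of interest are real.\<close>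

definition measure_integral ::
  "'k::metric_space set \<Rightarrow> ('k set \<Rightarrow> 'b::euclidean_space) \<Rightarrow> ('k \<Rightarrow> real) \<Rightarrow> 'b" where
  "measure_integral K \<nu> g = (\<Sum>b\<in>Basis. signed_integral K (\<lambda>A. \<nu> A \<bullet> b) g *\<^sub>R b)"

lemma measure_integral_real: "measure_integral K (\<nu> :: 'k::metric_space set \<Rightarrow> real) g = signed_integral K \<nu> g"
  by (simp add: measure_integral_def)

lemma measure_integral_complex:
  "measure_integral K \<nu> g =
     Complex (signed_integral K (\<lambda>A. Re (\<nu> A)) g) (signed_integral K (\<lambda>A. Im (\<nu> A)) g)"
  by (simp add: measure_integral_def Basis_complex_def complex_eq_iff)

section \<open>Dirichlet eigenfunctions, Poisson kernel and Dirichlet harmonic functions\<close>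

text \<open>
  The indices start at \<open>0\<close> instead of \<open>1\<close>. The last clause is completeness: every
  \<open>f\<close> in \<open>L\<^sup>2(K,\<mu>)\<close> is the \<open>L\<^sup>2\<close>-limit of its Fourier series.
\<close>

definition dirichlet_eigensystem :: "'k::metric_space set \<Rightarrow> 'i set \<Rightarrow> ('i \<Rightarrow> 'k \<Rightarrow> 'k) \<Rightarrow> 'k set \<Rightarrow>
    ('k \<Rightarrow> 'k \<Rightarrow> real) \<Rightarrow> ('i \<Rightarrow> real) \<Rightarrow> 'k measure \<Rightarrow> (nat \<Rightarrow> real) \<Rightarrow> (nat \<Rightarrow> 'k \<Rightarrow> real) \<Rightarrow> bool" where
  "dirichlet_eigensystem K S F V0 D r \<mu> lam \<phi> \<longleftrightarrow>
     0 < lam 0 \<and> mono lam \<and>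
     (\<forall>n. has_laplacian K S F V0 D r \<mu> (\<phi> n) (\<lambda>x. - lam n * \<phi> n x) \<and> (\<forall>p\<in>V0. \<phi> n p = 0)) \<and>
     (\<forall>m n. (\<integral>x. \<phi> m x * \<phi> n x \<partial>\<mu>) = (if m = n then 1 else 0)) \<and>
     (\<forall>f \<in> Lp_space \<mu> 2.
        (\<lambda>N. Lp_norm \<mu> 2 (\<lambda>x. f x - (\<Sum>n<N. (\<integral>y. f y * \<phi> n y \<partial>\<mu>) * \<phi> n x))) \<longlonglongrightarrow> 0)"

definition poisson_kernel :: "(nat \<Rightarrow> real) \<Rightarrow> (nat \<Rightarrow> 'k \<Rightarrow> real) \<Rightarrow> real \<Rightarrow> 'k \<Rightarrow> 'k \<Rightarrow> real" where
  "poisson_kernel lam \<phi> t x y = (\<Sum>n. exp (- sqrt (lam n) * t) * \<phi> n x * \<phi> n y)"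

definition poisson_integral :: "'k measure \<Rightarrow> (nat \<Rightarrow> real) \<Rightarrow> (nat \<Rightarrow> 'k \<Rightarrow> real) \<Rightarrow>
    ('k \<Rightarrow> 'b::{banach,second_countable_topology}) \<Rightarrow> real \<Rightarrow> 'k \<Rightarrow> 'b" where
  "poisson_integral \<mu> lam \<phi> f t x = (\<integral>y. poisson_kernel lam \<phi> t x y *\<^sub>R f y \<partial>\<mu>)"

definition poisson_integral_measure :: "'k::metric_space set \<Rightarrow> (nat \<Rightarrow> real) \<Rightarrow>
    (nat \<Rightarrow> 'k \<Rightarrow> real) \<Rightarrow> ('k set \<Rightarrow> 'b::euclidean_space) \<Rightarrow> real \<Rightarrow> 'k \<Rightarrow> 'b" where
  "poisson_integral_measure K lam \<phi> \<nu> t x = measure_integral K \<nu> (poisson_kernel lam \<phi> t x)"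

definition first_deriv :: "(real \<Rightarrow> 'b::real_normed_vector) \<Rightarrow> real \<Rightarrow> 'b" where
  "first_deriv f t = vector_derivative f (at t)"

definition C2_on_positive :: "(real \<Rightarrow> 'b::real_normed_vector) \<Rightarrow> bool" where
  "C2_on_positive f \<longleftrightarrow>
     (\<forall>t>0. f differentiable (at t)) \<and> (\<forall>t>0. first_deriv f differentiable (at t)) \<and>
     continuous_on {0<..} (first_deriv (first_deriv f))"

definition harmonic_function :: "'k::metric_space set \<Rightarrow> 'i set \<Rightarrow> ('i \<Rightarrow> 'k \<Rightarrow> 'k) \<Rightarrow> 'k set \<Rightarrow>
    ('k \<Rightarrow> 'k \<Rightarrow> real) \<Rightarrow> ('i \<Rightarrow> real) \<Rightarrow> 'k measure \<Rightarrow>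
    (real \<Rightarrow> 'k \<Rightarrow> 'b::{real_normed_field,euclidean_space}) \<Rightarrow> bool" where
  "harmonic_function K S F V0 D r \<mu> u \<longleftrightarrow>
     continuous_on ({0<..} \<times> K) (\<lambda>(t, x). u t x) \<and>
     (\<forall>x\<in>K. C2_on_positive (\<lambda>t. u t x)) \<and>
     (\<forall>t>0. \<exists>g. has_laplacian K S F V0 D r \<mu> (u t) g \<and>
        (\<forall>x\<in>K - V0. first_deriv (first_deriv (\<lambda>s. u s x)) t + g x = 0))"

definition dirichlet_harmonic_function :: "'k::metric_space set \<Rightarrow> 'i set \<Rightarrow>
    ('i \<Rightarrow> 'k \<Rightarrow> 'k) \<Rightarrow> 'k set \<Rightarrow> ('k \<Rightarrow> 'k \<Rightarrow> real) \<Rightarrow> ('i \<Rightarrow> real) \<Rightarrow> 'k measure \<Rightarrow>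
    (real \<Rightarrow> 'k \<Rightarrow> 'b::{real_normed_field,euclidean_space}) \<Rightarrow> bool" where
  "dirichlet_harmonic_function K S F V0 D r \<mu> u \<longleftrightarrow>
     harmonic_function K S F V0 D r \<mu> u \<and> (\<forall>t>0. \<forall>p\<in>V0. u t p = 0)"

end

theory Submission
  imports Defs
begin

text \<open>
  For the converse implications of both parts, the Fourier coefficients of a Dirichlet harmonic
  function \<open>u(t, \<cdot>)\<close> bounded in \<open>L\<^sup>1\<close> have to be multiples of \<open>exp (- t sqrt \<lambda>\<^sub>n)\<close>. This follows
  from the maximum principle for \<open>\<partial>\<^sub>t\<^sub>t + \<Delta>\<close>, by comparison with finite eigenfunction sums; no
  integrability of \<open>\<partial>\<^sub>t\<^sub>t u\<close> is needed. The measures \<open>(1 + u\<^sup>\<plusminus>(t, \<cdot>)) \<mu>\<close> have weak limits along a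
  sequence \<open>t \<rightarrow> 0\<close>, whose difference \<open>\<nu>\<close> has the limits of the Fourier coefficients as its
  own, so \<open>u\<close> is the Poisson integral of \<open>\<nu>\<close>. A bound in \<open>L\<^sup>p\<close>, \<open>p > 1\<close>, gives uniform
  integrability, hence \<open>\<nu> = f \<mu>\<close>, and \<open>f \<in> L\<^sup>p\<close> by Fatou's lemma because the Poisson integrals of \<open>f\<close>
  tend to \<open>f\<close> in \<open>L\<^sup>1\<close>. The direct implications rest on \<open>\<integral> |P\<^sup>D(t, x, y)| d\<mu>(y) \<le> 1\<close>, which is again
  the maximum principle, now for the Poisson integrals of functions in \<open>\<F>\<^sub>0\<close>.
  The growth of the eigenvalues comes from \<open>sup u\<^sup>2 \<le> C \<E>(u, u)\<close> on \<open>\<F>\<^sub>0\<close>, which applied to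
  eigenfunction sums gives \<open>\<Sum> \<phi>\<^sub>n(x)\<^sup>2 / \<lambda>\<^sub>n \<le> C\<close>.
\<close>

section \<open>Symbolic dynamics and the self-similar measure\<close>

text \<open>The hypotheses do not say that \<open>K\<close> is connected, and
  \<open>sup u^2 \<le> C E(u,u)\<close> fails if some cells are cut off from \<open>V0\<close>; it
  is the completeness of the Dirichlet eigenfunctions that excludes this. The constant
  \<open>C\<close> comes from a telescoping sum along nested cells, whose terms shrink like powers
  of the square root of the largest \<open>r i\<close>, a number below 1. The Laplacian is defined
  weakly, so its sign at a maximum has to be read off from a test function: a truncation supported
  near the set of maximum points, after a quadratic perturbation in time has made the sign strict.
  The summand 1 in \<open>(1 + u^\<plusminus>) \<mu>\<close> keeps the total masses away from 0, so
  that they can be normalised to probability measures for Helly's theorem; it cancels in the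
  difference of the limits. These limits may overlap, so they are in general not the Jordan parts of
  \<nu>; densities with respect to a common measure link them to the signed integral. Real and
  complex scalars are reduced to coordinates in \<open>Basis\<close>, because the maximum principle
  needs an ordered range.\<close>

lemma topological_product_cylinder:
  assumes fin: "finite S"
    and cont: "continuous_map (product_topology (\<lambda>_::nat. discrete_topology S) UNIV) (top_of_set K) f"
    and \<omega>: "\<omega> \<in> UNIV \<rightarrow> S" and G: "open G" "f \<omega> \<in> G"
  shows "\<exists>n. \<forall>\<omega>'\<in>UNIV \<rightarrow> S. (\<forall>k<n. \<omega>' k = \<omega> k) \<longrightarrow> f \<omega>' \<in> G"
proof -
  let ?T = "product_topology (\<lambda>_::nat. discrete_topology S) UNIV"
  have top: "topspace ?T = UNIV \<rightarrow> S" by (auto simp: PiE_UNIV_domain)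
  have fK: "f ` (UNIV \<rightarrow> S) \<subseteq> K"
    using continuous_map_image_subset_topspace[OF cont] top by simp
  have "openin ?T {x \<in> topspace ?T. f x \<in> K \<inter> G}"
    by (rule openin_continuous_map_preimage[OF cont]) (use G in \<open>auto simp: openin_open\<close>)
  moreover have "\<omega> \<in> {x \<in> topspace ?T. f x \<in> K \<inter> G}" using \<omega> G fK top by auto
  ultimately obtain U where U: "finite {i. U i \<noteq> S}" "\<omega> \<in> Pi\<^sub>E UNIV U"
     "Pi\<^sub>E UNIV U \<subseteq> {x \<in> topspace ?T. f x \<in> K \<inter> G}"
    unfolding openin_product_topology_alt by (auto; blast)
  obtain n where n: "\<And>i. U i \<noteq> S \<Longrightarrow> i < n"
    using finite_nat_set_iff_bounded[of "{i. U i \<noteq> S}"] U(1) by auto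
  show ?thesis
  proof (intro exI[of _ n] ballI impI)
    fix \<omega>' assume w: "\<omega>' \<in> UNIV \<rightarrow> S" "\<forall>k<n. \<omega>' k = \<omega> k"
    have "\<omega>' i \<in> U i" for i
      using w U(2) n[of i] by (cases "U i = S") (auto simp: PiE_UNIV_domain)
    then have "\<omega>' \<in> Pi\<^sub>E UNIV U" by (auto simp: PiE_UNIV_domain)
    then show "f \<omega>' \<in> G" using U(3) by auto
  qed
qed

locale fractal_structure =
  fixes K :: "'k::metric_space set" and S :: "'i set" and F :: "'i \<Rightarrow> 'k \<Rightarrow> 'k"
    and \<pi> :: "(nat \<Rightarrow> 'i) \<Rightarrow> 'k" and V0 :: "'k set" and D :: "'k \<Rightarrow> 'k \<Rightarrow> real"
    and r :: "'i \<Rightarrow> real" and d :: real and \<mu> :: "'k measure"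
  assumes self_similar: "self_similar_structure K S F \<pi>"
    and V0_eq: "V0 = boundary_set K S F" and finite_V0: "finite V0" and V0_nonempty: "V0 \<noteq> {}"
    and harmonic_structure: "regular_harmonic_structure S F V0 D r"
    and sum_weights: "(\<Sum>i\<in>S. r i powr d) = 1"
    and \<mu>_eq: "\<mu> = self_similar_measure K S \<pi> r d"
begin

abbreviation "P \<equiv> \<Pi>\<^sub>M n\<in>(UNIV :: nat set). point_measure S (\<lambda>i. ennreal (r i powr d))"

lemma finite_S: "finite S" and compact_K: "compact K"
  and F_props: "\<forall>i\<in>S. continuous_on K (F i) \<and> inj_on (F i) K \<and> F i ` K \<subseteq> K"
  and \<pi>_cont: "continuous_map (product_topology (\<lambda>_. discrete_topology S) UNIV) (top_of_set K) \<pi>"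
  and \<pi>_image: "\<pi> ` (UNIV \<rightarrow> S) = K"
  and \<pi>_Cons_ball: "\<forall>i\<in>S. \<forall>\<omega>\<in>UNIV \<rightarrow> S. \<pi> (case_nat i \<omega>) = F i (\<pi> \<omega>)"
  using self_similar unfolding self_similar_structure_def by simp_all

lemma F_cont: "i \<in> S \<Longrightarrow> continuous_on K (F i)"
  and F_into: "i \<in> S \<Longrightarrow> x \<in> K \<Longrightarrow> F i x \<in> K"
  using F_props by blast+

lemma \<pi>_Cons: "i \<in> S \<Longrightarrow> \<omega> \<in> UNIV \<rightarrow> S \<Longrightarrow> \<pi> (case_nat i \<omega>) = F i (\<pi> \<omega>)"
  using \<pi>_Cons_ball by blast

lemma r_pos: "i \<in> S \<Longrightarrow> 0 < r i" and r_less_1: "i \<in> S \<Longrightarrow> r i < 1"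
  using harmonic_structure unfolding regular_harmonic_structure_def by auto

lemma S_nonempty: "S \<noteq> {}"
  using sum_weights by auto

lemma \<pi>_in_K: "\<omega> \<in> UNIV \<rightarrow> S \<Longrightarrow> \<pi> \<omega> \<in> K"
  using \<pi>_image by auto

lemma V0_subset: "V0 \<subseteq> K"
  by (auto simp: V0_eq boundary_set_def)

lemma F_word_into: "set w \<subseteq> S \<Longrightarrow> x \<in> K \<Longrightarrow> foldr F w x \<in> K"
  by (induction w) (auto intro: F_into)

lemma \<pi>_cylinder:
  assumes "\<omega> \<in> UNIV \<rightarrow> S" "open G" "\<pi> \<omega> \<in> G"
  shows "\<exists>n. \<forall>\<omega>'\<in>UNIV \<rightarrow> S. (\<forall>k<n. \<omega>' k = \<omega> k) \<longrightarrow> \<pi> \<omega>' \<in> G"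
  by (rule topological_product_cylinder[OF finite_S \<pi>_cont assms])

section \<open>The Bernoulli measure on infinite words\<close>

lemma prob_space_letters: "prob_space (point_measure S (\<lambda>i. ennreal (r i powr d)))"
proof
  have "emeasure (point_measure S (\<lambda>i. ennreal (r i powr d))) S = (\<Sum>i\<in>S. ennreal (r i powr d))"
    by (rule emeasure_point_measure_finite[OF finite_S order_refl])
  also have "\<dots> = ennreal (\<Sum>i\<in>S. r i powr d)"
    by (rule sum_ennreal) simp
  also have "\<dots> = 1"
    unfolding sum_weights by simp
  finally show "emeasure (point_measure S (\<lambda>i. ennreal (r i powr d)))
      (space (point_measure S (\<lambda>i. ennreal (r i powr d)))) = 1"
    unfolding space_point_measure .
qed

lemma prob_space_Bernoulli: "prob_space P"
  by (intro prob_space_PiM prob_space_letters)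

lemma space_Bernoulli: "space P = UNIV \<rightarrow> S"
  by (simp add: space_PiM space_point_measure PiE_UNIV_domain)

lemma cylinder_sets [measurable]:
  "{\<omega> \<in> UNIV \<rightarrow> S. \<forall>k<n. \<omega> k = \<alpha> k} \<in> sets P"
proof -
  have "{\<omega> \<in> space P. \<omega> k \<in> {\<alpha> k} \<inter> S} \<in> sets P" for k
    by (rule sets_Collect_single) (simp_all add: sets_point_measure)
  then have "{\<omega> \<in> space P. \<forall>k\<in>{..<n}. \<omega> k \<in> {\<alpha> k} \<inter> S} \<in> sets P"
    by (rule sets.sets_Collect_finite_All) simp
  moreover have "{\<omega> \<in> space P. \<forall>k\<in>{..<n}. \<omega> k \<in> {\<alpha> k} \<inter> S} =
      {\<omega> \<in> UNIV \<rightarrow> S. \<forall>k<n. \<omega> k = \<alpha> k}"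
    unfolding space_Bernoulli by blast
  ultimately show ?thesis by metis
qed

lemma emeasure_cylinder:
  assumes "\<alpha> \<in> UNIV \<rightarrow> S"
  shows "emeasure P {\<omega> \<in> UNIV \<rightarrow> S. \<forall>k<n. \<omega> k = \<alpha> k} = (\<Prod>k<n. ennreal (r (\<alpha> k) powr d))"
proof -
  interpret product_prob_space "\<lambda>_::nat. point_measure S (\<lambda>i. ennreal (r i powr d))" UNIV
    by (intro product_prob_spaceI prob_space_letters)
  have \<alpha>: "\<alpha> k \<in> S" for k using assms by auto
  have "emeasure P {\<omega> \<in> space P. \<forall>k\<in>{..<n}. \<omega> k \<in> {\<alpha> k}} =
      (\<Prod>k<n. emeasure (point_measure S (\<lambda>i. ennreal (r i powr d))) {\<alpha> k})"
    by (rule emeasure_PiM_Collect) (auto simp: sets_point_measure \<alpha>)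
  also have "\<dots> = (\<Prod>k<n. ennreal (r (\<alpha> k) powr d))"
    by (simp add: emeasure_point_measure_finite finite_S \<alpha>)
  finally show ?thesis unfolding space_Bernoulli by (simp add: Ball_def)
qed

text \<open>This is the source of the full support of \<mu>: no letter has probability 0 because
  every \<open>r i\<close> is positive.\<close>

lemma emeasure_cylinder_pos:
  assumes "\<alpha> \<in> UNIV \<rightarrow> S"
  shows "emeasure P {\<omega> \<in> UNIV \<rightarrow> S. \<forall>k<n. \<omega> k = \<alpha> k} > 0"
proof -
  have "(\<Prod>k<n. r (\<alpha> k) powr d) > 0"
  proof (intro prod_pos)
    fix k
    have "\<alpha> k \<in> S" using assms by auto
    then show "r (\<alpha> k) powr d > 0" using r_pos[of "\<alpha> k"] by simp
  qed
  moreover have "(\<Prod>k<n. ennreal (r (\<alpha> k) powr d)) = ennreal (\<Prod>k<n. r (\<alpha> k) powr d)"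
    by (rule prod_ennreal) simp
  ultimately show ?thesis by (simp add: emeasure_cylinder[OF assms])
qed

text \<open>There are only countably many cylinders, so open sets of infinite words are measurable.\<close>

lemma measurable_of_cylinders:
  fixes f :: "(nat \<Rightarrow> 'i) \<Rightarrow> 'c::topological_space"
  assumes "\<And>\<omega> G. \<omega> \<in> UNIV \<rightarrow> S \<Longrightarrow> open G \<Longrightarrow> f \<omega> \<in> G \<Longrightarrow>
     \<exists>n. \<forall>\<omega>'\<in>UNIV \<rightarrow> S. (\<forall>k<n. \<omega>' k = \<omega> k) \<longrightarrow> f \<omega>' \<in> G"
  shows "f \<in> borel_measurable P"
proof (rule borel_measurableI)
  fix G :: "'c set" assume G: "open G"
  define C where "C w = {\<omega> \<in> UNIV \<rightarrow> S. \<forall>k<length w. \<omega> k = w ! k}" for w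
  let ?W = "{w \<in> lists S. C w \<subseteq> f -` G}"
  have "f -` G \<inter> space P = (\<Union>w\<in>?W. C w)"
  proof (intro equalityI subsetI)
    fix \<omega> assume "\<omega> \<in> f -` G \<inter> space P"
    then have \<omega>: "\<omega> \<in> UNIV \<rightarrow> S" "f \<omega> \<in> G" by (auto simp: space_Bernoulli)
    obtain n where n: "\<And>\<omega>'. \<omega>' \<in> UNIV \<rightarrow> S \<Longrightarrow> (\<forall>k<n. \<omega>' k = \<omega> k) \<Longrightarrow> f \<omega>' \<in> G"
      using assms[OF \<omega>(1) G \<omega>(2)] by blast
    let ?w = "map \<omega> [0..<n]"
    have "\<omega> \<in> C ?w" using \<omega> by (simp add: C_def)
    moreover have "?w \<in> ?W" using n \<omega>(1) by (auto simp: C_def Pi_iff lists_eq_set)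
    ultimately show "\<omega> \<in> (\<Union>w\<in>?W. C w)" by blast
  qed (auto simp: C_def space_Bernoulli)
  moreover have "countable ?W"
    by (rule countable_subset[of _ "lists S"]) (auto intro: countable_lists countable_finite finite_S)
  moreover have "C w \<in> sets P" for w
    unfolding C_def by (rule cylinder_sets)
  ultimately show "f -` G \<inter> space P \<in> sets P"
    by (simp add: sets.countable_UN'')
qed

section \<open>The self-similar measure and continuous functions on \<open>K\<close>\<close>

lemma \<pi>_measurable [measurable]: "\<pi> \<in> measurable P (restrict_space borel K)"
proof (rule measurable_restrict_space2)
  show "\<pi> \<in> borel_measurable P"
    by (rule measurable_of_cylinders) (rule \<pi>_cylinder)
qed (use \<pi>_in_K space_Bernoulli in auto)

lemma \<mu>_distr: "\<mu> = distr P (restrict_space borel K) \<pi>"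
  by (simp add: \<mu>_eq self_similar_measure_def)

lemma sets_\<mu> [measurable_cong]: "sets \<mu> = sets (restrict_space borel K)"
  by (simp add: \<mu>_distr)

lemma open_Int_sets: "open G \<Longrightarrow> G \<inter> K \<in> sets (restrict_space borel K)"
  unfolding sets_restrict_space by (rule image_eqI[of _ _ G]) auto

lemma space_\<mu>: "space \<mu> = K"
  by (simp add: \<mu>_distr space_restrict_space)

lemma prob_space_\<mu>: "prob_space \<mu>"
  unfolding \<mu>_distr by (rule prob_space.prob_space_distr[OF prob_space_Bernoulli \<pi>_measurable])

sublocale prob_space \<mu>
  by (rule prob_space_\<mu>)

lemma continuous_measurable:
  fixes f :: "'k \<Rightarrow> 'c::topological_space"
  assumes "continuous_on K f"
  shows "f \<in> borel_measurable \<mu>"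
  using borel_measurable_continuous_on_restrict[OF assms] measurable_cong_sets[OF sets_\<mu> refl] by blast

lemma continuous_bounded:
  fixes f :: "'k \<Rightarrow> 'c::real_normed_vector"
  assumes "continuous_on K f"
  obtains B where "B > 0" "\<And>x. x \<in> K \<Longrightarrow> norm (f x) \<le> B"
proof -
  have "bounded (f ` K)"
    by (rule compact_imp_bounded[OF compact_continuous_image[OF assms compact_K]])
  then obtain B where "B > 0" "\<forall>y\<in>f ` K. norm y \<le> B" by (auto simp: bounded_pos)
  then show thesis using that by blast
qed

lemma continuous_integrable:
  fixes f :: "'k \<Rightarrow> 'c::euclidean_space"
  assumes "continuous_on K f"
  shows "integrable \<mu> f"
proof -
  obtain B where "\<And>x. x \<in> K \<Longrightarrow> norm (f x) \<le> B" using continuous_bounded[OF assms] by blast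
  then show ?thesis
    by (intro integrable_const_bound[where B = B] continuous_measurable assms)
      (auto simp: space_\<mu>)
qed

text \<open>A neighbourhood of \<open>\<pi> \<omega>\<close> pulls back to a set of words containing
  a full cylinder around \<open>\<omega>\<close>, and cylinders have positive mass.\<close>

lemma emeasure_open_pos:
  assumes "open G" "x \<in> G" "x \<in> K"
  shows "emeasure \<mu> (G \<inter> K) > 0"
proof -
  obtain \<omega> where \<omega>: "\<omega> \<in> UNIV \<rightarrow> S" "\<pi> \<omega> = x" using assms(3) \<pi>_image by auto
  with assms obtain n where n: "\<forall>\<omega>'\<in>UNIV \<rightarrow> S. (\<forall>k<n. \<omega>' k = \<omega> k) \<longrightarrow> \<pi> \<omega>' \<in> G"
    using \<pi>_cylinder[of \<omega> G] by blast
  have OK: "G \<inter> K \<in> sets (restrict_space borel K)"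
    by (rule open_Int_sets[OF assms(1)])
  have "0 < emeasure P {\<omega>' \<in> UNIV \<rightarrow> S. \<forall>k<n. \<omega>' k = \<omega> k}"
    by (rule emeasure_cylinder_pos) fact
  also have "\<dots> \<le> emeasure P (\<pi> -` (G \<inter> K) \<inter> space P)"
    by (rule emeasure_mono) (use n \<pi>_in_K measurable_sets[OF \<pi>_measurable OK] in \<open>auto simp: space_Bernoulli\<close>)
  also have "\<dots> = emeasure \<mu> (G \<inter> K)"
    unfolding \<mu>_distr by (rule emeasure_distr[OF \<pi>_measurable OK, symmetric])
  finally show ?thesis .
qed

text \<open>Continuous functions that differ at one point differ on a nonempty relatively open set,
  which is not null.\<close>

lemma continuous_AE_eq:
  fixes f g :: "'k \<Rightarrow> 'c::real_normed_vector"
  assumes "continuous_on K f" "continuous_on K g" "AE x in \<mu>. f x = g x" "x \<in> K"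
  shows "f x = g x"
proof (rule ccontr)
  assume neq: "f x \<noteq> g x"
  have "openin (top_of_set K) (K \<inter> (\<lambda>x. f x - g x) -` (- {0}))"
    by (rule continuous_openin_preimage_gen[OF continuous_on_diff[OF assms(1,2)]]) (simp add: open_Compl)
  then obtain G where G: "open G" "K \<inter> (\<lambda>x. f x - g x) -` (- {0}) = K \<inter> G"
    by (auto simp: openin_open)
  have "x \<in> G" using neq assms(4) G(2) by auto
  then have pos: "emeasure \<mu> (G \<inter> K) > 0" by (rule emeasure_open_pos[OF G(1) _ assms(4)])
  have "AE x in \<mu>. x \<notin> G \<inter> K"
    using assms(3) by eventually_elim (use G(2) in auto)
  moreover have "G \<inter> K \<in> sets \<mu>" using open_Int_sets[OF G(1)] sets_\<mu> by simp
  ultimately have "emeasure \<mu> (G \<inter> K) = 0"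
    by (subst (asm) AE_iff_measurable[where N = "G \<inter> K"])
      (use sets.sets_into_space[OF \<open>G \<inter> K \<in> sets \<mu>\<close>] in auto)
  with pos show False by simp
qed

text \<open>Serves to turn vanishing integrals of nonnegative continuous functions into vanishing at
  every point of \<open>K\<close>.\<close>

lemma continuous_integral_pos:
  fixes f :: "'k \<Rightarrow> real"
  assumes "continuous_on K f" "\<And>x. x \<in> K \<Longrightarrow> 0 \<le> f x" "x \<in> K" "f x > 0"
  shows "(\<integral>x. f x \<partial>\<mu>) > 0"
proof -
  have "(\<integral>x. f x \<partial>\<mu>) \<ge> 0"
    by (rule integral_nonneg_AE) (use assms(2) in \<open>auto simp: space_\<mu>\<close>)
  moreover have "(\<integral>x. f x \<partial>\<mu>) \<noteq> 0"
  proof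
    assume "(\<integral>x. f x \<partial>\<mu>) = 0"
    then have "AE x in \<mu>. f x = 0"
      by (subst (asm) integral_nonneg_eq_0_iff_AE[OF continuous_integrable])
        (use assms in \<open>auto simp: space_\<mu>\<close>)
    then have "f x = 0"
      by (rule continuous_AE_eq[OF assms(1) continuous_on_const _ assms(3)])
    with assms(4) show False by simp
  qed
  ultimately show ?thesis by linarith
qed

end

section \<open>The Dirichlet form\<close>

lemma words_0: "words S 0 = {[]}"
  by (auto simp: words_def)

text \<open>The last letter belongs to the innermost map. Splitting it off expresses the energy of
  level \<open>Suc m\<close> by energies of level one inside the cells of level
  \<open>m\<close>.\<close>

lemma sum_words_Suc:
  fixes f :: "'i list \<Rightarrow> 'c::comm_monoid_add"
  shows "(\<Sum>w\<in>words S (Suc m). f w) = (\<Sum>w\<in>words S m. \<Sum>i\<in>S. f (w @ [i]))"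
proof -
  have "bij_betw (\<lambda>(w, i). w @ [i]) (words S m \<times> S) (words S (Suc m))"
  proof (rule bij_betw_imageI)
    show "(\<lambda>(w, i). w @ [i]) ` (words S m \<times> S) = words S (Suc m)"
    proof (intro equalityI subsetI)
      fix w assume "w \<in> words S (Suc m)"
      then have w: "length w = Suc m" "set w \<subseteq> S" by (auto simp: words_def)
      then have "w = butlast w @ [last w]" by (cases w) auto
      moreover have "butlast w \<in> words S m" "last w \<in> S"
        using w last_in_set[of w] by (fastforce simp: words_def dest: in_set_butlastD)+
      ultimately show "w \<in> (\<lambda>(w, i). w @ [i]) ` (words S m \<times> S)"
        by (intro image_eqI[of _ _ "(butlast w, last w)"]) auto
    qed (auto simp: words_def)
  qed (auto simp: inj_on_def)
  then have "(\<Sum>w\<in>words S (Suc m). f w) = (\<Sum>(w, i)\<in>words S m \<times> S. f (w @ [i]))"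
    by (subst sum.reindex_bij_betw[symmetric]) (auto intro!: sum.cong)
  then show ?thesis by (simp add: sum.cartesian_product)
qed

lemma finite_words: "finite S \<Longrightarrow> finite (words S m)"
  unfolding words_def using finite_lists_length_eq[of S m] by (simp add: conj_commute)

context fractal_structure
begin

abbreviation E :: "nat \<Rightarrow> ('k \<Rightarrow> real) \<Rightarrow> ('k \<Rightarrow> real) \<Rightarrow> real" where
  "E m u v \<equiv> Em S F V0 D r m u v"

abbreviation form :: "('k \<Rightarrow> real) \<Rightarrow> ('k \<Rightarrow> real) \<Rightarrow> real" where
  "form u v \<equiv> dirichlet_form S F V0 D r u v"

abbreviation dom :: "('k \<Rightarrow> real) set" where
  "dom \<equiv> form_domain K S F V0 D r"

abbreviation dom0 :: "('k \<Rightarrow> real) set" where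
  "dom0 \<equiv> form_domain0 K S F V0 D r"

section \<open>The matrix \<open>D\<close> and the energies of each level\<close>

lemma
  shows D_sym_ball: "\<forall>p\<in>V0. \<forall>q\<in>V0. D p q = D q p"
    and D_offdiag_ball: "\<forall>p\<in>V0. \<forall>q\<in>V0. p \<noteq> q \<longrightarrow> 0 \<le> D p q"
    and D_kernel_all: "\<forall>u. (\<forall>p\<in>V0. (\<Sum>q\<in>V0. D p q * u q) = 0) \<longleftrightarrow> (\<exists>c. \<forall>p\<in>V0. u p = c)"
    and E_min_all: "\<forall>u :: 'k \<Rightarrow> real. (\<exists>v. (\<forall>p\<in>V0. v p = u p) \<and> E 1 v v = E0 V0 D u u) \<and>
        (\<forall>v. (\<forall>p\<in>V0. v p = u p) \<longrightarrow> E0 V0 D u u \<le> E 1 v v)"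
  using harmonic_structure unfolding regular_harmonic_structure_def by - (elim conjE, assumption)+

lemma D_sym: "p \<in> V0 \<Longrightarrow> q \<in> V0 \<Longrightarrow> D p q = D q p"
  using D_sym_ball by blast

lemma D_offdiag: "p \<in> V0 \<Longrightarrow> q \<in> V0 \<Longrightarrow> p \<noteq> q \<Longrightarrow> 0 \<le> D p q"
  using D_offdiag_ball by blast

lemma D_kernel: "(\<forall>p\<in>V0. (\<Sum>q\<in>V0. D p q * u q) = 0) \<longleftrightarrow> (\<exists>c. \<forall>p\<in>V0. u p = c)"
  by (rule spec[OF D_kernel_all])

text \<open>\<open>v\<close> itself competes in the minimum for its own restriction to
  \<open>V0\<close>.\<close>

lemma E0_le_E1: "E0 V0 D v v \<le> E 1 v v"
  using E_min_all by blast

text \<open>Constants lie in the kernel of \<open>D\<close>.\<close>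

lemma D_row_sum: "p \<in> V0 \<Longrightarrow> (\<Sum>q\<in>V0. D p q) = 0"
  using D_kernel[of "\<lambda>_. 1"] by auto

lemma D_column_sum: "q \<in> V0 \<Longrightarrow> (\<Sum>p\<in>V0. D p q) = 0"
  using D_row_sum[of q] by (simp add: D_sym[of q] cong: sum.cong)

text \<open>Since rows and columns of \<open>D\<close> sum to 0, the terms \<open>u p * v p\<close>
  and \<open>u q * v q\<close> may be added for free and complete the product of differences. In
  this form energies can be compared edge by edge.\<close>

lemma E0_differences:
  fixes u v :: "'k \<Rightarrow> real"
  shows "E0 V0 D u v = (\<Sum>p\<in>V0. \<Sum>q\<in>V0. D p q * ((u p - u q) * (v p - v q))) / 2"
proof -
  have 1: "(\<Sum>p\<in>V0. \<Sum>q\<in>V0. D p q * (u p * v p)) = 0"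
    by (simp add: sum_distrib_right[symmetric] D_row_sum)
  have 2: "(\<Sum>p\<in>V0. \<Sum>q\<in>V0. D p q * (u q * v q)) = 0"
    by (subst sum.swap) (simp add: sum_distrib_right[symmetric] D_column_sum)
  have 3: "(\<Sum>p\<in>V0. \<Sum>q\<in>V0. D p q * (u q * v p)) = (\<Sum>p\<in>V0. \<Sum>q\<in>V0. D p q * (u p * v q))"
    by (subst sum.swap) (simp add: D_sym cong: sum.cong)
  have "(\<Sum>p\<in>V0. \<Sum>q\<in>V0. D p q * ((u p - u q) * (v p - v q))) =
     (\<Sum>p\<in>V0. \<Sum>q\<in>V0. D p q * (u p * v p)) + (\<Sum>p\<in>V0. \<Sum>q\<in>V0. D p q * (u q * v q))
     - (\<Sum>p\<in>V0. \<Sum>q\<in>V0. D p q * (u q * v p)) - (\<Sum>p\<in>V0. \<Sum>q\<in>V0. D p q * (u p * v q))"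
    by (simp add: sum.distrib[symmetric] sum_subtractf[symmetric] algebra_simps)
  then have "(\<Sum>p\<in>V0. \<Sum>q\<in>V0. D p q * ((u p - u q) * (v p - v q))) / 2 =
     - (\<Sum>p\<in>V0. \<Sum>q\<in>V0. D p q * (u p * v q))"
    unfolding 1 2 3 by simp
  also have "\<dots> = E0 V0 D u v"
    by (simp add: E0_def mult_ac)
  finally show ?thesis by simp
qed

text \<open>The diagonal entries of \<open>D\<close> are negative, but they meet vanishing differences.\<close>

lemma E0_monotone:
  fixes u v u' v' :: "'k \<Rightarrow> real"
  assumes "\<And>p q. p \<in> V0 \<Longrightarrow> q \<in> V0 \<Longrightarrow> (u p - u q) * (v p - v q) \<le> (u' p - u' q) * (v' p - v' q)"
  shows "E0 V0 D u v \<le> E0 V0 D u' v'"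
proof -
  have "D p q * ((u p - u q) * (v p - v q)) \<le> D p q * ((u' p - u' q) * (v' p - v' q))"
    if "p \<in> V0" "q \<in> V0" for p q
    using assms[OF that] D_offdiag[OF that] by (cases "p = q") (auto intro: mult_left_mono)
  then show ?thesis
    unfolding E0_differences by (intro divide_right_mono sum_mono) auto
qed

lemma E0_nonneg: "0 \<le> E0 V0 D u (u :: 'k \<Rightarrow> real)"
  using E0_monotone[of "\<lambda>_. 0" "\<lambda>_. 0" u u] by (simp add: E0_def)

text \<open>One term of the double sum of nonnegative terms is kept; the factor 2 undoes the halving
  in \<open>E0_differences\<close>.\<close>

lemma E0_edge:
  assumes "p \<in> V0" "q \<in> V0"
  shows "D p q * (u p - u q)\<^sup>2 \<le> 2 * E0 V0 D u (u :: 'k \<Rightarrow> real)"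
proof -
  have nn: "0 \<le> D p q * (u p - u q)\<^sup>2" if "p \<in> V0" "q \<in> V0" for p q
    using D_offdiag[OF that] by (cases "p = q") auto
  have "D p q * (u p - u q)\<^sup>2 \<le> (\<Sum>q\<in>V0. D p q * (u p - u q)\<^sup>2)"
    by (rule member_le_sum) (use assms nn finite_V0 in auto)
  also have "\<dots> \<le> (\<Sum>p\<in>V0. \<Sum>q\<in>V0. D p q * (u p - u q)\<^sup>2)"
    by (rule member_le_sum[where f = "\<lambda>p. \<Sum>q\<in>V0. D p q * (u p - u q)\<^sup>2"])
      (use assms nn finite_V0 in \<open>auto intro: sum_nonneg\<close>)
  finally show ?thesis
    by (simp add: E0_differences power2_eq_square)
qed

lemma r_word_pos: "set w \<subseteq> S \<Longrightarrow> 0 < prod_list (map r w)"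
  by (induction w) (auto intro: mult_pos_pos r_pos)

lemma E_cells: "E m u v = (\<Sum>w\<in>words S m. E0 V0 D (u \<circ> foldr F w) (v \<circ> foldr F w) / prod_list (map r w))"
  by (simp add: Em_def divide_inverse mult_ac)

lemma E_1: "E 1 u v = (\<Sum>i\<in>S. E0 V0 D (u \<circ> F i) (v \<circ> F i) / r i)"
proof -
  have "E 1 u v = E (Suc 0) u v" by simp
  also have "\<dots> = (\<Sum>i\<in>S. E0 V0 D (u \<circ> F i) (v \<circ> F i) / r i)"
    unfolding E_cells sum_words_Suc by (simp add: words_0)
  finally show ?thesis .
qed

text \<open>Self-similarity of the energies. Through it the one-step inequality
  \<open>E0_le_E1\<close> becomes monotonicity in \<open>m\<close>, and energy can be localised to a
  cell.\<close>

lemma E_Suc: "E (Suc m) u v = (\<Sum>w\<in>words S m. E 1 (u \<circ> foldr F w) (v \<circ> foldr F w) / prod_list (map r w))"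
proof -
  have "E (Suc m) u v = (\<Sum>w\<in>words S m. \<Sum>i\<in>S.
      E0 V0 D (u \<circ> (foldr F w \<circ> F i)) (v \<circ> (foldr F w \<circ> F i)) / (prod_list (map r w) * r i))"
    unfolding E_cells sum_words_Suc by (simp add: o_def)
  also have "\<dots> = (\<Sum>w\<in>words S m. E 1 (u \<circ> foldr F w) (v \<circ> foldr F w) / prod_list (map r w))"
    unfolding E_1 by (simp add: sum_divide_distrib o_assoc mult.commute)
  finally show ?thesis .
qed

text \<open>One comparison with two uses: with \<open>u = v\<close> and \<open>u' = v'\<close> it
  gives the contraction property, and with \<open>u\<close> and \<open>v\<close> zero it gives the
  sign of a mixed energy.\<close>

lemma E_monotone:
  assumes "\<And>p q. p \<in> K \<Longrightarrow> q \<in> K \<Longrightarrow> (u p - u q) * (v p - v q) \<le> (u' p - u' q) * (v' p - v' q)"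
  shows "E m u v \<le> E m u' v'"
  unfolding E_cells
proof (intro sum_mono divide_right_mono)
  fix w assume "w \<in> words S m"
  then have w: "set w \<subseteq> S" by (simp add: words_def)
  show "E0 V0 D (u \<circ> foldr F w) (v \<circ> foldr F w) \<le> E0 V0 D (u' \<circ> foldr F w) (v' \<circ> foldr F w)"
    by (rule E0_monotone) (use assms F_word_into[OF w] V0_subset in auto)
  show "0 \<le> prod_list (map r w)" using r_word_pos[OF w] by simp
qed

lemma E_nonneg: "0 \<le> E m u u"
  using E_monotone[of "\<lambda>_. 0" "\<lambda>_. 0" u u m] by (simp add: E_cells E0_def)

lemma E_le_Suc: "E m u u \<le> E (Suc m) u u"
proof -
  have "E0 V0 D (u \<circ> foldr F w) (u \<circ> foldr F w) / prod_list (map r w) \<le>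
      E 1 (u \<circ> foldr F w) (u \<circ> foldr F w) / prod_list (map r w)" if "w \<in> words S m" for w
    using that r_word_pos[of w] by (intro divide_right_mono E0_le_E1) (auto simp: words_def)
  then show ?thesis
    unfolding E_Suc by (subst E_cells) (rule sum_mono)
qed

lemma E_incseq: "incseq (\<lambda>m. E m u u)"
  by (rule incseq_SucI) (rule E_le_Suc)

lemma E_add_left: "E m (\<lambda>x. u x + v x) w = E m u w + E m v w"
  by (simp add: E_cells E0_def sum.distrib[symmetric] sum_negf[symmetric] o_def
      add_divide_distrib[symmetric] algebra_simps del: sum_negf)

lemma E_scale_left: "E m (\<lambda>x. c * u x) w = c * E m u w"
  by (simp add: E_cells E0_def sum_distrib_left o_def mult_ac)

lemma E_commute: "E m u w = E m w u"
  unfolding E_cells E0_differences by (simp add: mult_ac)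

lemma E_add_right: "E m w (\<lambda>x. u x + v x) = E m w u + E m w v"
  using E_add_left[of m u v w] by (simp add: E_commute)

lemma E_scale_right: "E m w (\<lambda>x. c * u x) = c * E m w u"
  using E_scale_left[of m c u w] by (simp add: E_commute)

text \<open>Membership in the domain only speaks of quadratic energies; polarization carries their
  convergence over to mixed ones.\<close>

lemma E_polarization: "E m u v = (E m (\<lambda>x. u x + v x) (\<lambda>x. u x + v x) - E m u u - E m v v) / 2"
  using E_commute[of m v u] by (simp add: E_add_left E_add_right)

text \<open>The parallelogram law with the energy of \<open>u - v\<close> discarded.\<close>

lemma E_add_le: "E m (\<lambda>x. u x + v x) (\<lambda>x. u x + v x) \<le> 2 * E m u u + 2 * E m v v"
proof -
  have "0 \<le> E m (\<lambda>x. u x + (-1) * v x) (\<lambda>x. u x + (-1) * v x)" by (rule E_nonneg)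
  also have "\<dots> = E m u u - 2 * E m u v + E m v v"
    unfolding E_add_left E_add_right E_scale_left E_scale_right using E_commute[of m v u] by simp
  finally show ?thesis
    unfolding E_add_left E_add_right using E_commute[of m v u] by simp
qed

section \<open>The form domain and the limit form\<close>

lemma dom_cont: "u \<in> dom \<Longrightarrow> continuous_on K u"
  by (simp add: form_domain_def)

lemma dom_E_tendsto: "u \<in> dom \<Longrightarrow> (\<lambda>m. E m u u) \<longlonglongrightarrow> form u u"
  by (simp add: form_domain_def energy_real dirichlet_form_def convergent_LIMSEQ_iff)

lemma E_le_form: "u \<in> dom \<Longrightarrow> E m u u \<le> form u u"
  by (rule incseq_le[OF E_incseq dom_E_tendsto])

text \<open>The energies increase with the level, so a bound that is uniform in \<open>m\<close>
  already makes them converge.\<close>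

lemma domI:
  assumes "continuous_on K u" "\<And>m. E m u u \<le> B"
  shows "u \<in> dom"
proof -
  obtain L where "(\<lambda>m. E m u u) \<longlonglongrightarrow> L"
    using incseq_convergent[OF E_incseq, of u B] assms(2) by blast
  then show ?thesis
    using assms(1) by (auto simp: form_domain_def energy_real convergent_def)
qed

lemma dom_add: "u \<in> dom \<Longrightarrow> v \<in> dom \<Longrightarrow> (\<lambda>x. u x + v x) \<in> dom"
proof (rule domI)
  assume u: "u \<in> dom" and v: "v \<in> dom"
  show "continuous_on K (\<lambda>x. u x + v x)" using u v by (intro continuous_on_add dom_cont)
  fix m
  show "E m (\<lambda>x. u x + v x) (\<lambda>x. u x + v x) \<le> 2 * form u u + 2 * form v v"
    using E_add_le[of m u v] E_le_form[OF u, of m] E_le_form[OF v, of m] by linarith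
qed

lemma dom_scale: "u \<in> dom \<Longrightarrow> (\<lambda>x. c * u x) \<in> dom"
proof (rule domI)
  assume u: "u \<in> dom"
  show "continuous_on K (\<lambda>x. c * u x)" using u by (intro continuous_intros dom_cont)
  fix m
  have "E m (\<lambda>x. c * u x) (\<lambda>x. c * u x) = c\<^sup>2 * E m u u"
    unfolding E_scale_left E_scale_right by (simp add: power2_eq_square)
  also have "\<dots> \<le> c\<^sup>2 * form u u"
    by (intro mult_left_mono E_le_form[OF u]) simp
  finally show "E m (\<lambda>x. c * u x) (\<lambda>x. c * u x) \<le> c\<^sup>2 * form u u" .
qed

lemma dom_const: "(\<lambda>_. c) \<in> dom"
  by (rule domI[where B = 0]) (simp_all add: E_cells E0_differences)

lemma dom_sum: "finite A \<Longrightarrow> (\<And>i. i \<in> A \<Longrightarrow> f i \<in> dom) \<Longrightarrow> (\<lambda>x. \<Sum>i\<in>A. f i x) \<in> dom"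
  by (induction A rule: finite_induct) (auto intro: dom_const dom_add)

lemma dom_diff: "u \<in> dom \<Longrightarrow> v \<in> dom \<Longrightarrow> (\<lambda>x. u x - v x) \<in> dom"
  using dom_add[OF _ dom_scale[of v "-1"]] by simp

text \<open>The Markov property: a 1-Lipschitz map shrinks every difference, and energies are
  weighted sums of squared differences. It admits truncations as test functions.\<close>

lemma dom_contraction:
  assumes "u \<in> dom" "continuous_on UNIV \<psi>" "\<And>a b. \<bar>\<psi> a - \<psi> b\<bar> \<le> \<bar>a - b :: real\<bar>"
  shows "(\<lambda>x. \<psi> (u x)) \<in> dom"
proof (rule domI)
  show "continuous_on K (\<lambda>x. \<psi> (u x))"
    using continuous_on_compose[OF dom_cont[OF assms(1)] continuous_on_subset[OF assms(2)]]
    by (simp add: o_def)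
  fix m
  have "E m (\<lambda>x. \<psi> (u x)) (\<lambda>x. \<psi> (u x)) \<le> E m u u"
    by (rule E_monotone)
      (use assms(3) in \<open>simp add: power2_eq_square[symmetric] abs_le_square_iff[symmetric]\<close>)
  also have "\<dots> \<le> form u u" by (rule E_le_form) fact
  finally show "E m (\<lambda>x. \<psi> (u x)) (\<lambda>x. \<psi> (u x)) \<le> form u u" .
qed

lemma E_tendsto:
  assumes "u \<in> dom" "v \<in> dom"
  shows "(\<lambda>m. E m u v) \<longlonglongrightarrow> form u v"
proof -
  have "(\<lambda>m. E m u v) \<longlonglongrightarrow>
      (form (\<lambda>x. u x + v x) (\<lambda>x. u x + v x) - form u u - form v v) / 2"
    unfolding E_polarization[of _ u v]
    by (intro tendsto_intros dom_E_tendsto dom_add assms) simp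
  then show ?thesis by (simp add: dirichlet_form_def limI)
qed

lemma form_add_left:
  assumes "u \<in> dom" "v \<in> dom" "w \<in> dom"
  shows "form (\<lambda>x. u x + v x) w = form u w + form v w"
proof (rule LIMSEQ_unique)
  show "(\<lambda>m. E m (\<lambda>x. u x + v x) w) \<longlonglongrightarrow> form (\<lambda>x. u x + v x) w"
    by (intro E_tendsto dom_add assms)
  show "(\<lambda>m. E m (\<lambda>x. u x + v x) w) \<longlonglongrightarrow> form u w + form v w"
    unfolding E_add_left by (intro tendsto_add E_tendsto assms)
qed

lemma form_scale_left:
  assumes "u \<in> dom" "w \<in> dom"
  shows "form (\<lambda>x. c * u x) w = c * form u w"
proof (rule LIMSEQ_unique)
  show "(\<lambda>m. E m (\<lambda>x. c * u x) w) \<longlonglongrightarrow> form (\<lambda>x. c * u x) w"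
    by (intro E_tendsto dom_scale assms)
  show "(\<lambda>m. E m (\<lambda>x. c * u x) w) \<longlonglongrightarrow> c * form u w"
    unfolding E_scale_left by (intro tendsto_mult tendsto_const E_tendsto assms)
qed

lemma form_commute: "form u v = form v u"
  by (simp add: dirichlet_form_def E_commute)

lemma form_zero_left: "form (\<lambda>_. 0) w = 0"
proof -
  have "E m (\<lambda>_. 0) w = 0" for m by (simp add: E_cells E0_def)
  then show ?thesis by (simp add: dirichlet_form_def)
qed

lemma form_sum_left:
  assumes "finite A" "\<And>i. i \<in> A \<Longrightarrow> f i \<in> dom" "w \<in> dom"
  shows "form (\<lambda>x. \<Sum>i\<in>A. f i x) w = (\<Sum>i\<in>A. form (f i) w)"
  using assms by (induction A rule: finite_induct) (simp_all add: form_zero_left form_add_left dom_sum)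

lemma form_diff_left:
  assumes "u \<in> dom" "v \<in> dom" "w \<in> dom"
  shows "form (\<lambda>x. u x - v x) w = form u w - form v w"
  using form_add_left[OF assms(1) dom_scale[OF assms(2), of "-1"] assms(3)]
    form_scale_left[OF assms(2,3), of "-1"] by simp

lemma form_nonneg: "u \<in> dom \<Longrightarrow> 0 \<le> form u u"
  using E_le_form[of u 0] E_nonneg[of 0 u] by linarith

lemma form_monotone_nonneg:
  assumes "u \<in> dom" "v \<in> dom" "\<And>p q. p \<in> K \<Longrightarrow> q \<in> K \<Longrightarrow> 0 \<le> (u p - u q) * (v p - v q)"
  shows "0 \<le> form u v"
proof (rule LIMSEQ_le_const[OF E_tendsto[OF assms(1,2)]])
  have "0 \<le> E m u v" for m
    using E_monotone[of "\<lambda>_. 0" "\<lambda>_. 0" u v m] assms(3) by (simp add: E_cells E0_def)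
  then show "\<exists>N. \<forall>n\<ge>N. 0 \<le> E n u v" by blast
qed

lemma dom0_D: "u \<in> dom0 \<Longrightarrow> u \<in> dom" "u \<in> dom0 \<Longrightarrow> p \<in> V0 \<Longrightarrow> u p = 0"
  by (auto simp: form_domain0_def)

lemma dom0I: "u \<in> dom \<Longrightarrow> (\<And>p. p \<in> V0 \<Longrightarrow> u p = 0) \<Longrightarrow> u \<in> dom0"
  by (auto simp: form_domain0_def)

end

section \<open>Connectedness and the sup-norm estimate\<close>

context fractal_structure
begin

lemma bounded_integrable:
  fixes f :: "'k \<Rightarrow> 'c::{banach, second_countable_topology}"
  assumes "f \<in> borel_measurable \<mu>" "\<And>x. x \<in> K \<Longrightarrow> norm (f x) \<le> B"
  shows "integrable \<mu> f"
  by (rule integrable_const_bound[where B = B]) (use assms in \<open>auto simp: space_\<mu>\<close>)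

lemma Lp_norm_2:
  fixes f :: "'k \<Rightarrow> real"
  assumes "f \<in> borel_measurable \<mu>" "integrable \<mu> (\<lambda>x. (f x)\<^sup>2)"
  shows "Lp_norm \<mu> 2 f = ennreal (sqrt (\<integral>x. (f x)\<^sup>2 \<partial>\<mu>))"
proof -
  have "ennreal (norm (f x) powr enn2real 2) = ennreal ((f x)\<^sup>2)" for x
    by (simp add: powr_numeral)
  then have "(\<integral>\<^sup>+x. ennreal (norm (f x) powr enn2real 2) \<partial>\<mu>) = (\<integral>\<^sup>+x. ennreal ((f x)\<^sup>2) \<partial>\<mu>)"
    by simp
  also have "\<dots> = ennreal (\<integral>x. (f x)\<^sup>2 \<partial>\<mu>)"
    by (rule nn_integral_eq_integral[OF assms(2)]) simp
  finally show ?thesis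
    by (simp add: Lp_norm_def powr_half_sqrt)
qed

text \<open>That the kernel of \<open>D\<close> consists of the constants means that the graph of
  positive entries is connected: the indicator of a set without positive edges to its complement
  lies in the kernel. Edge estimates are then added up along paths from \<open>p0\<close>.\<close>

lemma V0_differences:
  obtains C where "C \<ge> 0" "\<And>v :: 'k \<Rightarrow> real. \<And>p q. p \<in> V0 \<Longrightarrow> q \<in> V0 \<Longrightarrow> \<bar>v p - v q\<bar> \<le> C * sqrt (E0 V0 D v v)"
proof -
  obtain p0 where p0: "p0 \<in> V0" using V0_nonempty by blast
  \<comment> \<open>The points that can be compared with \<open>p0\<close>. The set contains
    \<open>p0\<close> and is closed under edges of positive weight, which is all that the kernel
    argument uses.\<close>
  define A where "A = {q \<in> V0. \<exists>C\<ge>0. \<forall>v :: 'k \<Rightarrow> real. \<bar>v p0 - v q\<bar> \<le> C * sqrt (E0 V0 D v v)}"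
  have p0A: "p0 \<in> A" using p0 by (auto simp: A_def intro!: exI[of _ 0])
  have step: "q' \<in> A" if q: "q \<in> A" and q': "q' \<in> V0" and pos: "D q q' > 0" for q q'
  proof -
    obtain C where C: "C \<ge> 0" "\<And>v :: 'k \<Rightarrow> real. \<bar>v p0 - v q\<bar> \<le> C * sqrt (E0 V0 D v v)"
      using q by (auto simp: A_def)
    have "\<bar>v p0 - v q'\<bar> \<le> (C + sqrt (2 / D q q')) * sqrt (E0 V0 D v v)" for v :: "'k \<Rightarrow> real"
    proof -
      have "(v q - v q')\<^sup>2 \<le> 2 / D q q' * E0 V0 D v v"
        using E0_edge[of q q' v] q q' pos by (auto simp: A_def field_simps)
      then have "\<bar>v q - v q'\<bar> \<le> sqrt (2 / D q q' * E0 V0 D v v)"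
        by (metis real_sqrt_abs real_sqrt_le_iff)
      then have "\<bar>v q - v q'\<bar> \<le> sqrt (2 / D q q') * sqrt (E0 V0 D v v)"
        by (simp only: real_sqrt_mult)
      then show ?thesis using C(2)[of v] by (simp add: distrib_right)
    qed
    moreover have "0 \<le> C + sqrt (2 / D q q')" using C pos by simp
    ultimately show ?thesis using q' unfolding A_def by blast
  qed
  have zero: "D q q' = 0" if "q \<in> A" "q' \<in> V0 - A" for q q'
  proof -
    have "q \<in> V0" "q' \<in> V0" "q \<noteq> q'" using that by (auto simp: A_def)
    then show ?thesis using D_offdiag[of q q'] step[of q q'] that by force
  qed
  have "\<forall>p\<in>V0. (\<Sum>q\<in>V0. D p q * indicator A q) = 0"
  proof
    fix p assume p: "p \<in> V0"
    show "(\<Sum>q\<in>V0. D p q * indicator A q) = 0"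
    proof (cases "p \<in> A")
      case True
      have "(\<Sum>q\<in>V0. D p q * indicator A q) = (\<Sum>q\<in>V0. D p q)"
        by (rule sum.cong) (use zero[OF True] in \<open>auto simp: indicator_def\<close>)
      then show ?thesis using D_row_sum[OF p] by simp
    next
      case False
      show ?thesis
        by (rule sum.neutral) (use zero[of _ p] p False D_sym[OF p] in \<open>auto simp: indicator_def\<close>)
    qed
  qed
  then obtain c :: real where c: "\<forall>p\<in>V0. indicator A p = c"
    using D_kernel[of "indicator A"] by blast
  then have "c = 1" using p0 p0A by auto
  then have "\<forall>q\<in>V0. q \<in> A" using c by (auto simp: indicator_def split: if_splits)
  then have "\<forall>q\<in>V0. \<exists>C\<ge>0. \<forall>v :: 'k \<Rightarrow> real. \<bar>v p0 - v q\<bar> \<le> C * sqrt (E0 V0 D v v)"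
    by (auto simp: A_def)
  then obtain C where C: "\<And>q. q \<in> V0 \<Longrightarrow> C q \<ge> 0"
      "\<And>q (v :: 'k \<Rightarrow> real). q \<in> V0 \<Longrightarrow> \<bar>v p0 - v q\<bar> \<le> C q * sqrt (E0 V0 D v v)"
    by metis
  show thesis
  proof
    \<comment> \<open>The sum of the constants dominates each of them; the factor 2 comes from the
      detour from \<open>p\<close> to \<open>q\<close> through \<open>p0\<close>.\<close>
    show "2 * (\<Sum>q\<in>V0. C q) \<ge> 0" using C(1) by (simp add: sum_nonneg)
    fix v :: "'k \<Rightarrow> real" and p q assume pq: "p \<in> V0" "q \<in> V0"
    have *: "\<bar>v p0 - v q\<bar> \<le> (\<Sum>q\<in>V0. C q) * sqrt (E0 V0 D v v)" if "q \<in> V0" for q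
    proof -
      have "C q \<le> (\<Sum>q\<in>V0. C q)" by (rule member_le_sum) (use that C(1) finite_V0 in auto)
      then have "C q * sqrt (E0 V0 D v v) \<le> (\<Sum>q\<in>V0. C q) * sqrt (E0 V0 D v v)"
        by (rule mult_right_mono) (simp add: E0_nonneg)
      then show ?thesis using C(2)[OF that, of v] by linarith
    qed
    show "\<bar>v p - v q\<bar> \<le> 2 * (\<Sum>q\<in>V0. C q) * sqrt (E0 V0 D v v)"
      using *[OF pq(1)] *[OF pq(2)] by (simp add: algebra_simps)
  qed
qed

text \<open>The common point is critical, so the one-letter word \<open>[i]\<close> witnesses that
  \<open>a\<close> is a boundary point.\<close>

lemma cells_meet_in_V0:
  assumes "i \<in> S" "j \<in> S" "i \<noteq> j" "a \<in> K" "b \<in> K" "F i a = F j b"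
  shows "a \<in> V0"
proof -
  have "F i a \<in> critical_set K S F"
    using assms unfolding critical_set_def by blast
  then have "foldr F [i] a \<in> critical_set K S F" by simp
  then show ?thesis
    using assms unfolding V0_eq boundary_set_def by (intro CollectI conjI exI[of _ "[i]"]) auto
qed

text \<open>A word \<open>w\<close> that carries \<open>F i a\<close> into the critical set extends
  to \<open>w @ [i]\<close>, which carries \<open>a\<close> there.\<close>

lemma V0_preimage:
  assumes "i \<in> S" "a \<in> K" "F i a \<in> V0"
  shows "a \<in> V0"
proof -
  obtain w where "set w \<subseteq> S" "foldr F w (F i a) \<in> critical_set K S F"
    using assms(3) unfolding V0_eq boundary_set_def by blast
  then have "w @ [i] \<noteq> [] \<and> set (w @ [i]) \<subseteq> S \<and> foldr F (w @ [i]) a \<in> critical_set K S F"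
    using assms(1) by simp
  then show ?thesis
    using assms(2) unfolding V0_eq boundary_set_def by blast
qed

lemma K_cells: "K = (\<Union>i\<in>S. F i ` K)"
proof (intro equalityI subsetI)
  fix x assume "x \<in> K"
  then obtain \<omega> where \<omega>: "\<omega> \<in> UNIV \<rightarrow> S" "x = \<pi> \<omega>" using \<pi>_image by blast
  have 0: "\<omega> 0 \<in> S" and s: "(\<lambda>n. \<omega> (Suc n)) \<in> UNIV \<rightarrow> S" using \<omega> by auto
  have "\<omega> = case_nat (\<omega> 0) (\<lambda>n. \<omega> (Suc n))" by (auto split: nat.split)
  then have "x = F (\<omega> 0) (\<pi> (\<lambda>n. \<omega> (Suc n)))" using \<pi>_Cons[OF 0 s] \<omega>(2) by simp
  then show "x \<in> (\<Union>i\<in>S. F i ` K)" using 0 \<pi>_in_K[OF s] by blast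
qed (auto intro: F_into)

text \<open>From level one on, each word keeps all its points inside a single cell of level one,
  where \<open>v\<close> has no differences. Level 0 compares points of \<open>V0\<close> from
  different cells and is therefore left out.\<close>

lemma E_cell_constant:
  assumes "\<And>i x y. i \<in> S \<Longrightarrow> x \<in> F i ` K \<Longrightarrow> y \<in> F i ` K \<Longrightarrow> v x = v y"
  shows "E (Suc m) u v = 0"
  unfolding E_cells
proof (rule sum.neutral, rule ballI)
  fix w assume "w \<in> words S (Suc m)"
  then obtain i w' where w: "w = i # w'" "i \<in> S" "set w' \<subseteq> S"
    by (auto simp: words_def length_Suc_conv)
  have "v (foldr F w p) = v (foldr F w q)" if "p \<in> V0" "q \<in> V0" for p q
    unfolding w(1) foldr.simps o_apply
    by (rule assms[OF w(2)]) (use that V0_subset F_word_into[OF w(3)] in auto)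
  then have *: "(v \<circ> foldr F w) p - (v \<circ> foldr F w) q = 0" if "p \<in> V0" "q \<in> V0" for p q
    using that unfolding o_apply right_minus_eq by blast
  have "E0 V0 D (u \<circ> foldr F w) (v \<circ> foldr F w) = 0"
    unfolding E0_differences by (simp add: * del: o_apply cong: sum.cong)
  then show "E0 V0 D (u \<circ> foldr F w) (v \<circ> foldr F w) / prod_list (map r w) = 0" by simp
qed

text \<open>The weights \<open>1 / r i\<close> exceed 1 and all terms are nonnegative, so a single
  unweighted cell stays below the whole sum.\<close>

lemma E0_cell_le: "i \<in> S \<Longrightarrow> E0 V0 D (v \<circ> F i) (v \<circ> F i) \<le> E 1 v v"
proof -
  assume i: "i \<in> S"
  have "E0 V0 D (v \<circ> F i) (v \<circ> F i) \<le> E0 V0 D (v \<circ> F i) (v \<circ> F i) / r i"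
    using divide_left_mono[of "r i" 1 "E0 V0 D (v \<circ> F i) (v \<circ> F i)"] r_pos[OF i] r_less_1[OF i] E0_nonneg
    by simp
  also have "\<dots> \<le> E 1 v v"
    unfolding E_1
    by (rule member_le_sum[where f = "\<lambda>i. E0 V0 D (v \<circ> F i) (v \<circ> F i) / r i"])
      (use i finite_S E0_nonneg r_pos in \<open>auto intro: divide_nonneg_pos\<close>)
  finally show ?thesis .
qed

text \<open>The factor \<open>prod_list (map r w)\<close> is the gain on deep cells that makes the
  telescoping sum in \<open>sup_norm_le_form\<close> geometric.\<close>

lemma E1_cell_le:
  assumes "w \<in> words S m"
  shows "E 1 (v \<circ> foldr F w) (v \<circ> foldr F w) \<le> prod_list (map r w) * E (Suc m) v v"
proof -
  have "E 1 (v \<circ> foldr F w) (v \<circ> foldr F w) / prod_list (map r w) \<le> E (Suc m) v v"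
    unfolding E_Suc
    by (rule member_le_sum[where f = "\<lambda>w. E 1 (v \<circ> foldr F w) (v \<circ> foldr F w) / prod_list (map r w)"])
      (use assms finite_words[OF finite_S] E_nonneg r_word_pos in \<open>auto simp: words_def intro!: divide_nonneg_pos\<close>)
  then show ?thesis
    using r_word_pos[of w] assms by (simp add: words_def field_simps)
qed

text \<open>On words, the cell map of \<open>w\<close> is prefixing by \<open>w\<close>.\<close>

lemma foldr_F_\<pi>:
  "set w \<subseteq> S \<Longrightarrow> \<sigma> \<in> UNIV \<rightarrow> S \<Longrightarrow>
    foldr case_nat w \<sigma> \<in> UNIV \<rightarrow> S \<and> \<pi> (foldr case_nat w \<sigma>) = foldr F w (\<pi> \<sigma>)"
proof (induction w)
  case (Cons i w)
  then have "foldr case_nat w \<sigma> \<in> UNIV \<rightarrow> S" "i \<in> S" by auto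
  moreover from this have "case_nat i (foldr case_nat w \<sigma>) \<in> UNIV \<rightarrow> S"
    by (auto simp: Pi_iff split: nat.split)
  ultimately show ?case using Cons by (simp add: \<pi>_Cons)
qed simp

lemma foldr_case_nat_nth: "k < length w \<Longrightarrow> foldr case_nat w \<sigma> k = w ! k"
  by (induction w arbitrary: k) (auto split: nat.split simp: nth_Cons)

text \<open>These points are images under \<pi> of words that agree with \<omega> on longer and
  longer prefixes.\<close>

lemma word_points_tendsto:
  assumes \<omega>: "\<omega> \<in> UNIV \<rightarrow> S" and p: "p \<in> K"
  shows "(\<lambda>m. foldr F (map \<omega> [0..<m]) p) \<longlonglongrightarrow> \<pi> \<omega>"
proof (rule topological_tendstoI)
  fix G assume G: "open G" "\<pi> \<omega> \<in> G"
  obtain \<sigma> where \<sigma>: "\<sigma> \<in> UNIV \<rightarrow> S" "p = \<pi> \<sigma>" using p \<pi>_image by blast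
  obtain n where n: "\<forall>\<omega>'\<in>UNIV \<rightarrow> S. (\<forall>k<n. \<omega>' k = \<omega> k) \<longrightarrow> \<pi> \<omega>' \<in> G"
    using \<pi>_cylinder[OF \<omega> G] by blast
  show "\<forall>\<^sub>F m in sequentially. foldr F (map \<omega> [0..<m]) p \<in> G"
    using eventually_ge_at_top[of n]
  proof eventually_elim
    case (elim m)
    have "set (map \<omega> [0..<m]) \<subseteq> S" using \<omega> by auto
    from foldr_F_\<pi>[OF this \<sigma>(1)] have *: "foldr case_nat (map \<omega> [0..<m]) \<sigma> \<in> UNIV \<rightarrow> S"
      "\<pi> (foldr case_nat (map \<omega> [0..<m]) \<sigma>) = foldr F (map \<omega> [0..<m]) p" using \<sigma>(2) by auto
    moreover have "foldr case_nat (map \<omega> [0..<m]) \<sigma> k = \<omega> k" if "k < n" for k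
      using that elim by (simp add: foldr_case_nat_nth)
    ultimately show ?case using n by metis
  qed
qed

end

locale fractal_eigensystem = fractal_structure K S F \<pi> V0 D r d \<mu>
  for K :: "'k::metric_space set" and S :: "'i set" and F \<pi> V0 D r d \<mu> +
  fixes lam :: "nat \<Rightarrow> real" and \<phi> :: "nat \<Rightarrow> 'k \<Rightarrow> real"
  assumes eigensystem: "dirichlet_eigensystem K S F V0 D r \<mu> lam \<phi>"
begin

section \<open>First consequences of the eigensystem\<close>

lemma
  shows lam_0_pos: "0 < lam 0" and lam_mono: "mono lam"
    and \<phi>_props: "\<forall>n. has_laplacian K S F V0 D r \<mu> (\<phi> n) (\<lambda>x. - lam n * \<phi> n x) \<and> (\<forall>p\<in>V0. \<phi> n p = 0)"
    and \<phi>_orthonormal_all: "\<forall>m n. (\<integral>x. \<phi> m x * \<phi> n x \<partial>\<mu>) = (if m = n then 1 else 0)"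
    and \<phi>_complete: "\<forall>f\<in>Lp_space \<mu> 2.
        (\<lambda>N. Lp_norm \<mu> 2 (\<lambda>x. f x - (\<Sum>n<N. (\<integral>y. f y * \<phi> n y \<partial>\<mu>) * \<phi> n x))) \<longlonglongrightarrow> 0"
  using eigensystem unfolding dirichlet_eigensystem_def by - (elim conjE, assumption)+

lemma lam_pos: "0 < lam n"
  using lam_0_pos monoD[OF lam_mono, of 0 n] by simp

lemma \<phi>_orthonormal: "(\<integral>x. \<phi> m x * \<phi> n x \<partial>\<mu>) = (if m = n then 1 else 0)"
  using \<phi>_orthonormal_all by blast

lemma \<phi>_laplacian: "has_laplacian K S F V0 D r \<mu> (\<phi> n) (\<lambda>x. - lam n * \<phi> n x)"
  using \<phi>_props by blast

lemma \<phi>_dom0: "\<phi> n \<in> dom0"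
  using \<phi>_props by (auto simp: form_domain0_def has_laplacian_def)

lemma \<phi>_dom: "\<phi> n \<in> dom"
  using \<phi>_dom0 by (rule dom0_D)

lemma \<phi>_cont: "continuous_on K (\<phi> n)"
  by (rule dom_cont[OF \<phi>_dom])

lemma form_\<phi>: "v \<in> dom0 \<Longrightarrow> form (\<phi> n) v = lam n * (\<integral>x. v x * \<phi> n x \<partial>\<mu>)"
  using \<phi>_laplacian[of n] unfolding has_laplacian_def by (simp add: mult_ac)

definition coeff :: "('k \<Rightarrow> real) \<Rightarrow> nat \<Rightarrow> real" where
  "coeff f n = (\<integral>x. f x * \<phi> n x \<partial>\<mu>)"

text \<open>For bounded functions the extended-valued norm of the completeness assumption is a real
  square root, so convergence passes to the integrals of the squares.\<close>

lemma L2_complete: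
  assumes f: "f \<in> borel_measurable \<mu>" "\<And>x. x \<in> K \<Longrightarrow> \<bar>f x\<bar> \<le> B"
  shows "(\<lambda>N. \<integral>x. (f x - (\<Sum>n<N. coeff f n * \<phi> n x))\<^sup>2 \<partial>\<mu>) \<longlonglongrightarrow> 0"
proof -
  have sq: "integrable \<mu> (\<lambda>x. (f x)\<^sup>2)"
    by (rule bounded_integrable[where B = "B\<^sup>2"]) (use f power_mono[of "\<bar>f _\<bar>" B 2] in auto)
  have "Lp_norm \<mu> 2 f < \<infinity>" by (simp add: Lp_norm_2[OF f(1) sq])
  then have "f \<in> Lp_space \<mu> 2" using f(1) by (simp add: Lp_space_def)
  then have *: "(\<lambda>N. Lp_norm \<mu> 2 (\<lambda>x. f x - (\<Sum>n<N. coeff f n * \<phi> n x))) \<longlonglongrightarrow> 0"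
    using \<phi>_complete unfolding coeff_def by blast
  let ?I = "\<lambda>N. \<integral>x. (f x - (\<Sum>n<N. coeff f n * \<phi> n x))\<^sup>2 \<partial>\<mu>"
  have "Lp_norm \<mu> 2 (\<lambda>x. f x - (\<Sum>n<N. coeff f n * \<phi> n x)) = ennreal (sqrt (?I N))" for N
  proof (rule Lp_norm_2)
    have cont: "continuous_on K (\<lambda>x. \<Sum>n<N. coeff f n * \<phi> n x)"
      by (intro continuous_intros \<phi>_cont)
    then show meas: "(\<lambda>x. f x - (\<Sum>n<N. coeff f n * \<phi> n x)) \<in> borel_measurable \<mu>"
      by (intro borel_measurable_diff f continuous_measurable)
    obtain C where C: "C > 0" "\<And>x. x \<in> K \<Longrightarrow> norm (\<Sum>n<N. coeff f n * \<phi> n x) \<le> C"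
      using continuous_bounded[OF cont] by blast
    have bd: "\<bar>f x - (\<Sum>n<N. coeff f n * \<phi> n x)\<bar> \<le> B + C" if "x \<in> K" for x
      using f(2)[OF that] C(2)[OF that] unfolding real_norm_def by linarith
    show "integrable \<mu> (\<lambda>x. (f x - (\<Sum>n<N. coeff f n * \<phi> n x))\<^sup>2)"
    proof (rule bounded_integrable[where B = "(B + C)\<^sup>2"])
      show "(\<lambda>x. (f x - (\<Sum>n<N. coeff f n * \<phi> n x))\<^sup>2) \<in> borel_measurable \<mu>"
        using meas by (rule borel_measurable_power)
      show "norm ((f x - (\<Sum>n<N. coeff f n * \<phi> n x))\<^sup>2) \<le> (B + C)\<^sup>2" if "x \<in> K" for x
        using power_mono[OF bd[OF that], of 2] by simp
    qed
  qed
  with * have "(\<lambda>N. ennreal (sqrt (?I N))) \<longlonglongrightarrow> ennreal 0" by simp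
  then have "(\<lambda>N. sqrt (?I N)) \<longlonglongrightarrow> 0"
    by (subst (asm) tendsto_ennreal_iff) auto
  then have "(\<lambda>N. (sqrt (?I N))\<^sup>2) \<longlonglongrightarrow> 0\<^sup>2" by (rule tendsto_power)
  then show ?thesis by simp
qed

text \<open>If the cells did not form a chain reaching \<open>V0\<close>, the indicator of a union of cells would be
  a function of zero energy vanishing on \<open>V0\<close>, hence orthogonal to all eigenfunctions.\<close>

lemma cells_connected:
  assumes p0: "p0 \<in> V0"
  obtains C where "C \<ge> 0" "\<And>i v. i \<in> S \<Longrightarrow> \<bar>v (F i p0) - v p0\<bar> \<le> C * sqrt (E 1 v v)"
proof -
  obtain C0 where C0: "C0 \<ge> 0" and C0_le: "\<And>v :: 'k \<Rightarrow> real. \<And>p q. p \<in> V0 \<Longrightarrow> q \<in> V0 \<Longrightarrow> \<bar>v p - v q\<bar> \<le> C0 * sqrt (E0 V0 D v v)"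
    using V0_differences by blast
  have in_cell: "\<bar>v (F i q) - v (F i q')\<bar> \<le> C0 * sqrt (E 1 v v)"
    if "i \<in> S" "q \<in> V0" "q' \<in> V0" for v i q q'
  proof -
    have "\<bar>v (F i q) - v (F i q')\<bar> \<le> C0 * sqrt (E0 V0 D (v \<circ> F i) (v \<circ> F i))"
      using C0_le[OF that(2,3), of "v \<circ> F i"] by simp
    also have "\<dots> \<le> C0 * sqrt (E 1 v v)"
      by (intro mult_left_mono real_sqrt_le_mono E0_cell_le that C0)
    finally show ?thesis .
  qed
  have in_V0: "\<bar>v p - v q\<bar> \<le> C0 * sqrt (E 1 v v)" if "p \<in> V0" "q \<in> V0" for v p q
    using C0_le[OF that, of v] mult_left_mono[OF real_sqrt_le_mono[OF E0_le_E1[of v]] C0] by linarith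
  \<comment> \<open>A cell is good if its boundary values are controlled by the value at
    \<open>p0\<close>, with a constant independent of \<open>v\<close>.\<close>
  define good where "good i \<longleftrightarrow> (\<exists>C\<ge>0. \<forall>v. \<forall>q\<in>V0. \<bar>v (F i q) - v p0\<bar> \<le> C * sqrt (E 1 v v))" for i
  have goodI: "good i" if "i \<in> S" "a \<in> V0" "C \<ge> 0" "\<And>v. \<bar>v (F i a) - v p0\<bar> \<le> C * sqrt (E 1 v v)" for i a C
    unfolding good_def
  proof (intro exI[of _ "C0 + C"] conjI allI ballI)
    show "0 \<le> C0 + C" using C0 that(3) by simp
    fix v q assume "q \<in> V0"
    show "\<bar>v (F i q) - v p0\<bar> \<le> (C0 + C) * sqrt (E 1 v v)"
      using in_cell[OF that(1) \<open>q \<in> V0\<close> that(2), of v] that(4)[of v] by (simp add: distrib_right)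
  qed
  have "\<forall>i\<in>S. good i"
  proof (rule ccontr)
    assume "\<not> ?thesis"
    then obtain i0 where i0: "i0 \<in> S" "\<not> good i0" by blast
    define A where "A = (\<Union>i\<in>{i \<in> S. \<not> good i}. F i ` K)"
    define B where "B = (\<Union>i\<in>{i \<in> S. good i}. F i ` K)"
    have cpt: "compact A" "compact B"
      unfolding A_def B_def
      by (intro compact_UN; use finite_S compact_continuous_image[OF F_cont compact_K] in auto)+
    have "(\<Union>i\<in>S. F i ` K) = A \<union> B" unfolding A_def B_def by blast
    with K_cells have KAB: "K = A \<union> B" by (rule trans)
    \<comment> \<open>A point shared by a bad and a good cell is the image of a point of
      \<open>V0\<close> in each of them, so the bound of the good cell passes to the bad
      one.\<close>
    have disj: "A \<inter> B = {}"
    proof (rule ccontr)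
      assume "A \<inter> B \<noteq> {}"
      then obtain x where "x \<in> A" "x \<in> B" by blast
      then obtain i a j b where ij: "i \<in> S" "\<not> good i" "j \<in> S" "good j" "a \<in> K" "b \<in> K" "F i a = F j b"
        unfolding A_def B_def by auto
      then have "i \<noteq> j" by blast
      then have a: "a \<in> V0" and b: "b \<in> V0"
        using cells_meet_in_V0[of i j a b] cells_meet_in_V0[of j i b a] ij by auto
      obtain C where C: "C \<ge> 0" "\<And>v q. q \<in> V0 \<Longrightarrow> \<bar>v (F j q) - v p0\<bar> \<le> C * sqrt (E 1 v v)"
        using ij(4) unfolding good_def by blast
      have "\<bar>v (F i a) - v p0\<bar> \<le> C * sqrt (E 1 v v)" for v
        unfolding ij(7) by (rule C(2)[OF b])
      then have "good i" by (rule goodI[OF ij(1) a C(1)])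
      then show False using ij(2) by simp
    qed
    \<comment> \<open>If \<open>F i a\<close> lies in \<open>V0\<close>, so does \<open>a\<close>,
      and \<open>in_V0\<close> compares \<open>F i a\<close> with \<open>p0\<close>; hence no bad
      cell contains a point of \<open>V0\<close>.\<close>
    have V0A: "p \<notin> A" if p: "p \<in> V0" for p
    proof
      assume "p \<in> A"
      then obtain i a where i: "i \<in> S" "\<not> good i" "a \<in> K" "p = F i a" unfolding A_def by auto
      then have "a \<in> V0" using V0_preimage p by blast
      then have "good i" by (rule goodI[OF i(1) _ C0]) (use in_V0[OF p p0] i(4) in auto)
      then show False using i(2) by simp
    qed
    define v :: "'k \<Rightarrow> real" where "v = indicator A"
    have v_cell: "v x = v y" if "i \<in> S" "x \<in> F i ` K" "y \<in> F i ` K" for i x y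
    proof (cases "good i")
      case True
      then have "x \<in> B" "y \<in> B" using that unfolding B_def by blast+
      then show ?thesis using disj unfolding v_def by (auto simp: indicator_def)
    next
      case False
      then have "x \<in> A" "y \<in> A" using that unfolding A_def by blast+
      then show ?thesis unfolding v_def by simp
    qed
    have "continuous_on A v" "continuous_on B v"
      unfolding v_def
      by (rule continuous_on_eq[of _ "\<lambda>_. 1"], simp, simp)
        (rule continuous_on_eq[of _ "\<lambda>_. 0"], use disj in \<open>auto simp: indicator_def\<close>)
    then have v_cont: "continuous_on K v"
      unfolding KAB using cpt by (intro continuous_on_closed_Un compact_imp_closed)
    have "E m v v \<le> 0" for m
      using E_le_Suc[of m v] E_cell_constant[OF v_cell, where m = m and u = v] by simp
    then have v_dom0: "v \<in> dom0"
      by (intro dom0I domI[OF v_cont]) (use V0A in \<open>auto simp: v_def\<close>)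
    have "form (\<phi> n) v = 0" for n
    proof -
      \<comment> \<open>The sequence is shifted by one because \<open>E_cell_constant\<close> starts
        at level one.\<close>
      have "(\<lambda>m. E (Suc m) (\<phi> n) v) \<longlonglongrightarrow> form (\<phi> n) v"
        by (rule LIMSEQ_Suc[OF E_tendsto[OF \<phi>_dom dom0_D(1)[OF v_dom0]]])
      then show ?thesis using E_cell_constant[OF v_cell] by (simp add: LIMSEQ_const_iff)
    qed
    then have "coeff v n = 0" for n
      using form_\<phi>[OF v_dom0, of n] lam_pos[of n] by (simp add: coeff_def)
    \<comment> \<open>All partial sums of the Fourier series of \<open>v\<close> vanish, so
      completeness says that \<open>v\<close> itself has norm 0.\<close>
    then have "(\<integral>x. (v x)\<^sup>2 \<partial>\<mu>) = 0"
      using L2_complete[OF continuous_measurable[OF v_cont], of 1]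
      by (simp add: v_def indicator_def LIMSEQ_const_iff)
    moreover have "v i \<ge> 0" for i by (simp add: v_def)
    ultimately have v0: "(v x)\<^sup>2 = 0" if "x \<in> K" for x
      using continuous_integral_pos[of "\<lambda>x. (v x)\<^sup>2" x] v_cont that
      by (cases "(v x)\<^sup>2 = 0") (auto intro!: continuous_intros)
    have "p0 \<in> K" using p0 V0_subset by blast
    then have "F i0 p0 \<in> A" "F i0 p0 \<in> K" using i0 F_into unfolding A_def by auto
    then show False using v0[of "F i0 p0"] by (simp add: v_def)
  qed
  then obtain C where C: "\<And>i. i \<in> S \<Longrightarrow> C i \<ge> 0"
      "\<And>i v q. i \<in> S \<Longrightarrow> q \<in> V0 \<Longrightarrow> \<bar>v (F i q) - v p0\<bar> \<le> C i * sqrt (E 1 v v)"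
    unfolding good_def by metis
  show thesis
  proof
    show "(\<Sum>i\<in>S. C i) \<ge> 0" using C(1) by (rule sum_nonneg)
    fix i v assume i: "i \<in> S"
    have "C i \<le> (\<Sum>i\<in>S. C i)" by (rule member_le_sum) (use i C(1) finite_S in auto)
    then have "C i * sqrt (E 1 v v) \<le> (\<Sum>i\<in>S. C i) * sqrt (E 1 v v)"
      by (rule mult_right_mono) (simp add: E_nonneg)
    then show "\<bar>v (F i p0) - v p0\<bar> \<le> (\<Sum>i\<in>S. C i) * sqrt (E 1 v v)"
      using C(2)[OF i p0, of v] by linarith
  qed
qed

text \<open>For a word coding \<open>x\<close>, the images of \<open>p0\<close> under the maps of
  its prefixes lead from \<open>p0\<close>, where \<open>u\<close> vanishes, to \<open>x\<close>.
  The step at level \<open>m\<close> costs at most \<open>C * sqrt (\<rho> ^ m * form u u)\<close>,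
  and these costs form a geometric series.\<close>

lemma sup_norm_le_form:
  obtains C where "C > 0" "\<And>u x. u \<in> dom0 \<Longrightarrow> x \<in> K \<Longrightarrow> (u x)\<^sup>2 \<le> C * form u u"
proof -
  obtain p0 where p0: "p0 \<in> V0" using V0_nonempty by blast
  obtain C where C: "C \<ge> 0" "\<And>i v. i \<in> S \<Longrightarrow> \<bar>v (F i p0) - v p0\<bar> \<le> C * sqrt (E 1 v v)"
    using cells_connected[OF p0] by blast
  define \<rho> where "\<rho> = Max (r ` S)"
  have r_le: "r i \<le> \<rho>" if "i \<in> S" for i
    unfolding \<rho>_def using that finite_S by simp
  have \<rho>_less: "\<rho> < 1" unfolding \<rho>_def using S_nonempty finite_S r_less_1 by simp
  obtain i1 where "i1 \<in> S" using S_nonempty by blast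
  then have \<rho>_pos: "0 < \<rho>" using r_pos r_le by force
  have r_word_le: "prod_list (map r w) \<le> \<rho> ^ length w" if "set w \<subseteq> S" for w
    using that
  proof (induction w)
    case (Cons i w)
    then have "r i * prod_list (map r w) \<le> \<rho> * \<rho> ^ length w"
      using r_le r_word_pos[of w] \<rho>_pos by (intro mult_mono) auto
    then show ?case by simp
  qed simp
  \<comment> \<open>A square root, since energies control squares of differences.\<close>
  define q where "q = sqrt \<rho>"
  have q: "0 < q" "q < 1" using \<rho>_pos \<rho>_less by (auto simp: q_def)
  let ?C = "C / (1 - q)"
  \<comment> \<open>The added 1 keeps the constant positive even if \<open>C = 0\<close>.\<close>
  have "(u x)\<^sup>2 \<le> (?C\<^sup>2 + 1) * form u u" if u: "u \<in> dom0" and x: "x \<in> K" for u x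
  proof -
    note ud = dom0_D(1)[OF u]
    obtain \<omega> where \<omega>: "\<omega> \<in> UNIV \<rightarrow> S" "x = \<pi> \<omega>" using x \<pi>_image by blast
    define w where "w m = map \<omega> [0..<m]" for m
    define p where "p m = foldr F (w m) p0" for m
    have w: "set (w m) \<subseteq> S" "w m \<in> words S m" for m using \<omega> by (auto simp: w_def words_def)
    have p_K: "p m \<in> K" for m unfolding p_def using F_word_into[OF w(1)] p0 V0_subset by blast
    have step: "\<bar>u (p (Suc m)) - u (p m)\<bar> \<le> C * sqrt (form u u) * q ^ m" for m
    proof -
      let ?v = "u \<circ> foldr F (w m)"
      have "E 1 ?v ?v \<le> prod_list (map r (w m)) * E (Suc m) u u" by (rule E1_cell_le[OF w(2)])
      also have "\<dots> \<le> \<rho> ^ m * form u u"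
        using r_word_le[OF w(1)] r_word_pos[OF w(1)] E_le_form[OF ud, of "Suc m"] E_nonneg \<rho>_pos
        by (intro mult_mono) (auto simp: w_def)
      finally have le: "sqrt (E 1 ?v ?v) \<le> sqrt (\<rho> ^ m * form u u)" by simp
      also have "\<dots> = q ^ m * sqrt (form u u)"
        by (simp add: real_sqrt_mult real_sqrt_power q_def)
      finally have "C * sqrt (E 1 ?v ?v) \<le> C * (q ^ m * sqrt (form u u))"
        using C(1) by (rule mult_left_mono)
      moreover have "\<bar>u (p (Suc m)) - u (p m)\<bar> \<le> C * sqrt (E 1 ?v ?v)"
        using C(2)[of "\<omega> m" ?v] \<omega>(1) by (auto simp: p_def w_def)
      ultimately show ?thesis by (simp add: mult_ac)
    qed
    have "\<bar>u (p m)\<bar> \<le> C * sqrt (form u u) * (\<Sum>k<m. q ^ k)" for m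
    proof (induction m)
      case 0
      then show ?case using dom0_D(2)[OF u p0] by (simp add: p_def w_def)
    next
      case (Suc m)
      then show ?case using step[of m] by (simp add: algebra_simps)
    qed
    moreover have "(\<Sum>k<m. q ^ k) \<le> 1 / (1 - q)" for m
      using q by (simp add: sum_gp_strict divide_right_mono)
    ultimately have "\<bar>u (p m)\<bar> \<le> C * sqrt (form u u) * (1 / (1 - q))" for m
      using C(1) form_nonneg[OF ud] by (meson mult_left_mono mult_nonneg_nonneg order_trans real_sqrt_ge_zero)
    then have "\<bar>u (p m)\<bar> \<le> ?C * sqrt (form u u)" for m by (simp add: mult_ac)
    moreover have "(\<lambda>m. \<bar>u (p m)\<bar>) \<longlonglongrightarrow> \<bar>u x\<bar>"
    proof (intro tendsto_rabs continuous_on_tendsto_compose[OF dom_cont[OF ud] _ x])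
      show "p \<longlonglongrightarrow> x"
        using word_points_tendsto[OF \<omega>(1), of p0] p0 V0_subset unfolding \<omega>(2) p_def w_def by blast
    qed (use p_K in simp)
    ultimately have "\<bar>u x\<bar> \<le> ?C * sqrt (form u u)"
      by (intro LIMSEQ_le_const2) auto
    then have "\<bar>u x\<bar>\<^sup>2 \<le> (?C * sqrt (form u u))\<^sup>2" by (rule power_mono) simp
    also have "\<dots> = ?C\<^sup>2 * form u u" using form_nonneg[OF ud] by (simp add: power_mult_distrib power_divide)
    also have "\<dots> \<le> (?C\<^sup>2 + 1) * form u u" using form_nonneg[OF ud] by (simp add: algebra_simps)
    finally show ?thesis by simp
  qed
  moreover have "?C\<^sup>2 + 1 > 0" by (simp add: add_nonneg_pos)
  ultimately show thesis using that by blast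
qed

end

section \<open>The Poisson kernel and eigenfunction expansions\<close>

context fractal_structure
begin

text \<open>The Cauchy-Schwarz inequality on a probability space, read off from the nonnegative
  variance of the absolute value.\<close>

lemma integral_abs_le_L2:
  fixes h :: "'k \<Rightarrow> real"
  assumes "h \<in> borel_measurable \<mu>" "\<And>x. x \<in> K \<Longrightarrow> \<bar>h x\<bar> \<le> B"
  shows "(\<integral>x. \<bar>h x\<bar> \<partial>\<mu>) \<le> sqrt (\<integral>x. (h x)\<^sup>2 \<partial>\<mu>)"
proof -
  have 1: "integrable \<mu> (\<lambda>x. \<bar>h x\<bar>)"
    by (rule bounded_integrable[where B = B]) (use assms in auto)
  have 2: "integrable \<mu> (\<lambda>x. \<bar>h x\<bar>\<^sup>2)"
    by (rule bounded_integrable[where B = "B\<^sup>2"]) (use assms power_mono[of "\<bar>h _\<bar>" B 2] in auto)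
  have "0 \<le> variance (\<lambda>x. \<bar>h x\<bar>)" by (rule variance_positive)
  also have "\<dots> = (\<integral>x. \<bar>h x\<bar>\<^sup>2 \<partial>\<mu>) - (\<integral>x. \<bar>h x\<bar> \<partial>\<mu>)\<^sup>2"
    by (rule variance_eq[OF 1 2])
  finally show ?thesis by (intro real_le_rsqrt) simp
qed

end

context fractal_eigensystem
begin

text \<open>The constant of the sup-norm estimate, chosen once so that later bounds can refer to
  it.\<close>

definition sup_const :: real where
  "sup_const = (SOME C. C > 0 \<and> (\<forall>u x. u \<in> dom0 \<longrightarrow> x \<in> K \<longrightarrow> (u x)\<^sup>2 \<le> C * form u u))"

lemma sup_const: "sup_const > 0" "u \<in> dom0 \<Longrightarrow> x \<in> K \<Longrightarrow> (u x)\<^sup>2 \<le> sup_const * form u u"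
proof -
  have "\<exists>C. C > 0 \<and> (\<forall>u x. u \<in> dom0 \<longrightarrow> x \<in> K \<longrightarrow> (u x)\<^sup>2 \<le> C * form u u)"
    using sup_norm_le_form by metis
  from someI_ex[OF this] show "sup_const > 0" "u \<in> dom0 \<Longrightarrow> x \<in> K \<Longrightarrow> (u x)\<^sup>2 \<le> sup_const * form u u"
    unfolding sup_const_def by blast+
qed

section \<open>Finite eigenfunction sums and the growth of the eigenvalues\<close>

lemma eigensum_dom0: "finite A \<Longrightarrow> (\<lambda>x. \<Sum>n\<in>A. a n * \<phi> n x) \<in> dom0"
  by (intro dom0I dom_sum dom_scale \<phi>_dom sum.neutral) (auto simp: dom0_D(2)[OF \<phi>_dom0])

lemma eigensum_cont: "continuous_on K (\<lambda>x. \<Sum>n\<in>A. a n * \<phi> n x)"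
  by (intro continuous_intros \<phi>_cont)

lemma integrable_\<phi>_mult: "integrable \<mu> (\<lambda>x. \<phi> m x * \<phi> n x)"
  by (intro continuous_integrable continuous_intros \<phi>_cont)

lemma coeff_eigensum:
  assumes "finite A"
  shows "coeff (\<lambda>x. \<Sum>n\<in>A. a n * \<phi> n x) k = (if k \<in> A then a k else 0)"
proof -
  have "coeff (\<lambda>x. \<Sum>n\<in>A. a n * \<phi> n x) k = (\<integral>x. (\<Sum>n\<in>A. a n * (\<phi> n x * \<phi> k x)) \<partial>\<mu>)"
    unfolding coeff_def by (simp only: sum_distrib_right mult.assoc)
  also have "\<dots> = (\<Sum>n\<in>A. a n * (\<integral>x. \<phi> n x * \<phi> k x \<partial>\<mu>))"
    by (subst Bochner_Integration.integral_sum) (auto simp: integrable_\<phi>_mult)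
  also have "\<dots> = (\<Sum>n\<in>A. if n = k then a n else 0)"
    by (rule sum.cong) (auto simp: \<phi>_orthonormal)
  also have "\<dots> = (if k \<in> A then a k else 0)"
    using assms by (simp add: sum.delta)
  finally show ?thesis .
qed

lemma form_eigensum_left:
  assumes "finite A" "v \<in> dom0"
  shows "form (\<lambda>x. \<Sum>n\<in>A. a n * \<phi> n x) v = (\<Sum>n\<in>A. lam n * a n * coeff v n)"
proof -
  have "form (\<lambda>x. \<Sum>n\<in>A. a n * \<phi> n x) v = (\<Sum>n\<in>A. form (\<lambda>x. a n * \<phi> n x) v)"
    by (intro form_sum_left dom_scale \<phi>_dom dom0_D(1) assms)
  also have "\<dots> = (\<Sum>n\<in>A. lam n * a n * coeff v n)"
    by (intro sum.cong refl)
      (simp add: form_scale_left[OF \<phi>_dom dom0_D(1)[OF assms(2)]] form_\<phi>[OF assms(2)] coeff_def mult_ac)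
  finally show ?thesis .
qed

lemma form_eigensum:
  assumes "finite A"
  shows "form (\<lambda>x. \<Sum>n\<in>A. a n * \<phi> n x) (\<lambda>x. \<Sum>n\<in>A. a n * \<phi> n x) = (\<Sum>n\<in>A. lam n * (a n)\<^sup>2)"
  unfolding form_eigensum_left[OF assms eigensum_dom0[OF assms]] coeff_eigensum[OF assms]
  by (simp add: power2_eq_square mult_ac)

text \<open>The sup-norm estimate is applied to the partial sum of the Green function with pole
  \<open>x\<close>, whose coefficients are \<open>\<phi> n x / lam n\<close>. Its value at
  \<open>x\<close> and its energy are the same sum \<open>s\<close>, so
  \<open>s * s \<le> sup_const * s\<close>.\<close>

lemma sum_\<phi>_sq_le:
  assumes "finite A" "x \<in> K"
  shows "(\<Sum>n\<in>A. (\<phi> n x)\<^sup>2 / lam n) \<le> sup_const"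
proof -
  let ?s = "\<Sum>n\<in>A. (\<phi> n x)\<^sup>2 / lam n"
  have "(\<Sum>n\<in>A. \<phi> n x / lam n * \<phi> n x)\<^sup>2 \<le> sup_const * (\<Sum>n\<in>A. lam n * (\<phi> n x / lam n)\<^sup>2)"
    using sup_const(2)[OF eigensum_dom0[OF assms(1)] assms(2)]
    unfolding form_eigensum[OF assms(1)] .
  moreover have "(\<Sum>n\<in>A. \<phi> n x / lam n * \<phi> n x) = ?s"
    by (simp add: power2_eq_square)
  moreover have "lam n * (\<phi> n x / lam n)\<^sup>2 = (\<phi> n x)\<^sup>2 / lam n" for n
    using lam_pos[of n] by (simp add: power2_eq_square field_simps)
  ultimately have "?s * ?s \<le> sup_const * ?s" by (simp add: power2_eq_square)
  moreover have "0 \<le> ?s" using lam_pos by (intro sum_nonneg) (simp add: less_imp_le)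
  ultimately show ?thesis using sup_const(1) by (cases "?s = 0") auto
qed

lemma \<phi>_sq_le: "x \<in> K \<Longrightarrow> (\<phi> n x)\<^sup>2 \<le> sup_const * lam n"
  using sum_\<phi>_sq_le[of "{n}" x] lam_pos[of n] by (simp add: field_simps)

lemma \<phi>_le: "x \<in> K \<Longrightarrow> \<bar>\<phi> n x\<bar> \<le> sqrt (sup_const * lam n)"
  using real_sqrt_le_mono[OF \<phi>_sq_le] by simp

lemma \<phi>_mult_le:
  assumes "x \<in> K" "y \<in> K"
  shows "\<bar>\<phi> n x * \<phi> n y\<bar> \<le> sup_const * lam n"
proof -
  have 0: "0 \<le> sup_const * lam n" using sup_const(1) lam_pos[of n] by simp
  have "\<bar>\<phi> n x * \<phi> n y\<bar> \<le> sqrt (sup_const * lam n) * sqrt (sup_const * lam n)"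
    unfolding abs_mult by (intro mult_mono \<phi>_le assms) (use 0 in auto)
  then show ?thesis using 0 by simp
qed

text \<open>Integrating \<open>sum_\<phi>_sq_le\<close> over \<open>x\<close> replaces each squared
  eigenfunction by 1.\<close>

lemma summable_inverse_lam: "summable (\<lambda>n. 1 / lam n)"
proof (rule summableI_nonneg_bounded[where x = sup_const])
  show "0 \<le> 1 / lam n" for n using lam_pos[of n] by simp
  fix N
  have int: "integrable \<mu> (\<lambda>x. (\<phi> n x)\<^sup>2 / lam n)" for n
    by (intro continuous_integrable continuous_intros \<phi>_cont) (use lam_pos[of n] in auto)
  have "(\<Sum>n<N. 1 / lam n) = (\<Sum>n<N. \<integral>x. (\<phi> n x)\<^sup>2 / lam n \<partial>\<mu>)"
    using \<phi>_orthonormal[of n n for n] by (simp add: power2_eq_square)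
  also have "\<dots> = (\<integral>x. (\<Sum>n<N. (\<phi> n x)\<^sup>2 / lam n) \<partial>\<mu>)"
    by (rule Bochner_Integration.integral_sum[symmetric]) (rule int)
  also have "\<dots> \<le> (\<integral>x. sup_const \<partial>\<mu>)"
    by (rule integral_mono) (use int sum_\<phi>_sq_le in \<open>auto simp: space_\<mu>\<close>)
  also have "\<dots> = sup_const" by (simp add: prob_space)
  finally show "(\<Sum>n<N. 1 / lam n) \<le> sup_const" .
qed

section \<open>The decay factors and the Poisson kernel\<close>

definition decay :: "real \<Rightarrow> nat \<Rightarrow> real" where
  "decay t n = exp (- sqrt (lam n) * t)"

lemma decay_pos: "0 < decay t n"
  by (simp add: decay_def)

lemma summable_decay:
  assumes "t > 0"
  shows "summable (\<lambda>n. decay t n * lam n)"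
\<comment> \<open>With \<open>x = sqrt (lam n) * t\<close>, the bound
  \<open>(x / 6) ^ 6 \<le> exp x\<close> removes the square root and gains three powers of
  \<open>lam n\<close>. One is spent on the factor \<open>lam n\<close>, one is bounded below by
  \<open>lam 0\<close>, and the last leaves the summable \<open>1 / lam n\<close>.\<close>
proof (rule summable_comparison_test'[OF summable_mult[OF summable_inverse_lam, of "6 ^ 6 / (t ^ 6 * lam 0)"], of 0])
  fix n
  let ?x = "sqrt (lam n) * t"
  have x: "?x > 0" using assms lam_pos by simp
  have "?x / 6 \<le> exp (?x / 6)"
    using exp_ge_add_one_self[of "?x / 6"] by linarith
  then have "(?x / 6) ^ 6 \<le> (exp (?x / 6)) ^ 6"
    using x by (intro power_mono) auto
  also have "\<dots> = exp ?x" by (simp add: exp_of_nat_mult[symmetric])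
  finally have *: "?x ^ 6 \<le> 6 ^ 6 * exp ?x" by (simp add: power_divide)
  have "?x ^ 6 = ((sqrt (lam n))\<^sup>2) ^ 3 * t ^ 6" by (simp add: power_mult_distrib power_mult[symmetric])
  also have "\<dots> = lam n ^ 3 * t ^ 6" using lam_pos[of n] by simp
  finally have "lam n ^ 3 * t ^ 6 \<le> 6 ^ 6 * exp ?x" using * by simp
  then have "decay t n * (lam n ^ 3 * t ^ 6) \<le> decay t n * (6 ^ 6 * exp ?x)"
    by (rule mult_left_mono) (simp add: decay_def)
  also have "\<dots> = 6 ^ 6 * (decay t n * exp ?x)" by simp
  also have "decay t n * exp ?x = 1" by (simp add: decay_def exp_add[symmetric])
  finally have "decay t n * (lam n ^ 3 * t ^ 6) \<le> 6 ^ 6" by simp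
  then have "decay t n * lam n \<le> 6 ^ 6 / (t ^ 6 * (lam n * lam n))"
    using assms lam_pos[of n] by (simp add: field_simps power3_eq_cube)
  also have "\<dots> \<le> 6 ^ 6 / (t ^ 6 * (lam 0 * lam n))"
    using assms lam_pos lam_mono[THEN monoD, of 0 n]
    by (intro divide_left_mono mult_left_mono mult_right_mono mult_pos_pos) (auto simp: less_imp_le)
  finally show "norm (decay t n * lam n) \<le> 6 ^ 6 / (t ^ 6 * lam 0) * (1 / lam n)"
    using lam_pos[of n] decay_pos[of t n] by (simp add: mult_ac)
qed

abbreviation pk :: "real \<Rightarrow> 'k \<Rightarrow> 'k \<Rightarrow> real" where
  "pk \<equiv> poisson_kernel lam \<phi>"

lemma pk_eq: "pk t x y = (\<Sum>n. decay t n * (\<phi> n x * \<phi> n y))"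
  by (simp add: poisson_kernel_def decay_def mult_ac)

definition pk_bound :: "real \<Rightarrow> real" where
  "pk_bound t = sup_const * (\<Sum>n. decay t n * lam n)"

lemma pk_term_le:
  assumes "x \<in> K" "y \<in> K"
  shows "\<bar>decay t n * (\<phi> n x * \<phi> n y)\<bar> \<le> sup_const * (decay t n * lam n)"
  using mult_left_mono[OF \<phi>_mult_le[OF assms, of n], of "decay t n"] decay_pos[of t n]
  by (simp add: abs_mult mult_ac)

lemma summable_pk:
  assumes "t > 0" "x \<in> K" "y \<in> K"
  shows "summable (\<lambda>n. \<bar>decay t n * (\<phi> n x * \<phi> n y)\<bar>)"
  by (rule summable_comparison_test'[OF summable_mult[OF summable_decay[OF assms(1)], of sup_const], of 0])
    (use pk_term_le[OF assms(2,3)] in simp)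

lemma pk_le:
  assumes "t > 0" "x \<in> K" "y \<in> K"
  shows "\<bar>pk t x y\<bar> \<le> pk_bound t"
proof -
  have "\<bar>pk t x y\<bar> \<le> (\<Sum>n. \<bar>decay t n * (\<phi> n x * \<phi> n y)\<bar>)"
    unfolding pk_eq by (rule summable_rabs[OF summable_pk[OF assms]])
  also have "\<dots> \<le> (\<Sum>n. sup_const * (decay t n * lam n))"
    by (rule suminf_le[OF pk_term_le[OF assms(2,3)] summable_pk[OF assms]])
      (rule summable_mult[OF summable_decay[OF assms(1)]])
  also have "\<dots> = pk_bound t"
    unfolding pk_bound_def by (rule suminf_mult[OF summable_decay[OF assms(1)]])
  finally show ?thesis .
qed

lemma pk_commute: "pk t x y = pk t y x"
  by (simp add: pk_eq mult.commute)

lemma \<phi>_measurable: "sets N = sets (restrict_space borel K) \<Longrightarrow> \<phi> n \<in> borel_measurable N"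
  using continuous_measurable[OF \<phi>_cont, of n] sets_\<mu> measurable_cong_sets[of N \<mu> borel borel] by auto

text \<open>The measure is left general because the kernel is integrated against \<mu>, against the
  variations of a signed measure and against weak limits.\<close>

lemma pk_measurable:
  assumes "sets N = sets (restrict_space borel K)"
  shows "pk t x \<in> borel_measurable N"
  unfolding pk_eq[abs_def] using \<phi>_measurable[OF assms] by measurable

lemma pk_measurable_pair:
  assumes "sets N1 = sets (restrict_space borel K)" "sets N2 = sets (restrict_space borel K)"
  shows "(\<lambda>(x, y). pk t x y) \<in> borel_measurable (N1 \<Otimes>\<^sub>M N2)"
proof -
  have [measurable]: "\<phi> n \<in> borel_measurable N1" "\<phi> n \<in> borel_measurable N2" for n
    by (rule \<phi>_measurable; fact)+
  show ?thesis unfolding pk_eq[abs_def] by measurable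
qed

text \<open>Termwise integration, dominated by
  \<open>sup_const * (decay t n * lam n) * norm (h y)\<close>. With \<open>h = 1\<close> and a
  general \<open>N\<close> it expands the Poisson integral of a measure.\<close>

lemma pk_integral_sums:
  fixes h :: "'k \<Rightarrow> real"
  assumes N: "sets N = sets (restrict_space borel K)" and t: "t > 0" and x: "x \<in> K" and h: "integrable N h"
  shows "(\<lambda>n. decay t n * \<phi> n x * (\<integral>y. h y * \<phi> n y \<partial>N)) sums (\<integral>y. pk t x y * h y \<partial>N)"
proof -
  have sp: "space N = K" using sets_eq_imp_space_eq[OF N] by (simp add: space_restrict_space)
  have [measurable]: "\<phi> n \<in> borel_measurable N" "h \<in> borel_measurable N" for n
    using \<phi>_measurable[OF N] h by auto
  let ?f = "\<lambda>n y. decay t n * (\<phi> n x * \<phi> n y) * h y"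
  have le: "norm (?f n y) \<le> sup_const * (decay t n * lam n) * norm (h y)" if "y \<in> K" for n y
    unfolding norm_mult[of _ "h y"]
    by (rule mult_right_mono) (use pk_term_le[OF x that, of t n] in auto)
  have int: "integrable N (?f n)" for n
  proof (rule Bochner_Integration.integrable_bound[of N "\<lambda>y. sup_const * (decay t n * lam n) * norm (h y)"])
      show "integrable N (\<lambda>y. sup_const * (decay t n * lam n) * norm (h y))" using h by simp
      show "AE y in N. norm (?f n y) \<le> norm (sup_const * (decay t n * lam n) * norm (h y))"
      proof (rule AE_I2)
        fix y assume "y \<in> space N"
        then have "norm (?f n y) \<le> sup_const * (decay t n * lam n) * norm (h y)" by (intro le) (simp add: sp)
        then show "norm (?f n y) \<le> norm (sup_const * (decay t n * lam n) * norm (h y))" by simp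
      qed
    qed measurable
  have "(\<lambda>n. integral\<^sup>L N (?f n)) sums (\<integral>y. (\<Sum>n. ?f n y) \<partial>N)"
  proof (rule sums_integral[OF int])
    show "AE y in N. summable (\<lambda>n. norm (?f n y))"
    proof (rule AE_I2)
      fix y assume "y \<in> space N"
      then show "summable (\<lambda>n. norm (?f n y))"
        using summable_mult2[OF summable_pk[OF t x, of y], of "\<bar>h y\<bar>"] by (simp add: sp abs_mult)
    qed
    show "summable (\<lambda>n. \<integral>y. norm (?f n y) \<partial>N)"
    proof (rule summable_comparison_test'[where N = 0])
      show "summable (\<lambda>n. sup_const * (decay t n * lam n) * (\<integral>y. norm (h y) \<partial>N))"
        by (intro summable_mult2 summable_mult summable_decay t)
      fix n
      have "(\<integral>y. norm (?f n y) \<partial>N) \<le> (\<integral>y. sup_const * (decay t n * lam n) * norm (h y) \<partial>N)"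
        by (rule integral_mono) (use int h le in \<open>auto simp: sp\<close>)
      then show "norm (\<integral>y. norm (?f n y) \<partial>N) \<le> sup_const * (decay t n * lam n) * (\<integral>y. norm (h y) \<partial>N)"
        by simp
    qed
  qed
  moreover have "integral\<^sup>L N (?f n) = decay t n * \<phi> n x * (\<integral>y. h y * \<phi> n y \<partial>N)" for n
  proof -
    have "integral\<^sup>L N (?f n) = (\<integral>y. decay t n * \<phi> n x * (h y * \<phi> n y) \<partial>N)"
      by (simp add: mult_ac)
    then show ?thesis by simp
  qed
  moreover have "(\<integral>y. (\<Sum>n. ?f n y) \<partial>N) = (\<integral>y. pk t x y * h y \<partial>N)"
  proof (rule Bochner_Integration.integral_cong[OF refl])
    fix y assume "y \<in> space N"
    then have "summable (\<lambda>n. decay t n * (\<phi> n x * \<phi> n y))"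
      by (intro summable_rabs_cancel[OF summable_pk[OF t x]]) (simp add: sp)
    then show "(\<Sum>n. ?f n y) = pk t x y * h y"
      unfolding pk_eq by (rule suminf_mult2[symmetric])
  qed
  ultimately show ?thesis by simp
qed

lemma pk_integrable:
  fixes h :: "'k \<Rightarrow> 'c::{banach, second_countable_topology}"
  assumes N: "sets N = sets (restrict_space borel K)" and t: "t > 0" and x: "x \<in> K" and h: "integrable N h"
  shows "integrable N (\<lambda>y. pk t x y *\<^sub>R h y)"
proof (rule Bochner_Integration.integrable_bound)
  have sp: "space N = K" using sets_eq_imp_space_eq[OF N] by (simp add: space_restrict_space)
  show "integrable N (\<lambda>y. pk_bound t *\<^sub>R norm (h y))" using h by simp
  show "(\<lambda>y. pk t x y *\<^sub>R h y) \<in> borel_measurable N"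
    using pk_measurable[OF N] h by measurable
  have "\<bar>pk t x y\<bar> * norm (h y) \<le> \<bar>pk_bound t\<bar> * norm (h y)" if "y \<in> K" for y
    using pk_le[OF t x that] by (intro mult_right_mono) auto
  then show "AE y in N. norm (pk t x y *\<^sub>R h y) \<le> norm (pk_bound t *\<^sub>R norm (h y))"
    by (intro AE_I2) (simp add: sp abs_mult)
qed

text \<open>Bessel's inequality for the energy: the remainder of the expansion has nonnegative
  energy, and the eigenfunctions are orthogonal for the form as well.\<close>

lemma energy_bessel:
  assumes "g \<in> dom0"
  shows "(\<Sum>n<N. lam n * (coeff g n)\<^sup>2) \<le> form g g"
proof -
  let ?g = "\<lambda>x. \<Sum>n<N. coeff g n * \<phi> n x"
  have gN: "?g \<in> dom0" by (rule eigensum_dom0) simp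
  have g: "g \<in> dom" and gN': "?g \<in> dom" using assms gN dom0_D by blast+
  have 1: "form ?g g = (\<Sum>n<N. lam n * (coeff g n)\<^sup>2)"
    by (subst form_eigensum_left) (simp_all add: assms power2_eq_square mult_ac)
  have 2: "form ?g ?g = (\<Sum>n<N. lam n * (coeff g n)\<^sup>2)"
    by (rule form_eigensum) simp
  have d: "(\<lambda>x. g x - ?g x) \<in> dom" by (rule dom_diff[OF g gN'])
  have "0 \<le> form (\<lambda>x. g x - ?g x) (\<lambda>x. g x - ?g x)" by (rule form_nonneg[OF d])
  also have "\<dots> = form g (\<lambda>x. g x - ?g x) - form ?g (\<lambda>x. g x - ?g x)"
    by (rule form_diff_left[OF g gN' d])
  also have "\<dots> = (form g g - form ?g g) - (form g ?g - form ?g ?g)"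
    unfolding form_commute[of _ "\<lambda>x. g x - ?g x"] form_diff_left[OF g gN' g] form_diff_left[OF g gN' gN']
    by (simp add: form_commute)
  finally show ?thesis using 1 2 form_commute[of g ?g] by simp
qed

text \<open>The energies of blocks of the series are tails of a convergent series by
  \<open>energy_bessel\<close>, and the sup-norm estimate turns them into uniform bounds.
  Completeness then identifies the uniform limit with \<open>g\<close>.\<close>

lemma eigen_expansion:
  assumes "g \<in> dom0"
  shows "uniform_limit K (\<lambda>N x. \<Sum>n<N. coeff g n * \<phi> n x) g sequentially"
proof -
  let ?g = "\<lambda>N x. \<Sum>n<N. coeff g n * \<phi> n x"
  have g_cont: "continuous_on K g" by (rule dom_cont[OF dom0_D(1)[OF assms]])
  let ?e = "\<lambda>n. lam n * (coeff g n)\<^sup>2"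
  have e_nonneg: "0 \<le> ?e n" for n using lam_pos[of n] by simp
  have summ: "summable ?e"
    by (rule summableI_nonneg_bounded[OF e_nonneg energy_bessel[OF assms]])
  have diff: "(?g M x - ?g N x)\<^sup>2 \<le> sup_const * (\<Sum>n\<in>{N..<M}. ?e n)" if "N \<le> M" "x \<in> K" for N M x
  proof -
    have "?g M x - ?g N x = (\<Sum>n\<in>{N..<M}. coeff g n * \<phi> n x)"
      using sum_diff_nat_ivl[of 0 N M "\<lambda>n. coeff g n * \<phi> n x"] that(1) by (simp add: atLeast0LessThan)
    then show ?thesis
      using sup_const(2)[OF eigensum_dom0 that(2), of "{N..<M}" "coeff g"]
      unfolding form_eigensum[OF finite_atLeastLessThan] by simp
  qed
  have "uniformly_Cauchy_on K ?g"
  proof (rule uniformly_Cauchy_onI')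
    fix \<epsilon> :: real assume \<epsilon>: "\<epsilon> > 0"
    then have "\<epsilon>\<^sup>2 / sup_const > 0" using sup_const by simp
    then obtain N0 where N0: "\<And>m n. m \<ge> N0 \<Longrightarrow> norm (\<Sum>k\<in>{m..<n}. ?e k) < \<epsilon>\<^sup>2 / sup_const"
      using summ unfolding summable_Cauchy by metis
    show "\<exists>M. \<forall>x\<in>K. \<forall>m\<ge>M. \<forall>n>m. dist (?g m x) (?g n x) < \<epsilon>"
    proof (intro exI ballI allI impI)
      fix x m n assume x: "x \<in> K" "N0 \<le> m" "m < n"
      have "(?g n x - ?g m x)\<^sup>2 \<le> sup_const * (\<Sum>k\<in>{m..<n}. ?e k)" by (rule diff) (use x in auto)
      also have "\<dots> < \<epsilon>\<^sup>2"
        using N0[OF x(2), of n] sup_const(1) by (simp add: field_simps abs_less_iff)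
      finally have "\<bar>?g n x - ?g m x\<bar>\<^sup>2 < \<epsilon>\<^sup>2" by simp
      then have "\<bar>?g n x - ?g m x\<bar> < \<epsilon>"
        by (rule power2_less_imp_less) (use \<epsilon> in simp)
      then show "dist (?g m x) (?g n x) < \<epsilon>" by (simp add: dist_real_def abs_minus_commute)
    qed
  qed
  then obtain h where h: "uniform_limit K ?g h sequentially"
    using Cauchy_uniformly_convergent unfolding uniformly_convergent_on_def by blast
  have h_cont: "continuous_on K h"
    by (rule uniform_limit_theorem[OF always_eventually h]) (simp_all add: eigensum_cont)
  have gh: "(\<lambda>N. \<integral>x. (g x - ?g N x)\<^sup>2 \<partial>\<mu>) \<longlonglongrightarrow> 0"
  proof -
    obtain B where B: "\<And>x. x \<in> K \<Longrightarrow> norm (g x) \<le> B" using continuous_bounded[OF g_cont] by blast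
    show ?thesis by (rule L2_complete[OF continuous_measurable[OF g_cont]]) (use B in simp)
  qed
  \<comment> \<open>By \<open>(a + b)^2 \<le> 2 a^2 + 2 b^2\<close> two errors of size
    \<open>\<epsilon> / 4\<close> each contribute \<open>\<epsilon> / 2\<close>.\<close>
  have "(\<integral>x. (g x - h x)\<^sup>2 \<partial>\<mu>) \<le> 0"
  proof (rule field_le_epsilon)
    fix \<epsilon> :: real assume \<epsilon>: "\<epsilon> > 0"
    have "\<forall>\<^sub>F N in sequentially. (\<integral>x. (g x - ?g N x)\<^sup>2 \<partial>\<mu>) < \<epsilon> / 4"
      using order_tendstoD(2)[OF gh, of "\<epsilon> / 4"] \<epsilon> by simp
    moreover have "\<forall>\<^sub>F N in sequentially. \<forall>x\<in>K. dist (?g N x) (h x) < sqrt (\<epsilon> / 4)"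
      by (rule uniform_limitD[OF h]) (use \<epsilon> in simp)
    ultimately have ev: "\<forall>\<^sub>F N in sequentially. (\<integral>x. (g x - ?g N x)\<^sup>2 \<partial>\<mu>) < \<epsilon> / 4 \<and>
        (\<forall>x\<in>K. dist (?g N x) (h x) < sqrt (\<epsilon> / 4))"
      by (rule eventually_conj)
    obtain N where N: "(\<integral>x. (g x - ?g N x)\<^sup>2 \<partial>\<mu>) < \<epsilon> / 4"
      "\<And>x. x \<in> K \<Longrightarrow> dist (?g N x) (h x) < sqrt (\<epsilon> / 4)"
      using eventually_happens'[OF sequentially_bot ev] by blast
    have sq: "(g x - h x)\<^sup>2 \<le> 2 * (g x - ?g N x)\<^sup>2 + \<epsilon> / 2" if "x \<in> K" for x
    proof -
      have "(?g N x - h x)\<^sup>2 \<le> \<epsilon> / 4"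
        using power_mono[OF less_imp_le[OF N(2)[OF that]], of 2] \<epsilon> by (simp add: dist_real_def)
      moreover have "(g x - h x)\<^sup>2 \<le> 2 * (g x - ?g N x)\<^sup>2 + 2 * (?g N x - h x)\<^sup>2"
        using zero_le_power2[of "(g x - ?g N x) - (?g N x - h x)"] by (simp add: power2_eq_square algebra_simps)
      ultimately show ?thesis by linarith
    qed
    have int: "integrable \<mu> (\<lambda>x. (g x - ?g N x)\<^sup>2)"
      by (intro continuous_integrable continuous_intros g_cont \<phi>_cont)
    have "(\<integral>x. (g x - h x)\<^sup>2 \<partial>\<mu>) \<le> (\<integral>x. 2 * (g x - ?g N x)\<^sup>2 + \<epsilon> / 2 \<partial>\<mu>)"
      by (rule integral_mono)
        (use int sq in \<open>auto simp: space_\<mu> intro!: continuous_integrable continuous_intros g_cont h_cont \<phi>_cont\<close>)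
    also have "\<dots> = 2 * (\<integral>x. (g x - ?g N x)\<^sup>2 \<partial>\<mu>) + \<epsilon> / 2"
      using int by (simp add: prob_space)
    finally show "(\<integral>x. (g x - h x)\<^sup>2 \<partial>\<mu>) \<le> 0 + \<epsilon>" using N(1) by simp
  qed
  moreover have "continuous_on K (\<lambda>x. (g x - h x)\<^sup>2)"
    by (intro continuous_intros g_cont h_cont)
  ultimately have "g x = h x" if "x \<in> K" for x
    using continuous_integral_pos[of "\<lambda>x. (g x - h x)\<^sup>2" x] that by (cases "g x = h x") auto
  then show ?thesis
    using h uniform_limit_cong'[of K ?g ?g h g sequentially] by auto
qed

end

section \<open>The maximum principle\<close>

text \<open>If \<open>l\<close> were positive, \<open>f1\<close> would vanish at \<open>t\<close>
  and be positive just to the right of it, and the mean value theorem would push \<open>f\<close>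
  above its maximum.\<close>

lemma second_derivative_at_maximum:
  fixes f f1 :: "real \<Rightarrow> real"
  assumes t: "a < t" "t < b"
    and d1: "\<And>s. a < s \<Longrightarrow> s < b \<Longrightarrow> (f has_real_derivative f1 s) (at s)"
    and d2: "(f1 has_real_derivative l) (at t)"
    and max: "\<And>s. a < s \<Longrightarrow> s < b \<Longrightarrow> f s \<le> f t"
  shows "l \<le> 0"
proof (rule ccontr)
  assume l: "\<not> l \<le> 0"
  have "f1 t = 0"
  proof (rule DERIV_local_max[OF d1[OF t], of "min (t - a) (b - t)"])
    show "0 < min (t - a) (b - t)" using t by simp
    show "\<forall>y. \<bar>t - y\<bar> < min (t - a) (b - t) \<longrightarrow> f y \<le> f t" using max by (auto simp: abs_less_iff)
  qed
  moreover obtain \<delta> where \<delta>: "\<delta> > 0" "\<And>h. 0 < h \<Longrightarrow> h < \<delta> \<Longrightarrow> f1 t < f1 (t + h)"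
    using DERIV_pos_inc_right[OF d2] l by auto
  ultimately have pos: "f1 s > 0" if "t < s" "s < t + \<delta>" for s
    using \<delta>(2)[of "s - t"] that by simp
  define s where "s = t + min (\<delta> / 2) ((b - t) / 2)"
  have s: "t < s" "s < t + \<delta>" "s < b" using \<delta> t by (auto simp: s_def min_def field_simps)
  obtain z where z: "t < z" "z < s" "f s - f t = (s - t) * f1 z"
    using MVT2[OF s(1), of f f1] d1 t s by force
  then have "f s - f t > 0" using pos[of z] s by simp
  then show False using max[of s] s t by simp
qed

context fractal_structure
begin

section \<open>Linearity of the Laplacian\<close>

abbreviation lap :: "('k \<Rightarrow> real) \<Rightarrow> ('k \<Rightarrow> real) \<Rightarrow> bool" where
  "lap \<equiv> has_laplacian K S F V0 D r \<mu>"

lemma lapD: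
  assumes "lap u g"
  shows "u \<in> dom" "continuous_on K g" "v \<in> dom0 \<Longrightarrow> form u v = - (\<integral>x. g x * v x \<partial>\<mu>)"
  using assms unfolding has_laplacian_def by blast+

lemma lapI:
  assumes "u \<in> dom" "continuous_on K g" "\<And>v. v \<in> dom0 \<Longrightarrow> form u v = - (\<integral>x. g x * v x \<partial>\<mu>)"
  shows "lap u g"
  using assms unfolding has_laplacian_def by blast

lemma integrable_lap:
  assumes "continuous_on K g" "v \<in> dom0"
  shows "integrable \<mu> (\<lambda>x. g x * v x)"
  by (intro continuous_integrable continuous_intros assms dom_cont[OF dom0_D(1)])

lemma lap_add:
  assumes "lap u g" "lap v h"
  shows "lap (\<lambda>x. u x + v x) (\<lambda>x. g x + h x)"
proof (rule lapI)
  fix w assume w: "w \<in> dom0"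
  have "form (\<lambda>x. u x + v x) w = form u w + form v w"
    by (intro form_add_left lapD(1)[OF assms(1)] lapD(1)[OF assms(2)] dom0_D w)
  then show "form (\<lambda>x. u x + v x) w = - (\<integral>x. (g x + h x) * w x \<partial>\<mu>)"
    using lapD(3)[OF assms(1) w] lapD(3)[OF assms(2) w]
      integrable_lap[OF lapD(2)[OF assms(1)] w] integrable_lap[OF lapD(2)[OF assms(2)] w]
    by (simp add: distrib_right)
qed (intro dom_add continuous_intros lapD(1)[OF assms(1)] lapD(1)[OF assms(2)] lapD(2)[OF assms(1)] lapD(2)[OF assms(2)])+

lemma lap_scale:
  assumes "lap u g"
  shows "lap (\<lambda>x. c * u x) (\<lambda>x. c * g x)"
proof (rule lapI)
  fix w assume w: "w \<in> dom0"
  have "form (\<lambda>x. c * u x) w = c * form u w"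
    by (intro form_scale_left lapD(1)[OF assms] dom0_D w)
  then show "form (\<lambda>x. c * u x) w = - (\<integral>x. (c * g x) * w x \<partial>\<mu>)"
    using lapD(3)[OF assms(1) w] by (simp add: mult.assoc)
qed (intro dom_scale continuous_intros lapD(1)[OF assms] lapD(2)[OF assms])+

lemma lap_zero: "lap (\<lambda>_. 0) (\<lambda>_. 0)"
  by (rule lapI) (simp_all add: dom_const form_zero_left)

lemma lap_sum:
  assumes "finite A" "\<And>i. i \<in> A \<Longrightarrow> lap (u i) (g i)"
  shows "lap (\<lambda>x. \<Sum>i\<in>A. u i x) (\<lambda>x. \<Sum>i\<in>A. g i x)"
  using assms by (induction A rule: finite_induct) (auto intro: lap_add lap_zero)

text \<open>Testing the Laplacian against the truncation \<open>(v - k)\<^sup>+\<close> for \<open>k\<close> close to the maximum.\<close>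

lemma laplacian_at_maximum:
  assumes v: "lap v g" and V0: "\<And>p. p \<in> V0 \<Longrightarrow> v p \<le> 0"
    and x0: "x0 \<in> K" "v x0 > 0" and max: "\<And>y. y \<in> K \<Longrightarrow> v y \<le> v x0"
    and pos: "\<And>y. y \<in> K \<Longrightarrow> v y = v x0 \<Longrightarrow> g y > 0"
  shows False
proof -
  have v_cont: "continuous_on K v" and g_cont: "continuous_on K g"
    using lapD[OF v] dom_cont by blast+
  \<comment> \<open>\<open>k\<close> is the maximum of \<open>v\<close> over the compact set where
    \<open>g \<le> 0\<close>, which \<open>pos\<close> keeps below \<open>v x0\<close>. It is raised
    to 0 if negative, so that the truncation vanishes on \<open>V0\<close>, and is 0 if that set is
    empty.\<close>
  obtain k where k: "0 \<le> k" "k < v x0" "\<And>y. y \<in> K \<Longrightarrow> k < v y \<Longrightarrow> 0 < g y"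
  proof (cases "{y \<in> K. g y \<le> 0} = {}")
    case True
    then show ?thesis using that[of 0] x0 by force
  next
    case False
    have "closedin (top_of_set K) {y \<in> K. g y \<in> {..0}}"
      using continuous_closedin_preimage[OF g_cont, of "{..0}"] by (simp add: vimage_def Int_def)
    then have "compact {y \<in> K. g y \<le> 0}"
      using closedin_compact[OF compact_K] by simp
    then obtain y1 where y1: "y1 \<in> K" "g y1 \<le> 0" "\<And>y. y \<in> K \<Longrightarrow> g y \<le> 0 \<Longrightarrow> v y \<le> v y1"
      using continuous_attains_sup[OF _ False, of v] continuous_on_subset[OF v_cont, of "{y \<in> K. g y \<le> 0}"]
      by auto
    then have "v y1 < v x0" using max[of y1] pos[of y1] by force
    then show ?thesis using that[of "max 0 (v y1)"] x0 y1(3) by force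
  qed
  define \<psi> where "\<psi> = (\<lambda>x. max (v x - k) 0)"
  have "(\<lambda>x. max (v x - k) 0) \<in> dom"
    by (rule dom_contraction[OF lapD(1)[OF v]]) (auto intro!: continuous_intros)
  then have \<psi>: "\<psi> \<in> dom0" using V0 k(1) by (intro dom0I) (force simp: \<psi>_def)+
  have "0 \<le> form v \<psi>"
  proof (rule form_monotone_nonneg[OF lapD(1)[OF v] dom0_D(1)[OF \<psi>]])
    fix p q
    show "0 \<le> (v p - v q) * (\<psi> p - \<psi> q)"
      by (cases "v p \<le> v q") (auto simp: \<psi>_def intro!: mult_nonneg_nonneg mult_nonpos_nonpos)
  qed
  also have "form v \<psi> = - (\<integral>x. g x * \<psi> x \<partial>\<mu>)" by (rule lapD(3)[OF v \<psi>])
  finally have "(\<integral>x. g x * \<psi> x \<partial>\<mu>) \<le> 0" by simp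
  moreover have "(\<integral>x. g x * \<psi> x \<partial>\<mu>) > 0"
  proof (rule continuous_integral_pos[OF _ _ x0(1)])
    show "continuous_on K (\<lambda>x. g x * \<psi> x)"
      by (intro continuous_intros g_cont dom_cont[OF dom0_D(1)[OF \<psi>]])
    show "0 \<le> g x * \<psi> x" if "x \<in> K" for x
      using k(3)[OF that] by (cases "k < v x") (auto simp: \<psi>_def)
    show "0 < g x0 * \<psi> x0" using k(2) pos[OF x0(1)] by (simp add: \<psi>_def)
  qed
  ultimately show False by simp
qed

text \<open>Adding \<open>\<epsilon> * (s - a)^2\<close> makes the second time derivative of
  \<open>w\<close> strictly negative at an interior maximum, so the Laplacian is strictly positive
  there, which contradicts \<open>laplacian_at_maximum\<close>. The ends of the time interval and
  \<open>V0\<close> cannot carry the maximum, because \<open>w \<le> M\<close> there.\<close>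

lemma maximum_principle:
  fixes w w1 w2 g :: "real \<Rightarrow> 'k \<Rightarrow> real"
  assumes ab: "a < b" and cont: "continuous_on ({a..b} \<times> K) (\<lambda>(t, x). w t x)"
    and d1: "\<And>t x. a < t \<Longrightarrow> t < b \<Longrightarrow> x \<in> K - V0 \<Longrightarrow> ((\<lambda>s. w s x) has_real_derivative w1 t x) (at t)"
    and d2: "\<And>t x. a < t \<Longrightarrow> t < b \<Longrightarrow> x \<in> K - V0 \<Longrightarrow> ((\<lambda>s. w1 s x) has_real_derivative w2 t x) (at t)"
    and lap: "\<And>t. a < t \<Longrightarrow> t < b \<Longrightarrow> lap (w t) (g t)"
    and eq: "\<And>t x. a < t \<Longrightarrow> t < b \<Longrightarrow> x \<in> K - V0 \<Longrightarrow> w2 t x + g t x = 0"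
    and bd: "\<And>t p. a < t \<Longrightarrow> t < b \<Longrightarrow> p \<in> V0 \<Longrightarrow> w t p = 0"
    and M: "0 \<le> M" "\<And>x. x \<in> K \<Longrightarrow> w a x \<le> M" "\<And>x. x \<in> K \<Longrightarrow> w b x \<le> M"
    and tx: "t \<in> {a..b}" "x \<in> K"
  shows "w t x \<le> M"
proof (rule ccontr)
  assume "\<not> w t x \<le> M"
  define \<delta> where "\<delta> = w t x - M"
  have \<delta>: "\<delta> > 0" using \<open>\<not> w t x \<le> M\<close> by (simp add: \<delta>_def)
  \<comment> \<open>With this choice the perturbation is at most half of the excess \<delta>, so
    that \<open>w\<close> still exceeds \<open>M\<close> where the perturbed function is
    maximal.\<close>
  define \<epsilon> where "\<epsilon> = \<delta> / (2 * (b - a)\<^sup>2)"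
  have \<epsilon>: "\<epsilon> > 0" using \<delta> ab by (simp add: \<epsilon>_def)
  have \<epsilon>_le: "\<epsilon> * (s - a)\<^sup>2 \<le> \<delta> / 2" if "s \<in> {a..b}" for s
  proof -
    have "\<epsilon> * (s - a)\<^sup>2 \<le> \<epsilon> * (b - a)\<^sup>2"
      using that \<epsilon> by (intro mult_left_mono power_mono) auto
    also have "\<dots> = \<delta> / 2" using ab by (simp add: \<epsilon>_def)
    finally show ?thesis .
  qed
  define W where "W = (\<lambda>(s, y). w s y + \<epsilon> * (s - a)\<^sup>2)"
  have W_cont: "continuous_on ({a..b} \<times> K) W"
    unfolding W_def case_prod_unfold
    using cont by (intro continuous_intros) (simp add: case_prod_unfold)
  have "compact ({a..b} \<times> K)" by (intro compact_Times compact_K) simp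
  moreover have "{a..b} \<times> K \<noteq> {}" using tx by blast
  ultimately obtain z where z: "z \<in> {a..b} \<times> K" "\<forall>y\<in>{a..b} \<times> K. W y \<le> W z"
    using continuous_attains_sup[OF _ _ W_cont] by blast
  obtain t0 x0 where zt: "z = (t0, x0)" by fastforce
  have t0: "t0 \<in> {a..b}" "x0 \<in> K" and
    max: "\<And>s y. s \<in> {a..b} \<Longrightarrow> y \<in> K \<Longrightarrow> w s y + \<epsilon> * (s - a)\<^sup>2 \<le> w t0 x0 + \<epsilon> * (t0 - a)\<^sup>2"
    using z by (auto simp: zt W_def)
  have big: "w t0 x0 + \<epsilon> * (t0 - a)\<^sup>2 \<ge> M + \<delta>"
  proof -
    have "M + \<delta> \<le> w t x + \<epsilon> * (t - a)\<^sup>2" using \<epsilon> by (simp add: \<delta>_def)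
    with max[OF tx] show ?thesis by linarith
  qed
  have w_big: "w t0 x0 > M" using big \<epsilon>_le[OF t0(1)] \<delta> by linarith
  then have "t0 \<noteq> a" "t0 \<noteq> b" using M(2,3)[OF t0(2)] by auto
  then have t0': "a < t0" "t0 < b" using t0 by auto
  show False
  proof (rule laplacian_at_maximum[OF lap[OF t0'] _ t0(2)])
    show "w t0 p \<le> 0" if "p \<in> V0" for p using bd[OF t0' that] by simp
    show "w t0 x0 > 0" using w_big M(1) by simp
    show "w t0 y \<le> w t0 x0" if "y \<in> K" for y using max[OF t0(1) that] by simp
    \<comment> \<open>The weak argument asks for the sign at every maximum point of the time slice,
      and each of these is also a maximum point of the perturbed function \<open>W\<close>.\<close>
    fix y assume y: "y \<in> K" "w t0 y = w t0 x0"
    then have "y \<notin> V0" using bd[OF t0', of y] w_big M(1) by auto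
    then have y': "y \<in> K - V0" using y by simp
    have "w2 t0 y + 2 * \<epsilon> \<le> 0"
    proof (rule second_derivative_at_maximum[OF t0', where f = "\<lambda>s. w s y + \<epsilon> * (s - a)\<^sup>2"
          and ?f1.0 = "\<lambda>s. w1 s y + 2 * \<epsilon> * (s - a)"])
      fix s assume s: "a < s" "s < b"
      show "((\<lambda>s. w s y + \<epsilon> * (s - a)\<^sup>2) has_real_derivative w1 s y + 2 * \<epsilon> * (s - a)) (at s)"
        by (auto intro!: derivative_eq_intros d1[OF s y'])
      show "w s y + \<epsilon> * (s - a)\<^sup>2 \<le> w t0 y + \<epsilon> * (t0 - a)\<^sup>2"
        using max[of s y] s y by simp
    next
      show "((\<lambda>s. w1 s y + 2 * \<epsilon> * (s - a)) has_real_derivative w2 t0 y + 2 * \<epsilon>) (at t0)"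
        by (auto intro!: derivative_eq_intros d2[OF t0' y'])
    qed
    then show "g t0 y > 0" using eq[OF t0' y'] \<epsilon> by linarith
  qed
qed

text \<open>The form in which \<open>maximum_principle\<close> consumes harmonicity: the time
  derivatives are explicit witnesses, required only off \<open>V0\<close>.\<close>

definition real_harmonic :: "(real \<Rightarrow> 'k \<Rightarrow> real) \<Rightarrow> bool" where
  "real_harmonic u \<longleftrightarrow> continuous_on ({0<..} \<times> K) (\<lambda>(t, x). u t x) \<and>
     (\<forall>t>0. \<forall>p\<in>V0. u t p = 0) \<and>
     (\<exists>u1 u2 g. \<forall>t>0. lap (u t) (g t) \<and>
       (\<forall>x\<in>K - V0. ((\<lambda>s. u s x) has_real_derivative u1 t x) (at t) \<and>
          ((\<lambda>s. u1 s x) has_real_derivative u2 t x) (at t) \<and> u2 t x + g t x = 0))"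

end

context fractal_eigensystem
begin

section \<open>The Poisson kernel and the maximum principle\<close>

lemma lap_eigensum:
  "finite A \<Longrightarrow> lap (\<lambda>x. \<Sum>n\<in>A. a n * \<phi> n x) (\<lambda>x. \<Sum>n\<in>A. a n * (- lam n * \<phi> n x))"
  by (intro lap_sum lap_scale \<phi>_laplacian)

text \<open>The left side is harmonic in \<open>t\<close> and \<open>x\<close> and takes the given
  values at time 0. It tends to 0 uniformly as time grows, so for \<open>T\<close> large the bound
  \<open>M > 0\<close> also holds at time \<open>T\<close>, and the maximum principle covers the
  times in between.\<close>

lemma decay_sum_le:
  assumes t: "t \<ge> 0" and g: "\<And>x. x \<in> K \<Longrightarrow> (\<Sum>n<N. c n * \<phi> n x) \<le> M" and M: "0 < M" and x: "x \<in> K"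
  shows "(\<Sum>n<N. c n * decay t n * \<phi> n x) \<le> M"
proof -
  define h where "h = (\<lambda>s x. \<Sum>n<N. (c n * decay s n) * \<phi> n x)"
  have "((\<lambda>T. \<Sum>n<N. \<bar>c n\<bar> * exp (- sqrt (lam n) * T) * sqrt (sup_const * lam n)) \<longlongrightarrow>
      (\<Sum>n<N. \<bar>c n\<bar> * 0 * sqrt (sup_const * lam n))) at_top"
  proof (intro tendsto_sum tendsto_mult tendsto_const)
    fix n
    have "filterlim (\<lambda>T. - sqrt (lam n) * T) at_bot at_top"
      by (rule filterlim_tendsto_neg_mult_at_bot[OF tendsto_const _ filterlim_ident]) (use lam_pos in simp)
    then show "((\<lambda>T. exp (- sqrt (lam n) * T)) \<longlongrightarrow> 0) at_top"
      by (rule filterlim_compose[OF exp_at_bot])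
  qed
  then have "\<forall>\<^sub>F T in at_top. (\<Sum>n<N. \<bar>c n\<bar> * exp (- sqrt (lam n) * T) * sqrt (sup_const * lam n)) < M"
    using order_tendstoD(2)[of _ 0 at_top M] M by simp
  then have "\<forall>\<^sub>F T in at_top. (\<Sum>n<N. \<bar>c n\<bar> * exp (- sqrt (lam n) * T) * sqrt (sup_const * lam n)) < M \<and> t < T"
    using eventually_gt_at_top[of t] by (rule eventually_conj)
  then obtain T where T: "(\<Sum>n<N. \<bar>c n\<bar> * exp (- sqrt (lam n) * T) * sqrt (sup_const * lam n)) < M" "t < T"
    using eventually_happens'[OF trivial_limit_at_top_linorder] by blast
  have hT: "h T y \<le> M" if "y \<in> K" for y
  proof -
    have "h T y \<le> (\<Sum>n<N. \<bar>c n\<bar> * exp (- sqrt (lam n) * T) * sqrt (sup_const * lam n))"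
      unfolding h_def
    proof (rule sum_mono)
      fix n
      have "c n * decay T n * \<phi> n y \<le> \<bar>c n * decay T n * \<phi> n y\<bar>" by simp
      also have "\<dots> = \<bar>c n\<bar> * decay T n * \<bar>\<phi> n y\<bar>" using decay_pos[of T n] by (simp add: abs_mult)
      also have "\<dots> \<le> \<bar>c n\<bar> * decay T n * sqrt (sup_const * lam n)"
        using decay_pos[of T n] by (intro mult_left_mono \<phi>_le that) simp
      finally show "c n * decay T n * \<phi> n y \<le> \<bar>c n\<bar> * exp (- sqrt (lam n) * T) * sqrt (sup_const * lam n)"
        by (simp add: decay_def)
    qed
    with T(1) show ?thesis by simp
  qed
  have "h t x \<le> M"
  proof (rule maximum_principle[of 0 T h
        "\<lambda>s x. \<Sum>n<N. (c n * (- sqrt (lam n) * decay s n)) * \<phi> n x"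
        "\<lambda>s x. \<Sum>n<N. (c n * (lam n * decay s n)) * \<phi> n x"
        "\<lambda>s x. \<Sum>n<N. (c n * decay s n) * (- lam n * \<phi> n x)"])
    show "0 < T" using T t by simp
    show "continuous_on ({0..T} \<times> K) (\<lambda>(t, x). h t x)"
      unfolding h_def case_prod_unfold decay_def
      by (intro continuous_intros continuous_on_compose2[OF \<phi>_cont continuous_on_snd]) auto
    show "lap (h s) (\<lambda>x. \<Sum>n<N. (c n * decay s n) * (- lam n * \<phi> n x))" for s
      unfolding h_def by (rule lap_eigensum) simp
    show "((\<lambda>s. h s y) has_real_derivative (\<Sum>n<N. (c n * (- sqrt (lam n) * decay s n)) * \<phi> n y)) (at s)" for s y
      unfolding h_def decay_def by (auto intro!: derivative_eq_intros sum.cong)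
    show "((\<lambda>s. \<Sum>n<N. (c n * (- sqrt (lam n) * decay s n)) * \<phi> n y) has_real_derivative
        (\<Sum>n<N. (c n * (lam n * decay s n)) * \<phi> n y)) (at s)" for s y
      unfolding decay_def using lam_pos by (auto intro!: derivative_eq_intros sum.cong simp: less_imp_le)
    show "(\<Sum>n<N. (c n * (lam n * decay s n)) * \<phi> n y) + (\<Sum>n<N. (c n * decay s n) * (- lam n * \<phi> n y)) = 0" for s y
      by (simp add: sum.distrib[symmetric] algebra_simps)
    show "h s p = 0" if "p \<in> V0" for s p
      unfolding h_def using dom0_D(2)[OF \<phi>_dom0 that] by simp
    show "0 \<le> M" using M by simp
    show "h 0 y \<le> M" if "y \<in> K" for y
      using g[OF that] by (simp add: h_def decay_def)
  qed (use hT t T x in auto)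
  then show ?thesis by (simp add: h_def)
qed

text \<open>A partial sum of the uniform expansion exceeds \<open>M\<close> by less than \<delta>.
  This slack also makes the bound \<open>M + \<delta>\<close> strictly positive, as
  \<open>decay_sum_le\<close> requires.\<close>

lemma poisson_dom0_le:
  assumes g: "g \<in> dom0" "\<And>x. x \<in> K \<Longrightarrow> g x \<le> M" and M: "0 \<le> M" and t: "t > 0" and x: "x \<in> K"
  shows "(\<integral>y. pk t x y * g y \<partial>\<mu>) \<le> M"
proof (rule field_le_epsilon)
  fix \<delta> :: real assume \<delta>: "\<delta> > 0"
  have "(\<lambda>n. decay t n * \<phi> n x * coeff g n) sums (\<integral>y. pk t x y * g y \<partial>\<mu>)"
    unfolding coeff_def
    by (rule pk_integral_sums[OF sets_\<mu> t x continuous_integrable[OF dom_cont[OF dom0_D(1)[OF g(1)]]]])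
  then have lim: "(\<lambda>N. \<Sum>n<N. coeff g n * decay t n * \<phi> n x) \<longlonglongrightarrow> (\<integral>y. pk t x y * g y \<partial>\<mu>)"
    by (simp add: sums_def mult_ac)
  have "\<forall>\<^sub>F N in sequentially. \<forall>y\<in>K. dist (\<Sum>n<N. coeff g n * \<phi> n y) (g y) < \<delta>"
    by (rule uniform_limitD[OF eigen_expansion[OF g(1)] \<delta>])
  then have "\<forall>\<^sub>F N in sequentially. (\<Sum>n<N. coeff g n * decay t n * \<phi> n x) \<le> M + \<delta>"
  proof eventually_elim
    case (elim N)
    show ?case
    proof (rule decay_sum_le[OF _ _ _ x])
      fix y assume y: "y \<in> K"
      then have "dist (\<Sum>n<N. coeff g n * \<phi> n y) (g y) < \<delta>" using elim by blast
      then show "(\<Sum>n<N. coeff g n * \<phi> n y) \<le> M + \<delta>"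
        using g(2)[OF y] by (simp add: dist_real_def abs_less_iff)
    qed (use t M \<delta> in auto)
  qed
  then show "(\<integral>y. pk t x y * g y \<partial>\<mu>) \<le> M + \<delta>"
    by (rule tendsto_upperbound[OF lim]) simp
qed

text \<open>The sign of the kernel is an \<open>L\<^sup>2\<close>-limit of eigenfunction sums; truncating these to
  \<open>[-1, 1]\<close> keeps them in \<open>\<F>\<^sub>0\<close>.\<close>

lemma integral_abs_pk_le:
  assumes t: "t > 0" and x: "x \<in> K"
  shows "(\<integral>y. \<bar>pk t x y\<bar> \<partial>\<mu>) \<le> 1"
proof -
  have pk_meas [measurable]: "pk t x \<in> borel_measurable \<mu>" by (rule pk_measurable[OF sets_\<mu>])
  define f where "f = (\<lambda>y. sgn (pk t x y))"
  have f_meas [measurable]: "f \<in> borel_measurable \<mu>"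
    unfolding f_def by measurable
  have f_bd: "\<bar>f y\<bar> \<le> 1" for y by (simp add: f_def sgn_if)
  define s where "s = (\<lambda>N y. \<Sum>n<N. coeff f n * \<phi> n y)"
  \<comment> \<open>\<open>T\<close> is 1-Lipschitz and fixes 0, so it preserves the form domain and
    the boundary condition; it also fixes the values -1, 0 and 1 of \<open>f\<close>.\<close>
  define T where "T = (\<lambda>a::real. max (-1) (min 1 a))"
  have T_contr: "\<bar>T a - T b\<bar> \<le> \<bar>a - b\<bar>" for a b by (auto simp: T_def)
  have s_dom0: "s N \<in> dom0" for N unfolding s_def by (rule eigensum_dom0) simp
  have Ts_dom0: "(\<lambda>y. T (s N y)) \<in> dom0" for N
  proof (rule dom0I)
    show "(\<lambda>y. T (s N y)) \<in> dom"
      by (rule dom_contraction[OF dom0_D(1)[OF s_dom0] _ T_contr]) (auto simp: T_def intro!: continuous_intros)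
    show "T (s N p) = 0" if "p \<in> V0" for p using dom0_D(2)[OF s_dom0 that] by (simp add: T_def)
  qed
  have s_cont: "continuous_on K (s N)" "continuous_on K (\<lambda>y. T (s N y))" for N
    using dom_cont[OF dom0_D(1)[OF s_dom0]] dom_cont[OF dom0_D(1)[OF Ts_dom0]] by blast+
  have lim: "(\<lambda>N. sqrt (\<integral>y. (f y - s N y)\<^sup>2 \<partial>\<mu>)) \<longlonglongrightarrow> sqrt 0"
    unfolding s_def by (intro tendsto_real_sqrt L2_complete[OF f_meas, of 1] f_bd)
  have le: "(\<integral>y. \<bar>pk t x y\<bar> \<partial>\<mu>) \<le> 1 + pk_bound t * sqrt (\<integral>y. (f y - s N y)\<^sup>2 \<partial>\<mu>)" for N
  proof -
    obtain B where B: "\<And>y. y \<in> K \<Longrightarrow> norm (s N y) \<le> B" using continuous_bounded[OF s_cont(1)] by blast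
    have Bp: "0 \<le> pk_bound t" using pk_le[OF t x x] by linarith
    have int0: "integrable \<mu> (\<lambda>y. \<bar>pk t x y\<bar>)"
      by (rule bounded_integrable[where B = "pk_bound t"]) (use pk_le[OF t x] in auto)
    have int1: "integrable \<mu> (\<lambda>y. pk t x y * T (s N y))"
      using pk_integrable[OF sets_\<mu> t x continuous_integrable[OF s_cont(2)]] by simp
    have fs_meas: "(\<lambda>y. f y - s N y) \<in> borel_measurable \<mu>"
      by (intro borel_measurable_diff f_meas continuous_measurable s_cont)
    have fs_bd: "\<bar>f y - s N y\<bar> \<le> 1 + B" if "y \<in> K" for y
      using f_bd[of y] B[OF that] unfolding real_norm_def by linarith
    have int2: "integrable \<mu> (\<lambda>y. pk_bound t * \<bar>f y - s N y\<bar>)"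
      by (intro integrable_mult_right bounded_integrable[where B = "1 + B"] borel_measurable_abs fs_meas)
        (use fs_bd in auto)
    \<comment> \<open>The absolute value is the kernel times \<open>T (f y)\<close>; replacing
      \<open>f\<close> by a partial sum inside \<open>T\<close> costs at most the kernel bound times
      their distance.\<close>
    have pt: "\<bar>pk t x y\<bar> \<le> pk t x y * T (s N y) + pk_bound t * \<bar>f y - s N y\<bar>" if "y \<in> K" for y
    proof -
      have "\<bar>pk t x y\<bar> = pk t x y * T (f y)" by (simp add: f_def T_def sgn_if)
      also have "\<dots> = pk t x y * T (s N y) + pk t x y * (T (f y) - T (s N y))" by (simp add: algebra_simps)
      also have "pk t x y * (T (f y) - T (s N y)) \<le> \<bar>pk t x y\<bar> * \<bar>T (f y) - T (s N y)\<bar>"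
        by (simp flip: abs_mult)
      also have "\<dots> \<le> pk_bound t * \<bar>f y - s N y\<bar>"
        by (intro mult_mono pk_le t x that T_contr) (use Bp in auto)
      finally show ?thesis by simp
    qed
    have "(\<integral>y. \<bar>pk t x y\<bar> \<partial>\<mu>) \<le> (\<integral>y. pk t x y * T (s N y) + pk_bound t * \<bar>f y - s N y\<bar> \<partial>\<mu>)"
      by (rule integral_mono[OF int0 Bochner_Integration.integrable_add[OF int1 int2]]) (use pt in \<open>simp add: space_\<mu>\<close>)
    also have "\<dots> = (\<integral>y. pk t x y * T (s N y) \<partial>\<mu>) + pk_bound t * (\<integral>y. \<bar>f y - s N y\<bar> \<partial>\<mu>)"
      using int1 int2 by (subst Bochner_Integration.integral_add) auto
    also have "(\<integral>y. pk t x y * T (s N y) \<partial>\<mu>) \<le> 1"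
      by (rule poisson_dom0_le[OF Ts_dom0 _ _ t x]) (auto simp: T_def)
    also have "(\<integral>y. \<bar>f y - s N y\<bar> \<partial>\<mu>) \<le> sqrt (\<integral>y. (f y - s N y)\<^sup>2 \<partial>\<mu>)"
      by (rule integral_abs_le_L2[OF fs_meas fs_bd])
    finally show ?thesis using Bp by (simp add: mult_left_mono)
  qed
  have "(\<lambda>N. 1 + pk_bound t * sqrt (\<integral>y. (f y - s N y)\<^sup>2 \<partial>\<mu>)) \<longlonglongrightarrow> 1 + pk_bound t * sqrt 0"
    by (intro tendsto_intros lim)
  from LIMSEQ_le_const[OF this] le show ?thesis by simp
qed

end

section \<open>Fourier coefficients of harmonic functions\<close>

context fractal_eigensystem
begin

lemma real_harmonicD:
  assumes "real_harmonic u"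
  shows "continuous_on ({0<..} \<times> K) (\<lambda>(t, x). u t x)"
    and "t > 0 \<Longrightarrow> u t \<in> dom0" and "t > 0 \<Longrightarrow> continuous_on K (u t)"
proof -
  show "continuous_on ({0<..} \<times> K) (\<lambda>(t, x). u t x)"
    using assms by (simp add: real_harmonic_def)
  show "u t \<in> dom0" if "t > 0" for t
    using assms that lapD(1) unfolding real_harmonic_def by (intro dom0I) blast+
  then show "continuous_on K (u t)" if "t > 0" for t
    using that dom_cont dom0_D(1) by blast
qed

text \<open>The derivatives of \<open>u\<close> need not be bounded near a given time, so the differential equation of
  the Fourier coefficients is not obtained by differentiating under the integral sign. Instead \<open>u\<close>
  is compared with finite eigenfunction sums by the maximum principle.\<close>

lemma real_harmonic_comparison:
  assumes u: "real_harmonic u" and ab: "0 < a" "a < b"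
    and \<alpha>: "\<And>n t. (\<alpha> n has_real_derivative \<alpha>1 n t) (at t)"
      "\<And>n t. (\<alpha>1 n has_real_derivative lam n * \<alpha> n t) (at t)"
    and ends: "\<And>x. x \<in> K \<Longrightarrow> \<bar>u a x - (\<Sum>n<N. \<alpha> n a * \<phi> n x)\<bar> \<le> \<delta>"
      "\<And>x. x \<in> K \<Longrightarrow> \<bar>u b x - (\<Sum>n<N. \<alpha> n b * \<phi> n x)\<bar> \<le> \<delta>"
    and tx: "t \<in> {a..b}" "x \<in> K"
  shows "\<bar>u t x - (\<Sum>n<N. \<alpha> n t * \<phi> n x)\<bar> \<le> \<delta>"
proof -
  define h where "h = (\<lambda>t x. \<Sum>n<N. \<alpha> n t * \<phi> n x)"
  obtain u1 u2 g where H: "\<forall>t>0. lap (u t) (g t) \<and>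
       (\<forall>x\<in>K - V0. ((\<lambda>s. u s x) has_real_derivative u1 t x) (at t) \<and>
          ((\<lambda>s. u1 s x) has_real_derivative u2 t x) (at t) \<and> u2 t x + g t x = 0)"
    using u unfolding real_harmonic_def by (elim conjE exE) (erule that)
  have ug: "lap (u t) (g t)" if "t > 0" for t
    using H that by simp
  have ugx: "((\<lambda>s. u s x) has_real_derivative u1 t x) (at t)"
      "((\<lambda>s. u1 s x) has_real_derivative u2 t x) (at t)" "u2 t x + g t x = 0"
    if "t > 0" "x \<in> K - V0" for t x
    using bspec[OF conjunct2[OF mp[OF spec[OF H] that(1)]] that(2)] by simp_all
  have \<delta>: "0 \<le> \<delta>" using ends(1)[OF tx(2)] by linarith
  have \<alpha>_cont: "continuous_on A (\<alpha> n)" for n A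
    by (rule continuous_at_imp_continuous_on) (use \<alpha>(1) DERIV_isCont in blast)
  have u_cont: "continuous_on ({a..b} \<times> K) (\<lambda>z. u (fst z) (snd z))"
    using continuous_on_subset[OF real_harmonicD(1)[OF u], of "{a..b} \<times> K"] ab
    by (force simp: case_prod_unfold)
  have h_cont: "continuous_on ({a..b} \<times> K) (\<lambda>z. h (fst z) (snd z))"
    unfolding h_def
    by (intro continuous_intros continuous_on_compose2[OF \<phi>_cont continuous_on_snd]
        continuous_on_compose2[OF \<alpha>_cont continuous_on_fst]) auto
  have h1: "((\<lambda>s. h s y) has_real_derivative (\<Sum>n<N. \<alpha>1 n s * \<phi> n y)) (at s)" for s y
    unfolding h_def by (auto intro!: derivative_eq_intros \<alpha>)
  have h2: "((\<lambda>s. \<Sum>n<N. \<alpha>1 n s * \<phi> n y) has_real_derivative (\<Sum>n<N. lam n * \<alpha> n s * \<phi> n y)) (at s)" for s y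
    by (auto intro!: derivative_eq_intros \<alpha>)
  have h_lap: "lap (h s) (\<lambda>y. \<Sum>n<N. \<alpha> n s * (- lam n * \<phi> n y))" for s
    unfolding h_def by (rule lap_eigensum) simp
  \<comment> \<open>Both signs \<open>c\<close> are handled together, which gives the two halves of
    the absolute value.\<close>
  have bound: "c * (u t x - h t x) \<le> \<delta>" if c: "c = 1 \<or> c = -1" for c
  proof (rule maximum_principle[OF ab(2), of "\<lambda>s y. c * (u s y - h s y)"
        "\<lambda>s y. c * (u1 s y - (\<Sum>n<N. \<alpha>1 n s * \<phi> n y))"
        "\<lambda>s y. c * (u2 s y - (\<Sum>n<N. lam n * \<alpha> n s * \<phi> n y))"
        "\<lambda>s y. c * (g s y + (- 1) * (\<Sum>n<N. \<alpha> n s * (- lam n * \<phi> n y)))"])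
    show "continuous_on ({a..b} \<times> K) (\<lambda>(t, x). c * (u t x - h t x))"
      unfolding case_prod_unfold by (intro continuous_intros u_cont h_cont)
    show "((\<lambda>s. c * (u s y - h s y)) has_real_derivative c * (u1 s y - (\<Sum>n<N. \<alpha>1 n s * \<phi> n y))) (at s)"
      if "a < s" "s < b" "y \<in> K - V0" for s y
      by (rule DERIV_cmult[OF DERIV_diff[OF ugx(1) h1]]) (use that ab in auto)
    show "((\<lambda>s. c * (u1 s y - (\<Sum>n<N. \<alpha>1 n s * \<phi> n y))) has_real_derivative
        c * (u2 s y - (\<Sum>n<N. lam n * \<alpha> n s * \<phi> n y))) (at s)"
      if "a < s" "s < b" "y \<in> K - V0" for s y
      by (rule DERIV_cmult[OF DERIV_diff[OF ugx(2) h2]]) (use that ab in auto)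
    show "lap (\<lambda>y. c * (u s y - h s y)) (\<lambda>y. c * (g s y + (- 1) * (\<Sum>n<N. \<alpha> n s * (- lam n * \<phi> n y))))"
      if "a < s" "s < b" for s
      using lap_scale[OF lap_add[OF ug[of s] lap_scale[OF h_lap[of s], of "-1"]], of c] that ab by simp
    show "c * (u2 s y - (\<Sum>n<N. lam n * \<alpha> n s * \<phi> n y)) +
        c * (g s y + (- 1) * (\<Sum>n<N. \<alpha> n s * (- lam n * \<phi> n y))) = 0"
      if "a < s" "s < b" "y \<in> K - V0" for s y
    proof -
      let ?X = "\<Sum>n<N. \<alpha> n s * (- lam n * \<phi> n y)" and ?Y = "\<Sum>n<N. lam n * \<alpha> n s * \<phi> n y"
      have X: "?X = - ?Y"
        by (simp add: sum_negf[symmetric] mult_ac del: sum_negf)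
      have "c * (u2 s y - ?Y) + c * (g s y + (- 1) * ?X) = c * (u2 s y + g s y)"
        unfolding X by (simp add: algebra_simps)
      also have "u2 s y + g s y = 0" using ugx(3)[of s y] that ab by simp
      finally show ?thesis by simp
    qed
    show "c * (u s p - h s p) = 0" if "a < s" "s < b" "p \<in> V0" for s p
    proof -
      have "u s p = 0" using dom0_D(2)[OF real_harmonicD(2)[OF u] that(3), of s] that ab by simp
      moreover have "h s p = 0" unfolding h_def using dom0_D(2)[OF \<phi>_dom0 that(3)] by simp
      ultimately show ?thesis by simp
    qed
    show "c * (u a y - h a y) \<le> \<delta>" if "y \<in> K" for y
      using ends(1)[OF that] c unfolding h_def abs_le_iff by auto
    show "c * (u b y - h b y) \<le> \<delta>" if "y \<in> K" for y
      using ends(2)[OF that] c unfolding h_def abs_le_iff by auto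
  qed (use \<delta> tx in auto)
  show ?thesis using bound[of 1] bound[of "-1"] unfolding h_def abs_le_iff by simp
qed

text \<open>\<open>\<alpha> n\<close> solves \<open>y'' = lam n * y\<close> with the end values of
  the coefficient, hence the hyperbolic sines. The partial sums with coefficients
  \<open>\<alpha> n\<close> are harmonic and uniformly close to \<open>u\<close> at both ends, so by
  \<open>real_harmonic_comparison\<close> they are close at every time in between.\<close>

lemma coeff_two_point:
  assumes u: "real_harmonic u" and ab: "0 < a" "a < b" and t: "t \<in> {a..b}"
  shows "coeff (u t) n * sinh (sqrt (lam n) * (b - a)) =
    coeff (u a) n * sinh (sqrt (lam n) * (b - t)) + coeff (u b) n * sinh (sqrt (lam n) * (t - a))"
proof -
  let ?s = "\<lambda>n. sqrt (lam n)"
  have s_pos: "?s n > 0" for n using lam_pos by simp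
  have sinh_pos: "sinh (?s n * (b - a)) > 0" for n using s_pos ab by simp
  define \<alpha> where "\<alpha> n t = (coeff (u a) n * sinh (?s n * (b - t)) + coeff (u b) n * sinh (?s n * (t - a))) /
      sinh (?s n * (b - a))" for n t
  define \<alpha>1 where "\<alpha>1 n t = (coeff (u a) n * (- ?s n * cosh (?s n * (b - t))) +
      coeff (u b) n * (?s n * cosh (?s n * (t - a)))) / sinh (?s n * (b - a))" for n t
  have d1: "(\<alpha> n has_real_derivative \<alpha>1 n t) (at t)" for n t
    unfolding \<alpha>_def \<alpha>1_def by (rule DERIV_cdivide) (auto intro!: derivative_eq_intros simp: algebra_simps)
  have d2: "(\<alpha>1 n has_real_derivative lam n * \<alpha> n t) (at t)" for n t
  proof -
    define s where "s = ?s n"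
    have l: "lam n = s * s" using lam_pos[of n] by (simp add: s_def)
    have "(\<alpha>1 n has_real_derivative (coeff (u a) n * (s * s * sinh (s * (b - t))) +
        coeff (u b) n * (s * s * sinh (s * (t - a)))) / sinh (s * (b - a))) (at t)"
      unfolding \<alpha>1_def s_def[symmetric]
      by (rule DERIV_cdivide) (auto intro!: derivative_eq_intros simp: algebra_simps)
    moreover have "(coeff (u a) n * (s * s * sinh (s * (b - t))) +
        coeff (u b) n * (s * s * sinh (s * (t - a)))) / sinh (s * (b - a)) = lam n * \<alpha> n t"
      unfolding \<alpha>_def s_def[symmetric] unfolding l by (simp add: algebra_simps)
    ultimately show ?thesis by simp
  qed
  have \<alpha>_ends: "\<alpha> n a = coeff (u a) n" "\<alpha> n b = coeff (u b) n" for n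
    using sinh_pos[of n] by (auto simp: \<alpha>_def)
  have b: "0 < b" and t0: "0 < t" using ab t by auto
  let ?C = "sqrt (sup_const * lam n)"
  have C: "0 \<le> ?C" using sup_const(1) lam_pos[of n] by simp
  have "\<bar>coeff (u t) n - \<alpha> n t\<bar> \<le> 0 + \<epsilon>" if \<epsilon>: "\<epsilon> > 0" for \<epsilon>
  proof -
    \<comment> \<open>Integrating against \<open>\<phi> n\<close> multiplies the uniform error by at
      most \<open>?C\<close>; the added 1 keeps the denominator positive.\<close>
    define \<delta> where "\<delta> = \<epsilon> / (?C + 1)"
    have \<delta>: "\<delta> > 0" unfolding \<delta>_def by (intro divide_pos_pos \<epsilon> add_nonneg_pos C) simp
    have "\<forall>\<^sub>F N in sequentially. (\<forall>y\<in>K. dist (\<Sum>n<N. coeff (u a) n * \<phi> n y) (u a y) < \<delta>) \<and>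
        ((\<forall>y\<in>K. dist (\<Sum>n<N. coeff (u b) n * \<phi> n y) (u b y) < \<delta>) \<and> n < N)"
      by (intro eventually_conj uniform_limitD[OF eigen_expansion] real_harmonicD u ab b \<delta> eventually_gt_at_top)
    then obtain N where N: "\<And>y. y \<in> K \<Longrightarrow> dist (\<Sum>n<N. coeff (u a) n * \<phi> n y) (u a y) < \<delta>"
        "\<And>y. y \<in> K \<Longrightarrow> dist (\<Sum>n<N. coeff (u b) n * \<phi> n y) (u b y) < \<delta>" "n < N"
      using eventually_happens'[OF sequentially_bot] by blast
    let ?h = "\<lambda>y. \<Sum>n<N. \<alpha> n t * \<phi> n y"
    have close: "\<bar>u t y - ?h y\<bar> \<le> \<delta>" if "y \<in> K" for y
    proof (rule real_harmonic_comparison[OF u ab d1 d2 _ _ t that])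
      show "\<bar>u a x - (\<Sum>n<N. \<alpha> n a * \<phi> n x)\<bar> \<le> \<delta>" if "x \<in> K" for x
        using N(1)[OF that] by (simp add: \<alpha>_ends dist_real_def abs_minus_commute)
      show "\<bar>u b x - (\<Sum>n<N. \<alpha> n b * \<phi> n x)\<bar> \<le> \<delta>" if "x \<in> K" for x
        using N(2)[OF that] by (simp add: \<alpha>_ends dist_real_def abs_minus_commute)
    qed
    have int: "integrable \<mu> (\<lambda>y. u t y * \<phi> n y)" "integrable \<mu> (\<lambda>y. ?h y * \<phi> n y)"
      by (intro continuous_integrable continuous_intros \<phi>_cont real_harmonicD(3)[OF u t0])+
    \<comment> \<open>The requirement \<open>n < N\<close> ensures that the coefficient in question
      occurs in the partial sum.\<close>
    have "coeff (u t) n - \<alpha> n t = coeff (u t) n - coeff ?h n"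
      using N(3) by (simp add: coeff_eigensum)
    also have "\<dots> = (\<integral>y. (u t y - ?h y) * \<phi> n y \<partial>\<mu>)"
      unfolding coeff_def using int by (simp add: left_diff_distrib)
    finally have "\<bar>coeff (u t) n - \<alpha> n t\<bar> = \<bar>\<integral>y. (u t y - ?h y) * \<phi> n y \<partial>\<mu>\<bar>" by simp
    also have "\<dots> \<le> (\<integral>y. \<bar>(u t y - ?h y) * \<phi> n y\<bar> \<partial>\<mu>)"
      by (rule integral_abs_bound)
    also have "\<dots> \<le> (\<integral>y. \<delta> * ?C \<partial>\<mu>)"
    proof (rule integral_mono)
      show "integrable \<mu> (\<lambda>y. \<bar>(u t y - ?h y) * \<phi> n y\<bar>)"
        by (intro continuous_integrable continuous_intros \<phi>_cont real_harmonicD(3)[OF u t0])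
      show "\<bar>(u t y - ?h y) * \<phi> n y\<bar> \<le> \<delta> * ?C" if "y \<in> space \<mu>" for y
        unfolding abs_mult using that \<delta> by (intro mult_mono close \<phi>_le) (auto simp: space_\<mu>)
    qed simp
    also have "\<dots> = \<delta> * ?C" by (simp add: prob_space)
    also have "\<dots> \<le> \<delta> * (?C + 1)" using \<delta> by simp
    also have "\<dots> = \<epsilon>"
    proof -
      have "?C + 1 \<noteq> 0" using C by linarith
      then show ?thesis unfolding \<delta>_def by (rule nonzero_eq_divide_eq[THEN iffD1, OF _ refl])
    qed
    finally show ?thesis by simp
  qed
  then have "\<bar>coeff (u t) n - \<alpha> n t\<bar> \<le> 0" by (rule field_le_epsilon)
  then have eq: "coeff (u t) n = \<alpha> n t" by simp
  have "sinh (?s n * (b - a)) \<noteq> 0" using sinh_pos[of n] by linarith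
  from nonzero_eq_divide_eq[THEN iffD1, OF this eq[unfolded \<alpha>_def]] show ?thesis .
qed

text \<open>In the two-point formula \<open>b\<close> is sent to infinity. Boundedness of the
  coefficients excludes the growing exponential, so only the decaying one remains.\<close>

lemma coeff_bounded_decay:
  assumes u: "real_harmonic u" and bd: "\<And>t. t > 0 \<Longrightarrow> \<bar>coeff (u t) n\<bar> \<le> C"
    and at: "0 < a" "a \<le> t"
  shows "coeff (u t) n * exp (sqrt (lam n) * t) = coeff (u a) n * exp (sqrt (lam n) * a)"
proof -
  define s where "s = sqrt (lam n)"
  have s: "s > 0" using lam_pos by (simp add: s_def)
  have exp_lim: "((\<lambda>b. exp (- c * b)) \<longlongrightarrow> 0) at_top" if "c > 0" for c :: real
  proof (rule filterlim_compose[OF exp_at_bot])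
    show "filterlim (\<lambda>b. - c * b) at_bot at_top"
      by (rule filterlim_tendsto_neg_mult_at_bot[OF tendsto_const _ filterlim_ident]) (use that in simp)
  qed
  \<comment> \<open>\<open>L\<close> and \<open>R\<close> are the two sides of
    \<open>coeff_two_point\<close> times \<open>2 * exp (- s * b)\<close>, with the sines that
    contain \<open>b\<close> written out as exponentials.\<close>
  define L where "L b = coeff (u t) n * (exp (- s * a) - exp (s * a) * exp (- (2 * s) * b))" for b
  define R where "R b = coeff (u a) n * (exp (- s * t) - exp (s * t) * exp (- (2 * s) * b))
      + (coeff (u b) n * exp (- s * b)) * (2 * sinh (s * (t - a)))" for b
  have "\<forall>\<^sub>F b in at_top. L b = R b"
    using eventually_gt_at_top[of t]
  proof eventually_elim
    case (elim b)
    have *: "2 * exp (- s * b) * sinh (s * (b - c)) = exp (- s * c) - exp (s * c) * exp (- (2 * s) * b)" for c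
    proof -
      have "2 * exp (- s * b) * sinh (s * (b - c)) =
          exp (- s * b) * exp (s * (b - c)) - exp (- s * b) * exp (- (s * (b - c)))"
        by (simp add: sinh_field_def right_diff_distrib)
      also have "exp (- s * b) * exp (s * (b - c)) = exp (- s * c)"
        unfolding exp_add[symmetric] by (simp add: algebra_simps)
      also have "exp (- s * b) * exp (- (s * (b - c))) = exp (s * c) * exp (- (2 * s) * b)"
        unfolding exp_add[symmetric] by (simp add: algebra_simps)
      finally show ?thesis .
    qed
    have "2 * exp (- s * b) * (coeff (u t) n * sinh (s * (b - a))) =
        2 * exp (- s * b) * (coeff (u a) n * sinh (s * (b - t)) + coeff (u b) n * sinh (s * (t - a)))"
      using coeff_two_point[OF u at(1) _, of b t n] at elim unfolding s_def by simp
    then have "coeff (u t) n * (2 * exp (- s * b) * sinh (s * (b - a))) =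
        coeff (u a) n * (2 * exp (- s * b) * sinh (s * (b - t))) +
        (coeff (u b) n * exp (- s * b)) * (2 * sinh (s * (t - a)))"
      by (simp add: algebra_simps)
    then show ?case unfolding * L_def R_def .
  qed
  moreover have "(L \<longlongrightarrow> coeff (u t) n * (exp (- s * a) - exp (s * a) * 0)) at_top"
    unfolding L_def by (intro tendsto_intros exp_lim) (use s in simp)
  moreover have "(R \<longlongrightarrow> coeff (u a) n * (exp (- s * t) - exp (s * t) * 0) + 0 * (2 * sinh (s * (t - a)))) at_top"
  proof -
    have "((\<lambda>b. coeff (u b) n * exp (- s * b)) \<longlongrightarrow> 0) at_top"
    proof (rule Lim_null_comparison)
      show "\<forall>\<^sub>F b in at_top. norm (coeff (u b) n * exp (- s * b)) \<le> C * exp (- s * b)"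
        using eventually_gt_at_top[of 0]
        by eventually_elim (use bd in \<open>auto simp: abs_mult intro: mult_right_mono\<close>)
      show "((\<lambda>b. C * exp (- s * b)) \<longlongrightarrow> 0) at_top"
        using tendsto_mult_left[OF exp_lim[OF s], of C] by simp
    qed
    then show ?thesis
      unfolding R_def by (intro tendsto_intros exp_lim) (use s in simp)
  qed
  ultimately have "coeff (u t) n * exp (- s * a) = coeff (u a) n * exp (- s * t)"
    using tendsto_unique[OF trivial_limit_at_top_linorder] tendsto_cong[of L R] by force
  then have eq: "coeff (u t) n * exp (- s * a) * (exp (s * a) * exp (s * t)) =
      coeff (u a) n * exp (- s * t) * (exp (s * a) * exp (s * t))" by (simp only:)
  have e: "exp (- s * x) * exp (s * x) = 1" for x
    by (simp flip: exp_add)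
  have "coeff (u t) n * exp (s * t) * (exp (- s * a) * exp (s * a)) =
      coeff (u a) n * exp (s * a) * (exp (- s * t) * exp (s * t))"
    using eq by (simp only: mult_ac)
  then show ?thesis unfolding e unfolding s_def by (simp only: mult_1_right)
qed

text \<open>Since each eigenfunction is bounded, the bound on the integrals makes each coefficient
  bounded in time, so \<open>coeff_bounded_decay\<close> applies.\<close>

lemma real_harmonic_expansion:
  assumes u: "real_harmonic u" and bd: "\<And>t. t > 0 \<Longrightarrow> (\<integral>x. \<bar>u t x\<bar> \<partial>\<mu>) \<le> M"
  obtains B where "\<And>t n. t > 0 \<Longrightarrow> coeff (u t) n = decay t n * B n"
    "\<And>t x. t > 0 \<Longrightarrow> x \<in> K \<Longrightarrow> (\<lambda>n. decay t n * \<phi> n x * B n) sums u t x"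
proof -
  have c_bd: "\<bar>coeff (u t) n\<bar> \<le> sqrt (sup_const * lam n) * M" if t: "t > 0" for t n
  proof -
    have 0: "0 \<le> sqrt (sup_const * lam n)" using sup_const(1) lam_pos[of n] by simp
    have "\<bar>coeff (u t) n\<bar> \<le> (\<integral>x. \<bar>u t x * \<phi> n x\<bar> \<partial>\<mu>)"
      unfolding coeff_def by (rule integral_abs_bound)
    also have "\<dots> \<le> (\<integral>x. sqrt (sup_const * lam n) * \<bar>u t x\<bar> \<partial>\<mu>)"
    proof (rule integral_mono)
      show "\<bar>u t x * \<phi> n x\<bar> \<le> sqrt (sup_const * lam n) * \<bar>u t x\<bar>" if "x \<in> space \<mu>" for x
        unfolding abs_mult using mult_left_mono[OF \<phi>_le[of x n], of "\<bar>u t x\<bar>"] that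
        by (simp add: space_\<mu> mult.commute)
    qed (intro continuous_integrable continuous_intros \<phi>_cont real_harmonicD(3)[OF u t])+
    also have "\<dots> \<le> sqrt (sup_const * lam n) * M"
      using mult_left_mono[OF bd[OF t] 0] by simp
    finally show ?thesis .
  qed
  \<comment> \<open>The coefficient at time 1, continued back to time 0.\<close>
  define B where "B n = coeff (u 1) n * exp (sqrt (lam n))" for n
  have *: "coeff (u t) n * exp (sqrt (lam n) * t) = B n" if "t > 0" for t n
  proof (cases "t \<le> 1")
    case True
    from coeff_bounded_decay[where n = n, OF u c_bd that True] show ?thesis by (simp add: B_def)
  next
    case False
    then have "1 \<le> t" by simp
    from coeff_bounded_decay[where n = n, OF u c_bd zero_less_one this] show ?thesis by (simp add: B_def)
  qed
  have c: "coeff (u t) n = decay t n * B n" if "t > 0" for t n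
    unfolding *[OF that, symmetric] decay_def by (simp add: exp_minus)
  moreover have "(\<lambda>n. decay t n * \<phi> n x * B n) sums u t x" if "t > 0" "x \<in> K" for t x
    using tendsto_uniform_limitI[OF eigen_expansion[OF real_harmonicD(2)[OF u that(1)]] that(2)]
    by (simp add: c[OF that(1)] sums_def mult_ac)
  ultimately show thesis using that by blast
qed

end

section \<open>Poisson integrals of functions\<close>

text \<open>The convex function \<open>a powr p\<close> lies above its tangent at \<open>c\<close>.
  The case \<open>p > 1\<close> is Young's inequality.\<close>

lemma powr_tangent_le:
  fixes a c p :: real
  assumes "1 \<le> p" "0 \<le> a" "0 < c"
  shows "p * c powr (p - 1) * a \<le> a powr p + (p - 1) * c powr p"
proof (cases "p = 1")
  case True
  then show ?thesis using assms by simp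
next
  case False
  then have p: "p > 1" using assms by simp
  define q where "q = p / (p - 1)"
  have q: "q > 1" "1 / p + 1 / q = 1" using p by (auto simp: q_def field_simps)
  have "a * c powr (p - 1) \<le> a powr p / p + (c powr (p - 1)) powr q / q"
    by (rule Youngs_inequality) (use p q assms in auto)
  also have "(c powr (p - 1)) powr q = c powr p"
    using p by (simp add: powr_powr q_def)
  finally have "p * (a * c powr (p - 1)) \<le> p * (a powr p / p + c powr p / q)"
    using p by (intro mult_left_mono) auto
  also have "\<dots> = a powr p + (p - 1) * c powr p"
    using p by (simp add: q_def field_simps)
  finally show ?thesis by (simp add: mult_ac)
qed

context fractal_eigensystem
begin

abbreviation PI :: "('k \<Rightarrow> 'c::{banach, second_countable_topology}) \<Rightarrow> real \<Rightarrow> 'k \<Rightarrow> 'c" where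
  "PI \<equiv> poisson_integral \<mu> lam \<phi>"

lemma PI_real: "PI f t x = (\<integral>y. pk t x y * f y \<partial>\<mu>)"
  by (simp add: poisson_integral_def)

lemma integrable_pk: "t > 0 \<Longrightarrow> x \<in> K \<Longrightarrow> integrable \<mu> (pk t x)"
  by (rule bounded_integrable[where B = "pk_bound t"]) (use pk_le pk_measurable[OF sets_\<mu>] in auto)

lemma norm_PI_le:
  assumes "integrable \<mu> f" "t > 0" "x \<in> K"
  shows "norm (PI f t x) \<le> (\<integral>y. \<bar>pk t x y\<bar> * norm (f y) \<partial>\<mu>)"
  using integral_norm_bound[of \<mu> "\<lambda>y. pk t x y *\<^sub>R f y"] by (simp add: poisson_integral_def)

lemma integrable_abs_pk_mult:
  assumes "integrable \<mu> (h :: 'k \<Rightarrow> real)" "t > 0" "x \<in> K"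
  shows "integrable \<mu> (\<lambda>y. \<bar>pk t x y\<bar> * \<bar>h y\<bar>)"
  using integrable_norm[OF pk_integrable[OF sets_\<mu> assms(2,3,1)]] by (simp add: abs_mult)

text \<open>Jensen's inequality for a kernel of mass at most 1: the tangent is taken at the mean
  \<open>?c\<close> and integrated. The mass multiplies the nonnegative term
  \<open>(p - 1) * ?c powr p\<close>, so an upper bound for it is enough.\<close>

lemma norm_PI_powr_le:
  assumes f: "integrable \<mu> f" and t: "t > 0" and x: "x \<in> K" and p: "1 \<le> p"
    and fp: "integrable \<mu> (\<lambda>y. norm (f y) powr p)"
  shows "norm (PI f t x) powr p \<le> (\<integral>y. \<bar>pk t x y\<bar> * norm (f y) powr p \<partial>\<mu>)"
proof -
  let ?c = "\<integral>y. \<bar>pk t x y\<bar> * norm (f y) \<partial>\<mu>"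
  let ?I = "\<integral>y. \<bar>pk t x y\<bar> * norm (f y) powr p \<partial>\<mu>"
  have c0: "0 \<le> ?c" by (rule integral_nonneg_AE) simp
  have I0: "0 \<le> ?I" by (rule integral_nonneg_AE) simp
  have int1: "integrable \<mu> (\<lambda>y. \<bar>pk t x y\<bar> * norm (f y))"
    using integrable_abs_pk_mult[OF integrable_norm[OF f] t x] by simp
  have int2: "integrable \<mu> (\<lambda>y. \<bar>pk t x y\<bar> * norm (f y) powr p)"
    using integrable_abs_pk_mult[OF fp t x] by simp
  have int3: "integrable \<mu> (\<lambda>y. \<bar>pk t x y\<bar>)" using integrable_pk[OF t x] by simp
  have "?c powr p \<le> ?I"
  \<comment> \<open>The tangent inequality is available only at a positive point.\<close>
  proof (cases "?c = 0")
    case True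
    then show ?thesis using I0 p by simp
  next
    case False
    then have c: "?c > 0" using c0 by linarith
    have pt: "p * ?c powr (p - 1) * (\<bar>pk t x y\<bar> * norm (f y)) \<le>
        \<bar>pk t x y\<bar> * norm (f y) powr p + (p - 1) * ?c powr p * \<bar>pk t x y\<bar>" for y
      using mult_left_mono[OF powr_tangent_le[OF p norm_ge_zero[of "f y"] c], of "\<bar>pk t x y\<bar>"]
      by (simp add: algebra_simps)
    have "p * ?c powr (p - 1) * ?c = (\<integral>y. p * ?c powr (p - 1) * (\<bar>pk t x y\<bar> * norm (f y)) \<partial>\<mu>)"
      using int1 by simp
    also have "\<dots> \<le> (\<integral>y. \<bar>pk t x y\<bar> * norm (f y) powr p + (p - 1) * ?c powr p * \<bar>pk t x y\<bar> \<partial>\<mu>)"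
      by (rule integral_mono) (use pt int1 int2 int3 in auto)
    also have "\<dots> = ?I + (p - 1) * ?c powr p * (\<integral>y. \<bar>pk t x y\<bar> \<partial>\<mu>)"
      using int2 int3 by simp
    also have "\<dots> \<le> ?I + (p - 1) * ?c powr p * 1"
      using integral_abs_pk_le[OF t x] p by (intro add_left_mono mult_left_mono) auto
    finally have "p * (?c powr (p - 1) * ?c) \<le> ?I + (p - 1) * ?c powr p" by simp
    moreover have "?c powr (p - 1) * ?c = ?c powr p"
      using c powr_add[of ?c "p - 1" 1] by simp
    ultimately show ?thesis by (simp add: algebra_simps)
  qed
  moreover have "norm (PI f t x) powr p \<le> ?c powr p"
    using norm_PI_le[OF f t x] p by (intro powr_mono2) auto
  ultimately show ?thesis by linarith
qed

lemma PI_measurable: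
  assumes "f \<in> borel_measurable \<mu>"
  shows "PI f t \<in> borel_measurable \<mu>"
proof -
  have [measurable]: "(\<lambda>(x, y). pk t x y) \<in> borel_measurable (\<mu> \<Otimes>\<^sub>M \<mu>)" "f \<in> borel_measurable \<mu>"
    by (rule pk_measurable_pair; rule sets_\<mu>) (rule assms)
  show ?thesis unfolding poisson_integral_def by measurable
qed

lemma nn_integral_abs_pk_le:
  assumes "t > 0" "y \<in> K"
  shows "(\<integral>\<^sup>+x. ennreal \<bar>pk t x y\<bar> \<partial>\<mu>) \<le> 1"
proof -
  have "(\<integral>\<^sup>+x. ennreal \<bar>pk t x y\<bar> \<partial>\<mu>) = (\<integral>\<^sup>+x. ennreal \<bar>pk t y x\<bar> \<partial>\<mu>)"
    by (simp add: pk_commute)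
  also have "\<dots> = ennreal (\<integral>x. \<bar>pk t y x\<bar> \<partial>\<mu>)"
    using integrable_pk[OF assms] by (intro nn_integral_eq_integral) auto
  also have "\<dots> \<le> 1"
    using integral_abs_pk_le[OF assms] by (simp add: ennreal_le_1)
  finally show ?thesis .
qed

text \<open>A Schur bound: Tonelli exchanges the integrals, and symmetry of the kernel gives mass at
  most 1 in the other variable. With \<open>N = \<mu>\<close> it serves functions, with other
  \<open>N\<close> measures.\<close>

lemma nn_integral_kernel_le:
  assumes N: "sets N = sets (restrict_space borel K)" "finite_measure N" and t: "t > 0"
    and h [measurable]: "h \<in> borel_measurable N"
  shows "(\<integral>\<^sup>+x. \<integral>\<^sup>+y. ennreal \<bar>pk t x y\<bar> * h y \<partial>N \<partial>\<mu>) \<le> (\<integral>\<^sup>+y. h y \<partial>N)"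
proof -
  interpret N: finite_measure N by fact
  interpret pair_sigma_finite \<mu> N ..
  have [measurable]: "(\<lambda>(x, y). pk t x y) \<in> borel_measurable (\<mu> \<Otimes>\<^sub>M N)"
    by (rule pk_measurable_pair[OF sets_\<mu> N(1)])
  have sp: "space N = K" using sets_eq_imp_space_eq[OF N(1)] by (simp add: space_restrict_space)
  have "(\<integral>\<^sup>+x. \<integral>\<^sup>+y. ennreal \<bar>pk t x y\<bar> * h y \<partial>N \<partial>\<mu>) = (\<integral>\<^sup>+y. \<integral>\<^sup>+x. ennreal \<bar>pk t x y\<bar> * h y \<partial>\<mu> \<partial>N)"
    by (rule Fubini'[symmetric]) measurable
  also have "\<dots> = (\<integral>\<^sup>+y. (\<integral>\<^sup>+x. ennreal \<bar>pk t x y\<bar> \<partial>\<mu>) * h y \<partial>N)"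
  proof (rule nn_integral_cong, rule nn_integral_multc)
    fix y assume "y \<in> space N"
    have "(\<lambda>x. pk t x y) = pk t y" by (rule ext) (rule pk_commute)
    then have "(\<lambda>x. pk t x y) \<in> borel_measurable \<mu>"
      using pk_measurable[OF sets_\<mu>, of t y] by simp
    then show "(\<lambda>x. ennreal \<bar>pk t x y\<bar>) \<in> borel_measurable \<mu>" by measurable
  qed
  also have "\<dots> \<le> (\<integral>\<^sup>+y. 1 * h y \<partial>N)"
    by (intro nn_integral_mono mult_right_mono nn_integral_abs_pk_le t) (auto simp: sp)
  finally show ?thesis by simp
qed

text \<open>The Jensen estimate at each point is integrated by means of the Schur bound.\<close>

lemma PI_contraction:
  assumes f: "integrable \<mu> f" and t: "t > 0" and p: "1 \<le> p"
  shows "(\<integral>\<^sup>+x. ennreal (norm (PI f t x) powr p) \<partial>\<mu>) \<le> (\<integral>\<^sup>+x. ennreal (norm (f x) powr p) \<partial>\<mu>)"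
proof (cases "(\<integral>\<^sup>+x. ennreal (norm (f x) powr p) \<partial>\<mu>) = \<infinity>")
  case False
  have [measurable]: "f \<in> borel_measurable \<mu>" using f by simp
  have fp: "integrable \<mu> (\<lambda>y. norm (f y) powr p)"
    by (rule integrableI_nonneg) (use False in \<open>auto simp: less_top\<close>)
  have "(\<integral>\<^sup>+x. ennreal (norm (PI f t x) powr p) \<partial>\<mu>) \<le>
      (\<integral>\<^sup>+x. \<integral>\<^sup>+y. ennreal \<bar>pk t x y\<bar> * ennreal (norm (f y) powr p) \<partial>\<mu> \<partial>\<mu>)"
  proof (rule nn_integral_mono)
    fix x assume "x \<in> space \<mu>"
    then have x: "x \<in> K" by (simp add: space_\<mu>)
    have "ennreal (norm (PI f t x) powr p) \<le> ennreal (\<integral>y. \<bar>pk t x y\<bar> * norm (f y) powr p \<partial>\<mu>)"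
      by (intro ennreal_leI norm_PI_powr_le f t x p fp)
    also have "\<dots> = (\<integral>\<^sup>+y. ennreal (\<bar>pk t x y\<bar> * norm (f y) powr p) \<partial>\<mu>)"
      using integrable_abs_pk_mult[OF fp t x] by (intro nn_integral_eq_integral[symmetric]) auto
    finally show "ennreal (norm (PI f t x) powr p) \<le> (\<integral>\<^sup>+y. ennreal \<bar>pk t x y\<bar> * ennreal (norm (f y) powr p) \<partial>\<mu>)"
      by (simp add: ennreal_mult)
  qed
  also have "\<dots> \<le> (\<integral>\<^sup>+y. ennreal (norm (f y) powr p) \<partial>\<mu>)"
    by (rule nn_integral_kernel_le[OF sets_\<mu> finite_measure_axioms t]) measurable
  finally show ?thesis .
qed simp

lemma integrable_PI:
  fixes f :: "'k \<Rightarrow> 'c::{banach, second_countable_topology}"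
  assumes "integrable \<mu> f" "t > 0"
  shows "integrable \<mu> (PI f t)"
proof (rule bounded_integrable[where B = "\<integral>y. pk_bound t * norm (f y) \<partial>\<mu>"])
  show "PI f t \<in> borel_measurable \<mu>" using assms by (intro PI_measurable) auto
  fix x assume x: "x \<in> K"
  have "norm (PI f t x) \<le> (\<integral>y. \<bar>pk t x y\<bar> * norm (f y) \<partial>\<mu>)" by (rule norm_PI_le[OF assms x])
  also have "\<dots> \<le> (\<integral>y. pk_bound t * norm (f y) \<partial>\<mu>)"
    using integrable_abs_pk_mult[OF integrable_norm[OF assms(1)] assms(2) x] assms(1) pk_le[OF assms(2) x]
    by (intro integral_mono) (auto simp: space_\<mu> intro!: mult_right_mono)
  finally show "norm (PI f t x) \<le> (\<integral>y. pk_bound t * norm (f y) \<partial>\<mu>)" .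
qed

lemma PI_L1_le:
  fixes f :: "'k \<Rightarrow> real"
  assumes "integrable \<mu> f" "t > 0"
  shows "(\<integral>x. \<bar>PI f t x\<bar> \<partial>\<mu>) \<le> (\<integral>x. \<bar>f x\<bar> \<partial>\<mu>)"
proof -
  have "ennreal (\<integral>x. \<bar>PI f t x\<bar> \<partial>\<mu>) = (\<integral>\<^sup>+x. ennreal \<bar>PI f t x\<bar> \<partial>\<mu>)"
    using integrable_PI[OF assms] by (intro nn_integral_eq_integral[symmetric]) auto
  also have "\<dots> \<le> (\<integral>\<^sup>+x. ennreal \<bar>f x\<bar> \<partial>\<mu>)"
    using PI_contraction[OF assms, of 1] by simp
  also have "\<dots> = ennreal (\<integral>x. \<bar>f x\<bar> \<partial>\<mu>)"
    using assms by (intro nn_integral_eq_integral) auto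
  finally show ?thesis by (simp add: ennreal_le_iff)
qed

text \<open>Truncation makes \<open>f\<close> bounded, so that completeness applies; on a
  probability space the quadratic error dominates the error in the mean.\<close>

lemma L1_dense:
  fixes f :: "'k \<Rightarrow> real"
  assumes f: "integrable \<mu> f" and \<epsilon>: "\<epsilon> > 0"
  obtains N c where "(\<integral>x. \<bar>f x - (\<Sum>n<N. c n * \<phi> n x)\<bar> \<partial>\<mu>) < \<epsilon>"
proof -
  have [measurable]: "f \<in> borel_measurable \<mu>" using f by simp
  define g where "g k x = max (- real k) (min (real k) (f x))" for k x
  have g_meas [measurable]: "g k \<in> borel_measurable \<mu>" for k unfolding g_def by measurable
  have g_bd: "\<bar>g k x\<bar> \<le> real k" for k x by (auto simp: g_def)
  have "(\<lambda>k. \<integral>x. \<bar>f x - g k x\<bar> \<partial>\<mu>) \<longlonglongrightarrow> (\<integral>x. 0 \<partial>\<mu>)"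
  proof (rule integral_dominated_convergence[where w = "\<lambda>x. \<bar>f x\<bar>"])
    show "integrable \<mu> (\<lambda>x. \<bar>f x\<bar>)" using f by simp
    show "AE x in \<mu>. (\<lambda>k. \<bar>f x - g k x\<bar>) \<longlonglongrightarrow> 0"
    proof (rule AE_I2)
      fix x
      obtain k0 :: nat where k0: "\<bar>f x\<bar> \<le> real k0" using real_arch_simple by blast
      have "\<forall>\<^sub>F k in sequentially. \<bar>f x - g k x\<bar> = 0"
        using eventually_ge_at_top[of k0] by eventually_elim (use k0 in \<open>auto simp: g_def\<close>)
      then show "(\<lambda>k. \<bar>f x - g k x\<bar>) \<longlonglongrightarrow> 0" by (rule tendsto_eventually)
    qed
    show "AE x in \<mu>. norm \<bar>f x - g k x\<bar> \<le> \<bar>f x\<bar>" for k by (rule AE_I2) (auto simp: g_def)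
  qed measurable
  then have "\<forall>\<^sub>F k in sequentially. (\<integral>x. \<bar>f x - g k x\<bar> \<partial>\<mu>) < \<epsilon> / 2"
    using order_tendstoD(2)[of _ 0 sequentially "\<epsilon> / 2"] \<epsilon> by simp
  then obtain k where k: "(\<integral>x. \<bar>f x - g k x\<bar> \<partial>\<mu>) < \<epsilon> / 2"
    using eventually_happens'[OF sequentially_bot] by blast
  let ?s = "\<lambda>N x. \<Sum>n<N. coeff (g k) n * \<phi> n x"
  have "(\<lambda>N. sqrt (\<integral>x. (g k x - ?s N x)\<^sup>2 \<partial>\<mu>)) \<longlonglongrightarrow> sqrt 0"
    by (intro tendsto_real_sqrt L2_complete[OF g_meas g_bd])
  then have "\<forall>\<^sub>F N in sequentially. sqrt (\<integral>x. (g k x - ?s N x)\<^sup>2 \<partial>\<mu>) < \<epsilon> / 2"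
    using order_tendstoD(2)[of _ 0 sequentially "\<epsilon> / 2"] \<epsilon> by simp
  then obtain N where N: "sqrt (\<integral>x. (g k x - ?s N x)\<^sup>2 \<partial>\<mu>) < \<epsilon> / 2"
    using eventually_happens'[OF sequentially_bot] by blast
  obtain B where B: "\<And>x. x \<in> K \<Longrightarrow> norm (?s N x) \<le> B"
    using continuous_bounded[OF eigensum_cont] by blast
  have s_meas: "(\<lambda>x. g k x - ?s N x) \<in> borel_measurable \<mu>"
    by (intro borel_measurable_diff g_meas continuous_measurable eigensum_cont)
  have s_bd: "\<bar>g k x - ?s N x\<bar> \<le> real k + B" if "x \<in> K" for x
    using g_bd[of k x] B[OF that] unfolding real_norm_def by linarith
  have "(\<integral>x. \<bar>g k x - ?s N x\<bar> \<partial>\<mu>) \<le> sqrt (\<integral>x. (g k x - ?s N x)\<^sup>2 \<partial>\<mu>)"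
    by (rule integral_abs_le_L2[OF s_meas s_bd])
  then have gs: "(\<integral>x. \<bar>g k x - ?s N x\<bar> \<partial>\<mu>) < \<epsilon> / 2" using N by simp
  have g_int: "integrable \<mu> (g k)" by (rule bounded_integrable[OF g_meas, where B = "real k"]) (use g_bd in auto)
  have s_int: "integrable \<mu> (?s N)" by (intro continuous_integrable eigensum_cont)
  have "(\<integral>x. \<bar>f x - ?s N x\<bar> \<partial>\<mu>) \<le> (\<integral>x. \<bar>f x - g k x\<bar> + \<bar>g k x - ?s N x\<bar> \<partial>\<mu>)"
    by (rule integral_mono) (use f g_int s_int in auto)
  also have "\<dots> = (\<integral>x. \<bar>f x - g k x\<bar> \<partial>\<mu>) + (\<integral>x. \<bar>g k x - ?s N x\<bar> \<partial>\<mu>)"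
    using f g_int s_int by simp
  finally show thesis using that[of "coeff (g k)" N] k gs by simp
qed

lemma PI_eigensum:
  assumes "t > 0" "x \<in> K"
  shows "PI (\<lambda>y. \<Sum>n<N. c n * \<phi> n y) t x = (\<Sum>n<N. c n * decay t n * \<phi> n x)"
proof -
  have "(\<lambda>n. decay t n * \<phi> n x * coeff (\<lambda>y. \<Sum>n<N. c n * \<phi> n y) n) sums PI (\<lambda>y. \<Sum>n<N. c n * \<phi> n y) t x"
    unfolding coeff_def PI_real
    by (rule pk_integral_sums[OF sets_\<mu> assms continuous_integrable[OF eigensum_cont]])
  moreover have "(\<lambda>n. decay t n * \<phi> n x * coeff (\<lambda>y. \<Sum>n<N. c n * \<phi> n y) n) sums
      (\<Sum>n<N. decay t n * \<phi> n x * coeff (\<lambda>y. \<Sum>n<N. c n * \<phi> n y) n)"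
    by (rule sums_finite) (auto simp: coeff_eigensum)
  ultimately show ?thesis
    using sums_unique2 by (fastforce simp: coeff_eigensum mult_ac)
qed

text \<open>\<open>f\<close> is replaced by a finite eigenfunction sum \<open>s\<close>, on which
  the Poisson integral is explicit. The error \<open>f - s\<close> enters twice, once as it is and
  once under the contraction.\<close>

lemma PI_tendsto_L1_real:
  fixes f :: "'k \<Rightarrow> real"
  assumes f: "integrable \<mu> f"
  shows "(\<lambda>j. \<integral>x. \<bar>PI f (inverse (real (Suc j))) x - f x\<bar> \<partial>\<mu>) \<longlonglongrightarrow> 0"
proof (rule LIMSEQ_I)
  fix \<epsilon> :: real assume \<epsilon>: "\<epsilon> > 0"
  then have "\<epsilon> / 4 > 0" by simp
  from L1_dense[OF f this] obtain N c where Nc: "(\<integral>x. \<bar>f x - (\<Sum>n<N. c n * \<phi> n x)\<bar> \<partial>\<mu>) < \<epsilon> / 4"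
    by blast
  define s where "s = (\<lambda>x. \<Sum>n<N. c n * \<phi> n x)"
  \<comment> \<open>A uniform bound for the change of \<open>s\<close> under the Poisson integral at
    time \<open>t\<close>. Together with the two errors of \<open>f - s\<close> it uses three of the
    four quarters of \<epsilon>.\<close>
  define \<eta> where "\<eta> t = (\<Sum>n<N. \<bar>c n\<bar> * \<bar>decay t n - 1\<bar> * sqrt (sup_const * lam n))" for t
  let ?t = "\<lambda>j. inverse (real (Suc j))"
  have s_int: "integrable \<mu> s" unfolding s_def by (intro continuous_integrable eigensum_cont)
  have "(\<lambda>j. \<eta> (?t j)) \<longlonglongrightarrow> (\<Sum>n<N. \<bar>c n\<bar> * \<bar>exp (- sqrt (lam n) * 0) - 1\<bar> * sqrt (sup_const * lam n))"
    unfolding \<eta>_def decay_def by (intro tendsto_intros LIMSEQ_inverse_real_of_nat)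
  then have "\<forall>\<^sub>F j in sequentially. \<eta> (?t j) < \<epsilon> / 4"
    using order_tendstoD(2)[of _ 0 sequentially "\<epsilon> / 4"] \<epsilon> by simp
  then obtain J where J: "\<And>j. j \<ge> J \<Longrightarrow> \<eta> (?t j) < \<epsilon> / 4"
    unfolding eventually_sequentially by blast
  have "(\<integral>x. \<bar>PI f (?t j) x - f x\<bar> \<partial>\<mu>) < \<epsilon>" if "j \<ge> J" for j
  proof -
    let ?u = "?t j"
    have t: "?u > 0" by simp
    have fs_int: "integrable \<mu> (\<lambda>x. f x - s x)" using f s_int by simp
    have s_close: "\<bar>PI s ?u x - s x\<bar> \<le> \<eta> ?u" if "x \<in> K" for x
    proof -
      have "PI s ?u x - s x = (\<Sum>n<N. c n * (decay ?u n - 1) * \<phi> n x)"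
        unfolding s_def PI_eigensum[OF t that] by (simp add: sum_subtractf[symmetric] algebra_simps)
      also have "\<bar>\<dots>\<bar> \<le> (\<Sum>n<N. \<bar>c n * (decay ?u n - 1) * \<phi> n x\<bar>)" by (rule sum_abs)
      also have "\<dots> \<le> \<eta> ?u"
        unfolding \<eta>_def abs_mult by (intro sum_mono mult_left_mono \<phi>_le that) simp
      finally show ?thesis .
    qed
    have split: "PI f ?u x = PI (\<lambda>x. f x - s x) ?u x + PI s ?u x" if "x \<in> K" for x
      using pk_integrable[OF sets_\<mu> t that f] pk_integrable[OF sets_\<mu> t that s_int]
      by (simp add: PI_real right_diff_distrib)
    have "(\<integral>x. \<bar>PI f ?u x - f x\<bar> \<partial>\<mu>) \<le>
        (\<integral>x. (\<bar>PI (\<lambda>x. f x - s x) ?u x\<bar> + \<eta> ?u) + \<bar>f x - s x\<bar> \<partial>\<mu>)"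
    proof (rule integral_mono)
      show "integrable \<mu> (\<lambda>x. \<bar>PI f ?u x - f x\<bar>)" using integrable_PI[OF f t] f by simp
      show "integrable \<mu> (\<lambda>x. (\<bar>PI (\<lambda>x. f x - s x) ?u x\<bar> + \<eta> ?u) + \<bar>f x - s x\<bar>)"
        using integrable_PI[OF fs_int t] fs_int by simp
      fix x assume "x \<in> space \<mu>"
      then have "x \<in> K" by (simp add: space_\<mu>)
      from s_close[OF this] split[OF this]
      show "\<bar>PI f ?u x - f x\<bar> \<le> (\<bar>PI (\<lambda>x. f x - s x) ?u x\<bar> + \<eta> ?u) + \<bar>f x - s x\<bar>" by linarith
    qed
    also have "\<dots> = (\<integral>x. \<bar>PI (\<lambda>x. f x - s x) ?u x\<bar> \<partial>\<mu>) + \<eta> ?u + (\<integral>x. \<bar>f x - s x\<bar> \<partial>\<mu>)"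
      using integrable_PI[OF fs_int t] fs_int by (simp add: prob_space)
    also have "\<dots> < \<epsilon>"
      using PI_L1_le[OF fs_int t] Nc J[OF that] \<epsilon> unfolding s_def by linarith
    finally show ?thesis .
  qed
  moreover have "0 \<le> (\<integral>x. \<bar>PI f (?t j) x - f x\<bar> \<partial>\<mu>)" for j by (rule integral_nonneg_AE) simp
  ultimately show "\<exists>J. \<forall>j\<ge>J. norm ((\<integral>x. \<bar>PI f (?t j) x - f x\<bar> \<partial>\<mu>) - 0) < \<epsilon>"
    by (intro exI[of _ J]) simp
qed

lemma PI_inner:
  fixes f :: "'k \<Rightarrow> 'c::euclidean_space"
  assumes "integrable \<mu> f" "t > 0" "x \<in> K"
  shows "PI f t x \<bullet> b = PI (\<lambda>y. f y \<bullet> b) t x"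
  using integral_inner_left[of b \<mu> "\<lambda>y. pk t x y *\<^sub>R f y"] pk_integrable[OF sets_\<mu> assms(2,3,1)]
  by (simp add: poisson_integral_def)

text \<open>Coordinatewise convergence in the mean, weakened to almost everywhere convergence along
  a subsequence, as Fatou's lemma requires.\<close>

lemma PI_AE_subseq:
  fixes f :: "'k \<Rightarrow> 'c::euclidean_space"
  assumes f: "integrable \<mu> f"
  obtains k :: "nat \<Rightarrow> nat" where "strict_mono k"
    "AE x in \<mu>. (\<lambda>j. PI f (inverse (real (Suc (k j)))) x) \<longlonglongrightarrow> f x"
proof -
  let ?t = "\<lambda>j. inverse (real (Suc j))"
  have t: "?t j > 0" for j by simp
  have int: "integrable \<mu> (\<lambda>x. PI f (?t j) x - f x)" for j using integrable_PI[OF f t] f by simp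
  have fb: "integrable \<mu> (\<lambda>x. f x \<bullet> b)" for b using f by simp
  have "(\<lambda>j. \<integral>x. norm (PI f (?t j) x - f x) \<partial>\<mu>) \<longlonglongrightarrow> 0"
  proof (rule tendsto_sandwich[OF _ _ tendsto_const])
    show "(\<lambda>j. \<Sum>b\<in>Basis. \<integral>x. \<bar>PI (\<lambda>y. f y \<bullet> b) (?t j) x - f x \<bullet> b\<bar> \<partial>\<mu>) \<longlonglongrightarrow> 0"
      by (rule tendsto_null_sum) (rule PI_tendsto_L1_real[OF fb])
    show "\<forall>\<^sub>F j in sequentially. 0 \<le> (\<integral>x. norm (PI f (?t j) x - f x) \<partial>\<mu>)"
      by (intro always_eventually allI integral_nonneg_AE) simp
    have "(\<integral>x. norm (PI f (?t j) x - f x) \<partial>\<mu>) \<le>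
        (\<Sum>b\<in>Basis. \<integral>x. \<bar>PI (\<lambda>y. f y \<bullet> b) (?t j) x - f x \<bullet> b\<bar> \<partial>\<mu>)" for j
    proof -
      have intb: "integrable \<mu> (\<lambda>x. \<bar>PI (\<lambda>y. f y \<bullet> b) (?t j) x - f x \<bullet> b\<bar>)" for b
        using integrable_PI[OF fb t] fb by simp
      have "(\<integral>x. norm (PI f (?t j) x - f x) \<partial>\<mu>) \<le>
          (\<integral>x. (\<Sum>b\<in>Basis. \<bar>PI (\<lambda>y. f y \<bullet> b) (?t j) x - f x \<bullet> b\<bar>) \<partial>\<mu>)"
      proof (rule integral_mono)
        show "integrable \<mu> (\<lambda>x. norm (PI f (?t j) x - f x))" using int by simp
        show "integrable \<mu> (\<lambda>x. (\<Sum>b\<in>Basis. \<bar>PI (\<lambda>y. f y \<bullet> b) (?t j) x - f x \<bullet> b\<bar>))"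
          by (intro Bochner_Integration.integrable_sum intb)
        fix x assume "x \<in> space \<mu>"
        then have "x \<in> K" by (simp add: space_\<mu>)
        then show "norm (PI f (?t j) x - f x) \<le> (\<Sum>b\<in>Basis. \<bar>PI (\<lambda>y. f y \<bullet> b) (?t j) x - f x \<bullet> b\<bar>)"
          using norm_le_l1[of "PI f (?t j) x - f x"] PI_inner[OF f t, of x j] by (simp add: inner_diff_left)
      qed
      also have "\<dots> = (\<Sum>b\<in>Basis. \<integral>x. \<bar>PI (\<lambda>y. f y \<bullet> b) (?t j) x - f x \<bullet> b\<bar> \<partial>\<mu>)"
        by (rule Bochner_Integration.integral_sum[OF intb])
      finally show ?thesis .
    qed
    then show "\<forall>\<^sub>F j in sequentially. (\<integral>x. norm (PI f (?t j) x - f x) \<partial>\<mu>) \<le>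
        (\<Sum>b\<in>Basis. \<integral>x. \<bar>PI (\<lambda>y. f y \<bullet> b) (?t j) x - f x \<bullet> b\<bar> \<partial>\<mu>)"
      by (intro always_eventually allI)
  qed
  from tendsto_L1_AE_subseq[OF int this] obtain k :: "nat \<Rightarrow> nat" where k: "strict_mono k"
    "AE x in \<mu>. (\<lambda>j. PI f (?t (k j)) x - f x) \<longlonglongrightarrow> 0" by blast
  from k(2) have "AE x in \<mu>. (\<lambda>j. PI f (?t (k j)) x) \<longlonglongrightarrow> f x"
    by eventually_elim (simp add: LIM_zero_iff)
  with k(1) show thesis by (rule that)
qed

end

section \<open>Weak limits of measures\<close>

text \<open>Infinite words over a finite alphabet are coded by the real numbers whose digits are the letters,
  in a base exceeding the number of letters by one, so that the code is injective with continuous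
  inverse.\<close>

lemma word_coding:
  fixes S :: "'i set"
  assumes fin: "finite S"
  obtains q \<delta> :: real and e :: "(nat \<Rightarrow> 'i) \<Rightarrow> real"
  where "0 < q" "q < 1" "0 < \<delta>"
    "\<And>n \<omega> \<omega>'. \<omega> \<in> UNIV \<rightarrow> S \<Longrightarrow> \<omega>' \<in> UNIV \<rightarrow> S \<Longrightarrow> \<forall>k<n. \<omega>' k = \<omega> k \<Longrightarrow> \<bar>e \<omega>' - e \<omega>\<bar> \<le> q ^ n"
    "\<And>n \<omega> \<omega>' k. \<omega> \<in> UNIV \<rightarrow> S \<Longrightarrow> \<omega>' \<in> UNIV \<rightarrow> S \<Longrightarrow> \<bar>e \<omega>' - e \<omega>\<bar> < \<delta> * q ^ n \<Longrightarrow> k < n \<Longrightarrow> \<omega>' k = \<omega> k"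
proof -
  obtain g :: "'i \<Rightarrow> nat" and m where g: "g ` S = {i. i < m}" "inj_on g S"
    using finite_imp_inj_to_nat_seg[OF fin] by blast
  \<comment> \<open>Digits are at most \<open>k - 1\<close> and the base is \<open>k + 1\<close>, so
    a tail is at most \<open>(k - 1) / k\<close>. A difference of 1 in the first digit cannot be
    fully compensated: codes of words with different first letters stay at least
    \<open>q / k\<close> apart, hence the separation constant \<open>1 / k\<close>.\<close>
  define k where "k = real (Suc m)"
  have k: "k \<ge> 1" by (simp add: k_def)
  define q where "q = 1 / (k + 1)"
  have q: "0 < q" "q < 1" using k by (auto simp: q_def)
  have g_le: "real (g i) \<le> k - 1" if "i \<in> S" for i
  proof -
    have "g i < m" using that g(1) by blast
    then show ?thesis by (simp add: k_def)
  qed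
  define e where "e \<omega> = (\<Sum>n. real (g (\<omega> n)) * q ^ Suc n)" for \<omega>
  have geo: "(\<lambda>n. (k - 1) * q ^ Suc n) sums ((k - 1) / k)"
  proof -
    have "(\<lambda>n. (k - 1) * q * q ^ n) sums ((k - 1) * q * (1 / (1 - q)))"
      by (rule sums_mult[OF geometric_sums]) (use q in simp)
    moreover have "1 - q = k * q" using k by (simp add: q_def field_simps)
    then have "(k - 1) * q * (1 / (1 - q)) = (k - 1) / k" using q by simp
    ultimately show ?thesis by (simp add: mult.assoc)
  qed
  have term_le: "real (g (\<omega> n)) * q ^ Suc n \<le> (k - 1) * q ^ Suc n" if "\<omega> \<in> UNIV \<rightarrow> S" for \<omega> n
    by (rule mult_right_mono[OF g_le]) (use that q in auto)
  have summ: "summable (\<lambda>n. real (g (\<omega> n)) * q ^ Suc n)" if "\<omega> \<in> UNIV \<rightarrow> S" for \<omega>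
    by (rule summable_comparison_test'[OF sums_summable[OF geo], of 0])
      (use term_le[OF that] q in simp)
  have e_nonneg: "0 \<le> e \<omega>" if "\<omega> \<in> UNIV \<rightarrow> S" for \<omega>
    unfolding e_def by (rule suminf_nonneg[OF summ[OF that]]) (use q in simp)
  have e_le: "e \<omega> \<le> (k - 1) / k" if "\<omega> \<in> UNIV \<rightarrow> S" for \<omega>
    unfolding e_def sums_unique[OF geo] by (rule suminf_le[OF term_le[OF that] summ[OF that] sums_summable[OF geo]])
  have e_shift: "e \<omega> = q * (real (g (\<omega> 0)) + e (\<lambda>n. \<omega> (Suc n)))" if "\<omega> \<in> UNIV \<rightarrow> S" for \<omega>
  proof -
    have s: "(\<lambda>n. \<omega> (Suc n)) \<in> UNIV \<rightarrow> S" using that by auto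
    have "e \<omega> = real (g (\<omega> 0)) * q + (\<Sum>n. real (g (\<omega> (Suc n))) * q ^ Suc (Suc n))"
      using suminf_split_head[OF summ[OF that]] unfolding e_def by simp
    also have "(\<Sum>n. real (g (\<omega> (Suc n))) * q ^ Suc (Suc n)) = q * e (\<lambda>n. \<omega> (Suc n))"
      unfolding e_def by (subst suminf_mult[OF summ[OF s], symmetric]) (simp add: mult_ac)
    finally show ?thesis by (simp add: algebra_simps)
  qed
  have e_le1: "e \<omega> \<le> 1" if "\<omega> \<in> UNIV \<rightarrow> S" for \<omega>
  proof -
    have "(k - 1) / k \<le> 1" using k by simp
    then show ?thesis using e_le[OF that] by linarith
  qed
  have close: "\<bar>e \<omega>' - e \<omega>\<bar> \<le> q ^ n"
    if "\<omega> \<in> UNIV \<rightarrow> S" "\<omega>' \<in> UNIV \<rightarrow> S" "\<forall>k<n. \<omega>' k = \<omega> k" for n \<omega> \<omega>'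
    using that
  proof (induction n arbitrary: \<omega> \<omega>')
    case 0
    then show ?case using e_nonneg[of \<omega>] e_nonneg[of \<omega>'] e_le1[of \<omega>] e_le1[of \<omega>'] by simp
  next
    case (Suc n)
    have s: "(\<lambda>n. \<omega> (Suc n)) \<in> UNIV \<rightarrow> S" "(\<lambda>n. \<omega>' (Suc n)) \<in> UNIV \<rightarrow> S" using Suc.prems by auto
    have "\<bar>e (\<lambda>n. \<omega>' (Suc n)) - e (\<lambda>n. \<omega> (Suc n))\<bar> \<le> q ^ n"
      by (rule Suc.IH[OF s]) (use Suc.prems(3) in auto)
    moreover have "e \<omega>' - e \<omega> = q * (e (\<lambda>n. \<omega>' (Suc n)) - e (\<lambda>n. \<omega> (Suc n)))"
      using Suc.prems(3) unfolding e_shift[OF Suc.prems(1)] e_shift[OF Suc.prems(2)]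
      by (simp add: algebra_simps)
    ultimately show ?case using q by (simp add: abs_mult)
  qed
  have sep: "\<omega>' j = \<omega> j"
    if "\<omega> \<in> UNIV \<rightarrow> S" "\<omega>' \<in> UNIV \<rightarrow> S" "\<bar>e \<omega>' - e \<omega>\<bar> < 1 / k * q ^ n" "j < n" for n \<omega> \<omega>' j
    using that
  proof (induction n arbitrary: \<omega> \<omega>' j)
    case (Suc n)
    let ?s = "e (\<lambda>n. \<omega> (Suc n))" and ?s' = "e (\<lambda>n. \<omega>' (Suc n))"
    have s: "(\<lambda>n. \<omega> (Suc n)) \<in> UNIV \<rightarrow> S" "(\<lambda>n. \<omega>' (Suc n)) \<in> UNIV \<rightarrow> S" using Suc.prems by auto
    have d: "e \<omega>' - e \<omega> = q * ((real (g (\<omega>' 0)) - real (g (\<omega> 0))) + (?s' - ?s))"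
      unfolding e_shift[OF Suc.prems(1)] e_shift[OF Suc.prems(2)] by (simp add: algebra_simps)
    have "q * \<bar>(real (g (\<omega>' 0)) - real (g (\<omega> 0))) + (?s' - ?s)\<bar> < q * (1 / k * q ^ n)"
      using Suc.prems(3) q unfolding d by (simp add: abs_mult mult_ac)
    then have lt: "\<bar>(real (g (\<omega>' 0)) - real (g (\<omega> 0))) + (?s' - ?s)\<bar> < 1 / k * q ^ n"
      by (rule mult_less_cancel_left_pos[OF q(1), THEN iffD1])
    have "g (\<omega>' 0) = g (\<omega> 0)"
    proof (rule ccontr)
      assume "g (\<omega>' 0) \<noteq> g (\<omega> 0)"
      then have "1 \<le> \<bar>real (g (\<omega>' 0)) - real (g (\<omega> 0))\<bar>" by linarith
      moreover have "\<bar>?s' - ?s\<bar> \<le> (k - 1) / k"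
        using e_nonneg[OF s(1)] e_nonneg[OF s(2)] e_le[OF s(1)] e_le[OF s(2)] by linarith
      moreover have "(k - 1) / k = 1 - 1 / k" using k by (simp add: field_simps)
      moreover have "1 / k * q ^ n \<le> 1 / k"
        using k q by (simp add: divide_right_mono power_le_one)
      ultimately show False using lt by linarith
    qed
    then have 0: "\<omega>' 0 = \<omega> 0" using g(2) Suc.prems(1,2) by (auto simp: inj_on_def)
    have "\<bar>?s' - ?s\<bar> < 1 / k * q ^ n" using lt 0 by simp
    then have "\<omega>' (Suc j') = \<omega> (Suc j')" if "j' < n" for j'
      using Suc.IH[OF s, of j'] that by simp
    then show ?case using 0 Suc.prems(4) by (cases j) auto
  qed simp
  show thesis
  proof (rule that[of q "1 / k" e])
    show "0 < 1 / k" using k by simp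
  qed (use q close sep in blast)+
qed

context fractal_structure
begin

text \<open>Since \<theta> is continuous on the compact set \<open>C\<close> of codes and recovers
  \<open>\<pi> \<omega>\<close> from the code of \<omega>, measures on \<open>K\<close> can be
  obtained as images of measures on the real line.\<close>

lemma coding:
  obtains C :: "real set" and e :: "(nat \<Rightarrow> 'i) \<Rightarrow> real" and \<theta> :: "real \<Rightarrow> 'k"
  where "compact C" "e \<in> borel_measurable P" "continuous_on C \<theta>" "\<theta> \<in> measurable borel (restrict_space borel K)"
    "\<And>\<omega>. \<omega> \<in> UNIV \<rightarrow> S \<Longrightarrow> e \<omega> \<in> C \<and> \<theta> (e \<omega>) = \<pi> \<omega>"
proof -
  obtain q \<delta> and e :: "(nat \<Rightarrow> 'i) \<Rightarrow> real" where q: "0 < q" "q < 1" "0 < \<delta>"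
    and close: "\<And>n \<omega> \<omega>'. \<omega> \<in> UNIV \<rightarrow> S \<Longrightarrow> \<omega>' \<in> UNIV \<rightarrow> S \<Longrightarrow> \<forall>k<n. \<omega>' k = \<omega> k \<Longrightarrow> \<bar>e \<omega>' - e \<omega>\<bar> \<le> q ^ n"
    and sep: "\<And>n \<omega> \<omega>' k. \<omega> \<in> UNIV \<rightarrow> S \<Longrightarrow> \<omega>' \<in> UNIV \<rightarrow> S \<Longrightarrow> \<bar>e \<omega>' - e \<omega>\<bar> < \<delta> * q ^ n \<Longrightarrow> k < n \<Longrightarrow> \<omega>' k = \<omega> k"
    using word_coding[OF finite_S] by blast
  have cyl: "\<exists>n. \<forall>\<omega>'\<in>UNIV \<rightarrow> S. (\<forall>k<n. \<omega>' k = \<omega> k) \<longrightarrow> e \<omega>' \<in> G"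
    if \<omega>: "\<omega> \<in> UNIV \<rightarrow> S" and G: "open G" "e \<omega> \<in> G" for \<omega> G
  proof -
    obtain \<epsilon> where \<epsilon>: "\<epsilon> > 0" "\<And>y. dist y (e \<omega>) < \<epsilon> \<Longrightarrow> y \<in> G"
      using G by (auto simp: open_dist)
    obtain n where n: "q ^ n < \<epsilon>" using real_arch_pow_inv[OF \<epsilon>(1) q(2)] by blast
    show ?thesis
    proof (intro exI[of _ n] ballI impI \<epsilon>(2))
      fix \<omega>' assume "\<omega>' \<in> UNIV \<rightarrow> S" "\<forall>k<n. \<omega>' k = \<omega> k"
      then have "\<bar>e \<omega>' - e \<omega>\<bar> \<le> q ^ n" by (intro close \<omega>) auto
      then show "dist (e \<omega>') (e \<omega>) < \<epsilon>" using n by (simp add: dist_real_def)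
    qed
  qed
  have meas: "e \<in> borel_measurable P" by (rule measurable_of_cylinders[OF cyl])
  define C where "C = e ` (UNIV \<rightarrow> S)"
  let ?T = "product_topology (\<lambda>_::nat. discrete_topology S) UNIV"
  have top: "topspace ?T = UNIV \<rightarrow> S" by (auto simp: PiE_UNIV_domain)
  have "compact_space ?T"
    by (simp add: compact_space_product_topology compact_space_discrete_topology finite_S)
  then have "compactin ?T (UNIV \<rightarrow> S)" unfolding compact_space_def top .
  moreover have "continuous_map ?T euclidean e"
    unfolding continuous_map_def
  proof (intro conjI allI impI)
    fix G :: "real set" assume "openin euclidean G"
    then have G: "open G" by simp
    show "openin ?T {\<omega> \<in> topspace ?T. e \<omega> \<in> G}"
    proof (subst openin_subopen, intro ballI)
      fix \<omega> assume "\<omega> \<in> {\<omega> \<in> topspace ?T. e \<omega> \<in> G}"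
      then have \<omega>: "\<omega> \<in> UNIV \<rightarrow> S" "e \<omega> \<in> G" unfolding top by auto
      obtain n where n: "\<forall>\<omega>'\<in>UNIV \<rightarrow> S. (\<forall>k<n. \<omega>' k = \<omega> k) \<longrightarrow> e \<omega>' \<in> G"
        using cyl[OF \<omega>(1) G \<omega>(2)] by blast
      let ?U = "\<Pi>\<^sub>E k\<in>UNIV. if k < n then {\<omega> k} else S"
      have "openin ?T ?U"
      proof (rule product_topology_basis)
        show "openin (discrete_topology S) (if k < n then {\<omega> k} else S)" for k using \<omega>(1) by auto
        show "finite {k. (if k < n then {\<omega> k} else S) \<noteq> topspace (discrete_topology S)}"
          by (rule finite_subset[of _ "{..<n}"]) auto
      qed
      moreover have "\<omega> \<in> ?U" using \<omega>(1) by (auto simp: PiE_UNIV_domain)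
      moreover have "?U \<subseteq> {\<omega> \<in> topspace ?T. e \<omega> \<in> G}"
      proof
        fix \<omega>' assume *: "\<omega>' \<in> ?U"
        have "\<omega>' k \<in> (if k < n then {\<omega> k} else S)" for k using PiE_mem[OF *, of k] by simp
        then have k1: "\<omega>' k = \<omega> k" if "k < n" for k using that by (metis singletonD)
        have "\<omega>' k \<in> S" for k
          using \<open>\<And>k. \<omega>' k \<in> (if k < n then {\<omega> k} else S)\<close>[of k] \<omega>(1) by (cases "k < n") auto
        then have "\<omega>' \<in> UNIV \<rightarrow> S" by blast
        with n k1 show "\<omega>' \<in> {\<omega> \<in> topspace ?T. e \<omega> \<in> G}" unfolding top by blast
      qed
      ultimately show "\<exists>U. openin ?T U \<and> \<omega> \<in> U \<and> U \<subseteq> {\<omega> \<in> topspace ?T. e \<omega> \<in> G}" by blast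
    qed
  qed simp
  ultimately have "compactin euclidean (e ` (UNIV \<rightarrow> S))" by (rule image_compactin)
  then have cpt: "compact C" unfolding C_def by simp
  have e_inj: "\<omega>' = \<omega>" if "\<omega> \<in> UNIV \<rightarrow> S" "\<omega>' \<in> UNIV \<rightarrow> S" "e \<omega>' = e \<omega>" for \<omega> \<omega>'
    by (rule ext, rule sep[OF that(1,2) _ lessI]) (use that(3) q in simp)
  define \<theta>0 where "\<theta>0 x = \<pi> (SOME \<omega>. \<omega> \<in> UNIV \<rightarrow> S \<and> e \<omega> = x)" for x
  have \<theta>0: "\<theta>0 (e \<omega>) = \<pi> \<omega>" if "\<omega> \<in> UNIV \<rightarrow> S" for \<omega>
  proof -
    have "(SOME \<omega>'. \<omega>' \<in> UNIV \<rightarrow> S \<and> e \<omega>' = e \<omega>) = \<omega>"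
      by (rule some_equality) (use that e_inj in auto)
    then show ?thesis unfolding \<theta>0_def by simp
  qed
  have cont: "continuous_on C \<theta>0"
    unfolding continuous_on_topological
  proof (intro ballI allI impI)
    fix x and G :: "'k set" assume x: "x \<in> C" and G: "open G" "\<theta>0 x \<in> G"
    obtain \<omega> where \<omega>: "\<omega> \<in> UNIV \<rightarrow> S" "x = e \<omega>" using x unfolding C_def by blast
    have "\<pi> \<omega> \<in> G" using G(2) \<theta>0 \<omega> by simp
    then obtain n where n: "\<forall>\<omega>'\<in>UNIV \<rightarrow> S. (\<forall>k<n. \<omega>' k = \<omega> k) \<longrightarrow> \<pi> \<omega>' \<in> G"
      using \<pi>_cylinder[OF \<omega>(1) G(1)] by blast
    show "\<exists>A. open A \<and> x \<in> A \<and> (\<forall>y\<in>C. y \<in> A \<longrightarrow> \<theta>0 y \<in> G)"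
    proof (intro exI[of _ "ball x (\<delta> * q ^ n)"] conjI ballI impI)
      show "x \<in> ball x (\<delta> * q ^ n)" using q by simp
      fix y assume y: "y \<in> C" "y \<in> ball x (\<delta> * q ^ n)"
      obtain \<omega>' where \<omega>': "\<omega>' \<in> UNIV \<rightarrow> S" "y = e \<omega>'" using y(1) unfolding C_def by blast
      have "\<bar>e \<omega>' - e \<omega>\<bar> < \<delta> * q ^ n" using y(2) \<omega>(2) \<omega>'(2) by (simp add: dist_real_def abs_minus_commute)
      then have "\<forall>k<n. \<omega>' k = \<omega> k" using sep[OF \<omega>(1) \<omega>'(1)] by blast
      then show "\<theta>0 y \<in> G" using n \<omega>' \<theta>0 by simp
    qed simp
  qed
  obtain x1 where x1: "x1 \<in> K" using V0_nonempty V0_subset by blast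
  \<comment> \<open>Off the codes \<theta> takes a default value in \<open>K\<close>, which makes it
    a measurable map on the whole line.\<close>
  define \<theta> where "\<theta> x = (if x \<in> C then \<theta>0 x else x1)" for x
  have C_borel: "C \<in> sets borel" using compact_imp_closed[OF cpt] by simp
  show thesis
  proof (rule that[of C e \<theta>])
    show "continuous_on C \<theta>" by (rule continuous_on_eq[OF cont]) (simp add: \<theta>_def)
    show "\<theta> \<in> measurable borel (restrict_space borel K)"
    proof (rule measurable_restrict_space2)
      show "\<theta> \<in> borel_measurable borel"
        unfolding \<theta>_def[abs_def] by (rule borel_measurable_continuous_on_if[OF C_borel cont]) simp
      show "\<theta> \<in> space borel \<rightarrow> K"
        unfolding \<theta>_def C_def using \<theta>0 \<pi>_in_K x1 by auto
    qed
    show "e \<omega> \<in> C \<and> \<theta> (e \<omega>) = \<pi> \<omega>" if "\<omega> \<in> UNIV \<rightarrow> S" for \<omega>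
      using that \<theta>0 by (auto simp: \<theta>_def C_def)
  qed (fact cpt meas)+
qed

lemma integral_\<mu>:
  fixes f :: "'k \<Rightarrow> 'c::{banach, second_countable_topology}"
  assumes "f \<in> borel_measurable \<mu>"
  shows "(\<integral>x. f x \<partial>\<mu>) = (\<integral>\<omega>. f (\<pi> \<omega>) \<partial>P)"
  unfolding \<mu>_distr
  by (rule integral_distr[OF \<pi>_measurable]) (use assms measurable_cong_sets[OF sets_\<mu> refl] in blast)

text \<open>The measures are moved to the real line along the coding of words, where Helly's selection theorem
  applies.\<close>

lemma weak_limit:
  fixes h :: "nat \<Rightarrow> 'k \<Rightarrow> real"
  assumes cont: "\<And>j. continuous_on K (h j)" and h_ge: "\<And>j x. x \<in> K \<Longrightarrow> 1 \<le> h j x"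
    and bd: "\<And>j. (\<integral>x. h j x \<partial>\<mu>) \<le> M"
  obtains s :: "nat \<Rightarrow> nat" and N where "strict_mono s" "finite_measure N" "sets N = sets (restrict_space borel K)"
    "\<And>\<psi> :: 'k \<Rightarrow> real. continuous_on K \<psi> \<Longrightarrow> (\<lambda>j. \<integral>x. \<psi> x * h (s j) x \<partial>\<mu>) \<longlonglongrightarrow> (\<integral>x. \<psi> x \<partial>N)"
    "(\<And>\<epsilon>. \<epsilon> > 0 \<Longrightarrow> \<exists>L. \<forall>j. (\<integral>x. max (h j x - L) 0 \<partial>\<mu>) \<le> \<epsilon>) \<Longrightarrow> absolutely_continuous \<mu> N"
proof -
  obtain C :: "real set" and e :: "(nat \<Rightarrow> 'i) \<Rightarrow> real" and \<theta> :: "real \<Rightarrow> 'k"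
    where C: "compact C" and e [measurable]: "e \<in> borel_measurable P" and \<theta>_cont: "continuous_on C \<theta>"
      and \<theta> [measurable]: "\<theta> \<in> measurable borel (restrict_space borel K)"
      and e_C: "\<And>\<omega>. \<omega> \<in> UNIV \<rightarrow> S \<Longrightarrow> e \<omega> \<in> C \<and> \<theta> (e \<omega>) = \<pi> \<omega>"
    using coding by blast
  interpret P: prob_space P by (rule prob_space_Bernoulli)
  have \<theta>_K: "\<theta> x \<in> K" for x
    using measurable_space[OF \<theta>, of x] by (simp add: space_restrict_space)
  \<comment> \<open>The total masses. They lie between 1 and \<open>M\<close>, so dividing by them
    is harmless and they converge along a subsequence.\<close>
  define a where "a j = (\<integral>x. h j x \<partial>\<mu>)" for j
  have a_ge: "1 \<le> a j" for j
  proof -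
    have "(\<integral>x. 1 \<partial>\<mu>) \<le> a j"
      unfolding a_def by (rule integral_mono) (use continuous_integrable[OF cont] h_ge in \<open>auto simp: space_\<mu>\<close>)
    then show ?thesis by (simp add: prob_space)
  qed
  have h\<pi>_meas [measurable]: "(\<lambda>\<omega>. h j (\<pi> \<omega>)) \<in> borel_measurable P" for j
    using measurable_compose[OF \<pi>_measurable borel_measurable_continuous_on_restrict[OF cont]] .
  have h\<pi>_ge: "1 \<le> h j (\<pi> \<omega>)" if "\<omega> \<in> space P" for j \<omega>
    using h_ge \<pi>_in_K that unfolding space_Bernoulli by blast
  have h\<pi>_int: "integrable P (\<lambda>\<omega>. h j (\<pi> \<omega>))" for j
  proof -
    obtain B where B: "\<And>x. x \<in> K \<Longrightarrow> norm (h j x) \<le> B" using continuous_bounded[OF cont] by blast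
    show ?thesis
      by (rule P.integrable_const_bound[where B = B]) (use B \<pi>_in_K space_Bernoulli in auto)
  qed
  have a_P: "a j = (\<integral>\<omega>. h j (\<pi> \<omega>) \<partial>P)" for j
    unfolding a_def by (rule integral_\<mu>[OF continuous_measurable[OF cont]])
  have ratio_nonneg: "0 \<le> h j (\<pi> \<omega>) / a j" if "\<omega> \<in> space P" for j \<omega>
    using h\<pi>_ge[OF that, of j] a_ge[of j] by (intro divide_nonneg_nonneg) auto
  \<comment> \<open>The measures with densities \<open>h j\<close>, normalised and carried to the
    real line by the code.\<close>
  define \<nu> where "\<nu> j = distr (density P (\<lambda>\<omega>. ennreal (h j (\<pi> \<omega>) / a j))) borel e" for j
  have \<nu>_int: "(\<integral>x. f x \<partial>\<nu> j) = (\<integral>\<omega>. h j (\<pi> \<omega>) / a j * f (e \<omega>) \<partial>P)" if [measurable]: "f \<in> borel_measurable borel" for f :: "real \<Rightarrow> real" and j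
  proof -
    have "(\<integral>x. f x \<partial>\<nu> j) = (\<integral>\<omega>. f (e \<omega>) \<partial>density P (\<lambda>\<omega>. ennreal (h j (\<pi> \<omega>) / a j)))"
      unfolding \<nu>_def by (rule integral_distr) measurable
    also have "\<dots> = (\<integral>\<omega>. (h j (\<pi> \<omega>) / a j) *\<^sub>R f (e \<omega>) \<partial>P)"
    proof (rule integral_density)
      show "AE \<omega> in P. 0 \<le> h j (\<pi> \<omega>) / a j"
        by (intro AE_I2 ratio_nonneg)
    qed measurable
    finally show ?thesis by simp
  qed
  have \<nu>_rd: "real_distribution (\<nu> j)" for j
  proof (rule real_distribution.intro)
    have "(\<integral>\<^sup>+\<omega>. ennreal (h j (\<pi> \<omega>) / a j) \<partial>P) = ennreal (\<integral>\<omega>. h j (\<pi> \<omega>) / a j \<partial>P)"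
      by (rule nn_integral_eq_integral) (use h\<pi>_int[of j] in simp, intro AE_I2 ratio_nonneg)
    also have "(\<integral>\<omega>. h j (\<pi> \<omega>) / a j \<partial>P) = 1"
      using a_P[of j] a_ge[of j] by simp
    finally have "prob_space (density P (\<lambda>\<omega>. ennreal (h j (\<pi> \<omega>) / a j)))"
      by (intro prob_spaceI) (simp add: emeasure_density cong: nn_integral_cong)
    then show "prob_space (\<nu> j)"
      unfolding \<nu>_def by (rule prob_space.prob_space_distr) simp
    show "real_distribution_axioms (\<nu> j)"
      by (rule real_distribution_axioms.intro) (simp add: \<nu>_def)
  qed
  have C_borel [measurable]: "C \<in> sets borel" using compact_imp_closed[OF C] by simp
  have \<nu>_C: "AE x in \<nu> j. x \<in> C" for j
    unfolding \<nu>_def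
  proof (subst AE_distr_iff)
    show "AE \<omega> in density P (\<lambda>\<omega>. ennreal (h j (\<pi> \<omega>) / a j)). e \<omega> \<in> C"
      by (rule AE_I2) (use e_C space_Bernoulli in simp)
  qed auto
  obtain R where R: "R > 0" "\<And>x. x \<in> C \<Longrightarrow> norm x \<le> R"
    using compact_imp_bounded[OF C] unfolding bounded_pos by blast
  have "tight \<nu>"
    unfolding tight_def
  proof (intro conjI allI impI)
    fix \<epsilon> :: real assume \<epsilon>: "\<epsilon> > 0"
    show "\<exists>a b. a < b \<and> (\<forall>n. 1 - \<epsilon> < measure (\<nu> n) {a<..b})"
    \<comment> \<open>Tightness is stated with intervals open on the left; starting at
      \<open>- R - 1\<close> keeps the point \<open>- R\<close> inside.\<close>
    proof (rule exI[of _ "- R - 1"], rule exI[of _ R], intro conjI allI)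
      fix n
      interpret \<nu>: real_distribution "\<nu> n" by (rule \<nu>_rd)
      have "AE x in \<nu> n. x \<in> {- R - 1<..R}"
        using \<nu>_C[of n] by eventually_elim (use R(2) in \<open>force simp: abs_le_iff\<close>)
      then have "measure (\<nu> n) {- R - 1<..R} = 1" by (subst \<nu>.prob_eq_1) auto
      then show "1 - \<epsilon> < measure (\<nu> n) {- R - 1<..R}" using \<epsilon> by simp
    qed (use R in simp)
  qed (rule \<nu>_rd)
  then obtain s1 N' where s1: "strict_mono (s1 :: nat \<Rightarrow> nat)" and N': "real_distribution N'"
    and weak: "weak_conv_m (\<nu> \<circ> id \<circ> s1) N'"
    using tight_imp_convergent_subsubsequence[of \<nu> id] strict_mono_id by blast
  interpret N': real_distribution N' by (rule N')
  have "bounded (range (\<lambda>j. a (s1 j)))"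
  proof (rule boundedI)
    fix x assume "x \<in> range (\<lambda>j. a (s1 j))"
    then obtain j where "x = a (s1 j)" by blast
    then show "norm x \<le> M" using a_ge[of "s1 j"] bd[of "s1 j", folded a_def] by simp
  qed
  then obtain \<alpha> s2 where s2: "strict_mono (s2 :: nat \<Rightarrow> nat)" and "((\<lambda>j. a (s1 j)) \<circ> s2) \<longlonglongrightarrow> \<alpha>"
    using bounded_imp_convergent_subsequence by blast
  then have \<alpha>: "(\<lambda>j. a (s1 (s2 j))) \<longlonglongrightarrow> \<alpha>" by (simp add: o_def)
  have \<alpha>_ge: "1 \<le> \<alpha>" by (rule LIMSEQ_le_const[OF \<alpha>]) (use a_ge in blast)
  define s where "s = s1 \<circ> s2"
  have s: "strict_mono s" unfolding s_def by (rule strict_mono_o[OF s1 s2])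
  have lim: "(\<lambda>j. \<integral>x. f x \<partial>\<nu> (s j)) \<longlonglongrightarrow> (\<integral>x. f x \<partial>N')"
    if "continuous_on UNIV f" "\<And>x. norm (f x) \<le> B" for f :: "real \<Rightarrow> real" and B
  proof -
    have "(\<lambda>j. \<integral>x. f x \<partial>(\<nu> \<circ> id \<circ> s1) j) \<longlonglongrightarrow> (\<integral>x. f x \<partial>N')"
      by (rule weak_conv_imp_integral_bdd_continuous_conv[OF _ N' weak _ that(2)])
        (use \<nu>_rd that(1) in \<open>auto simp: continuous_on_eq_continuous_at\<close>)
    from LIMSEQ_subseq_LIMSEQ[OF this s2] show ?thesis by (simp add: o_def s_def)
  qed
  have C_ne: "C \<noteq> {}"
  proof -
    obtain \<omega> where "\<omega> \<in> UNIV \<rightarrow> S" using S_nonempty by (metis Pi_I' ex_in_conv)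
    then show ?thesis using e_C by blast
  qed
  \<comment> \<open>That all measures sit on \<open>C\<close> passes to the weak limit by testing
    with the distance to \<open>C\<close>, cut off at 1 to be bounded.\<close>
  have N'_C: "AE x in N'. x \<in> C"
  proof -
    define f where "f x = min 1 (infdist x C)" for x
    have f_cont: "continuous_on UNIV f" unfolding f_def by (intro continuous_intros)
    have [measurable]: "f \<in> borel_measurable borel" by (rule borel_measurable_continuous_onI[OF f_cont])
    have f_bd: "norm (f x) \<le> 1" for x by (auto simp: f_def infdist_nonneg)
    have "(\<integral>x. f x \<partial>\<nu> j) = 0" for j
    proof -
      have "AE x in \<nu> j. f x = 0" using \<nu>_C[of j] by eventually_elim (simp add: f_def)
      then show ?thesis by (rule integral_eq_zero_AE)
    qed
    then have "(\<integral>x. f x \<partial>N') = 0" using lim[OF f_cont f_bd] by (simp add: LIMSEQ_const_iff)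
    moreover have "integrable N' f" by (rule N'.integrable_const_bound[where B = 1]) (use f_bd in auto)
    ultimately have "AE x in N'. f x = 0"
      by (subst (asm) integral_nonneg_eq_0_iff_AE) (auto simp: f_def infdist_nonneg)
    then show ?thesis
      by eventually_elim
        (use in_closed_iff_infdist_zero[OF compact_imp_closed[OF C] C_ne] in \<open>auto simp: f_def min_def split: if_splits\<close>)
  qed
  \<comment> \<open>The factor \<alpha>, the limit of the total masses, undoes the
    normalisation.\<close>
  define N where "N = density (distr N' (restrict_space borel K) \<theta>) (\<lambda>_. ennreal \<alpha>)"
  have \<theta>N' [measurable]: "\<theta> \<in> measurable N' (restrict_space borel K)" by simp
  have sets_N: "sets N = sets (restrict_space borel K)" by (simp add: N_def)
  have emeasure_N: "emeasure N A = ennreal \<alpha> * emeasure N' (\<theta> -` A)" if "A \<in> sets (restrict_space borel K)" for A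
    using that by (simp add: N_def emeasure_density_const emeasure_distr)
  have fin_N: "finite_measure N"
    by (rule finite_measureI)
      (use emeasure_N[OF sets.top] N'.emeasure_finite in \<open>auto simp: N_def ennreal_mult_eq_top_iff\<close>)
  have int_N: "(\<integral>x. \<psi> x \<partial>N) = \<alpha> * (\<integral>x. \<psi> (\<theta> x) \<partial>N')" if "continuous_on K \<psi>" for \<psi> :: "'k \<Rightarrow> real"
  proof -
    have [measurable]: "\<psi> \<in> borel_measurable (restrict_space borel K)"
      by (rule borel_measurable_continuous_on_restrict[OF that])
    have "(\<integral>x. \<psi> x \<partial>N) = (\<integral>x. \<alpha> *\<^sub>R \<psi> x \<partial>distr N' (restrict_space borel K) \<theta>)"
      unfolding N_def using \<alpha>_ge by (intro integral_density) auto
    also have "\<dots> = (\<integral>x. \<alpha> *\<^sub>R \<psi> (\<theta> x) \<partial>N')"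
      by (rule integral_distr) auto
    finally show ?thesis by simp
  qed
  have conv: "(\<lambda>j. \<integral>x. \<psi> x * h (s j) x \<partial>\<mu>) \<longlonglongrightarrow> (\<integral>x. \<psi> x \<partial>N)" if \<psi>: "continuous_on K \<psi>" for \<psi> :: "'k \<Rightarrow> real"
  proof -
    obtain B where B: "B > 0" "\<And>x. x \<in> K \<Longrightarrow> norm (\<psi> x) \<le> B" using continuous_bounded[OF \<psi>] by blast
    have \<psi>\<theta>: "continuous_on C (\<lambda>x. \<psi> (\<theta> x))"
      by (rule continuous_on_compose2[OF \<psi> \<theta>_cont]) (use \<theta>_K in auto)
    \<comment> \<open>Tietze's theorem extends the test function from \<open>C\<close> to a bounded
      continuous function on the line, where weak convergence applies.\<close>
    obtain \<Psi> where \<Psi>: "continuous_on UNIV \<Psi>" "\<And>x. x \<in> C \<Longrightarrow> \<Psi> x = \<psi> (\<theta> x)" "\<And>x. norm (\<Psi> x) \<le> B"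
      using Tietze[OF \<psi>\<theta>, of UNIV B] B \<theta>_K compact_imp_closed[OF C] by auto
    have [measurable]: "\<Psi> \<in> borel_measurable borel" by (rule borel_measurable_continuous_onI[OF \<Psi>(1)])
    have "(\<integral>x. \<psi> x * h j x \<partial>\<mu>) = a j * (\<integral>x. \<Psi> x \<partial>\<nu> j)" for j
    proof -
      have "(\<integral>x. \<psi> x * h j x \<partial>\<mu>) = (\<integral>\<omega>. \<psi> (\<pi> \<omega>) * h j (\<pi> \<omega>) \<partial>P)"
        by (rule integral_\<mu>) (intro continuous_measurable continuous_intros \<psi> cont)
      also have "\<dots> = (\<integral>\<omega>. a j * (h j (\<pi> \<omega>) / a j * \<Psi> (e \<omega>)) \<partial>P)"
        by (rule Bochner_Integration.integral_cong[OF refl])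
          (use a_ge[of j] e_C \<Psi>(2) space_Bernoulli in auto)
      also have "\<dots> = a j * (\<integral>x. \<Psi> x \<partial>\<nu> j)" by (subst \<nu>_int) auto
      finally show ?thesis .
    qed
    then have "(\<lambda>j. \<integral>x. \<psi> x * h (s j) x \<partial>\<mu>) \<longlonglongrightarrow> \<alpha> * (\<integral>x. \<Psi> x \<partial>N')"
      using tendsto_mult[OF \<alpha> lim[OF \<Psi>(1,3)]] by (simp add: s_def)
    also have "(\<integral>x. \<Psi> x \<partial>N') = (\<integral>x. \<psi> (\<theta> x) \<partial>N')"
    proof (rule integral_cong_AE)
      have "\<psi> \<in> borel_measurable (restrict_space borel K)"
        by (rule borel_measurable_continuous_on_restrict[OF \<psi>])
      then show "(\<lambda>x. \<psi> (\<theta> x)) \<in> borel_measurable N'" by measurable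
      show "AE x in N'. \<Psi> x = \<psi> (\<theta> x)" using N'_C by eventually_elim (rule \<Psi>(2))
    qed simp
    finally show ?thesis using int_N[OF \<psi>] by simp
  qed
  \<comment> \<open>Uniform integrability bounds the masses near a compact subset of the preimage of
    a null set, uniformly in \<open>j\<close>. The bound survives the weak limit, and inner
    regularity passes from compact subsets to the whole preimage.\<close>
  have ac: "absolutely_continuous \<mu> N"
    if UI: "\<And>\<epsilon>. \<epsilon> > 0 \<Longrightarrow> \<exists>L. \<forall>j. (\<integral>x. max (h j x - L) 0 \<partial>\<mu>) \<le> \<epsilon>"
    unfolding absolutely_continuous_def
  proof
    fix A assume "A \<in> null_sets \<mu>"
    then have A: "A \<in> sets (restrict_space borel K)" "emeasure \<mu> A = 0" by (auto simp: sets_\<mu>)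
    let ?A = "\<theta> -` A"
    have A': "?A \<in> sets borel" using measurable_sets[OF \<theta> A(1)] by simp
    have Z0: "emeasure N' Z = 0" if Z: "compact Z" "Z \<subseteq> ?A" for Z
    proof (cases "Z = {}")
      case False
      \<comment> \<open>Continuous functions that decrease to the indicator of the compact set
        \<open>Z\<close>.\<close>
      define \<xi> where "\<xi> k x = max 0 (1 - real k * infdist x Z)" for k x
      have \<xi>_cont: "continuous_on UNIV (\<xi> k)" for k unfolding \<xi>_def by (intro continuous_intros)
      have \<xi>_meas [measurable]: "\<xi> k \<in> borel_measurable borel" for k
        by (rule borel_measurable_continuous_onI[OF \<xi>_cont])
      have \<xi>01: "0 \<le> \<xi> k x" "\<xi> k x \<le> 1" for k x by (auto simp: \<xi>_def infdist_nonneg)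
      have \<xi>_bd: "norm (\<xi> k x) \<le> 1" for k x using \<xi>01[of k x] by simp
      have \<xi>_Z: "\<xi> k x = 1" if "x \<in> Z" for k x using that by (simp add: \<xi>_def)
      have Z_borel [measurable]: "Z \<in> sets borel" using compact_imp_closed[OF Z(1)] by simp
      have eZ: "AE \<omega> in P. e \<omega> \<notin> Z"
      proof (rule AE_I)
        show "{\<omega> \<in> space P. \<not> e \<omega> \<notin> Z} \<subseteq> \<pi> -` A \<inter> space P"
          using Z(2) e_C by (auto simp: space_Bernoulli)
        show "emeasure P (\<pi> -` A \<inter> space P) = 0"
          using A emeasure_distr[OF \<pi>_measurable A(1)] \<mu>_distr by simp
        show "\<pi> -` A \<inter> space P \<in> sets P" by (rule measurable_sets[OF \<pi>_measurable A(1)])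
      qed
      have \<xi>_lim: "(\<lambda>k. \<integral>\<omega>. \<xi> k (e \<omega>) \<partial>P) \<longlonglongrightarrow> (\<integral>\<omega>. 0 \<partial>P)"
      proof (rule integral_dominated_convergence[where w = "\<lambda>_. 1"])
        show "AE \<omega> in P. (\<lambda>k. \<xi> k (e \<omega>)) \<longlonglongrightarrow> 0"
          using eZ
        proof eventually_elim
          case (elim \<omega>)
          let ?d = "infdist (e \<omega>) Z"
          have "?d > 0"
            using elim in_closed_iff_infdist_zero[OF compact_imp_closed[OF Z(1)] False, of "e \<omega>"]
              infdist_nonneg[of "e \<omega>" Z] by (simp add: less_le)
          then obtain k0 where k0: "1 < real k0 * ?d" using reals_Archimedean3 by blast
          have "\<forall>\<^sub>F k in sequentially. \<xi> k (e \<omega>) = 0"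
            using eventually_ge_at_top[of k0]
          proof eventually_elim
            case (elim k)
            then have "real k0 * ?d \<le> real k * ?d" using infdist_nonneg by (intro mult_right_mono) auto
            then show ?case using k0 by (simp add: \<xi>_def)
          qed
          then show ?case by (rule tendsto_eventually)
        qed
        show "AE \<omega> in P. norm (\<xi> k (e \<omega>)) \<le> 1" for k using \<xi>_bd by (intro AE_I2)
      qed auto
      have "emeasure N' Z \<le> ennreal (2 * \<epsilon>)" if \<epsilon>: "\<epsilon> > 0" for \<epsilon>
      proof -
        obtain L0 where L0: "\<And>j. (\<integral>x. max (h j x - L0) 0 \<partial>\<mu>) \<le> \<epsilon>" using UI[OF \<epsilon>] by blast
        \<comment> \<open>Replacing \<open>L0\<close> by a larger \<open>L\<close> preserves
          \<open>h \<le> L + max (h - L0) 0\<close>, and \<open>L \<ge> 1\<close> allows the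
          division \<open>\<epsilon> / L\<close>.\<close>
        define L where "L = max L0 1"
        have L: "L \<ge> 1" "L \<ge> L0" by (auto simp: L_def)
        have "\<forall>\<^sub>F k in sequentially. (\<integral>\<omega>. \<xi> k (e \<omega>) \<partial>P) < \<epsilon> / L"
          using order_tendstoD(2)[OF \<xi>_lim, of "\<epsilon> / L"] \<epsilon> L by simp
        then obtain k where k: "(\<integral>\<omega>. \<xi> k (e \<omega>) \<partial>P) < \<epsilon> / L"
          using eventually_happens'[OF sequentially_bot] by blast
        have \<xi>e_int: "integrable P (\<lambda>\<omega>. \<xi> k (e \<omega>))"
          by (rule P.integrable_const_bound[where B = 1]) (use \<xi>_bd in auto)
        have le: "(\<integral>x. \<xi> k x \<partial>\<nu> j) \<le> 2 * \<epsilon>" for j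
        proof -
          have max_int: "integrable P (\<lambda>\<omega>. max (h j (\<pi> \<omega>) - L0) 0)"
            using h\<pi>_int[of j] by auto
          have pt: "h j (\<pi> \<omega>) / a j * \<xi> k (e \<omega>) \<le> L * \<xi> k (e \<omega>) + max (h j (\<pi> \<omega>) - L0) 0"
            if "\<omega> \<in> space P" for \<omega>
          proof -
            have "h j (\<pi> \<omega>) / a j \<le> h j (\<pi> \<omega>) / 1"
              using h\<pi>_ge[OF that, of j] a_ge[of j] by (intro divide_left_mono) auto
            also have "\<dots> \<le> L + max (h j (\<pi> \<omega>) - L0) 0" using L by auto
            finally have "h j (\<pi> \<omega>) / a j * \<xi> k (e \<omega>) \<le> (L + max (h j (\<pi> \<omega>) - L0) 0) * \<xi> k (e \<omega>)"
              using \<xi>01 by (intro mult_right_mono)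
            also have "\<dots> = L * \<xi> k (e \<omega>) + max (h j (\<pi> \<omega>) - L0) 0 * \<xi> k (e \<omega>)"
              by (simp add: distrib_right)
            also have "max (h j (\<pi> \<omega>) - L0) 0 * \<xi> k (e \<omega>) \<le> max (h j (\<pi> \<omega>) - L0) 0"
              using \<xi>01 by (intro mult_left_le) auto
            finally show ?thesis by simp
          qed
          have "(\<integral>x. \<xi> k x \<partial>\<nu> j) = (\<integral>\<omega>. h j (\<pi> \<omega>) / a j * \<xi> k (e \<omega>) \<partial>P)" by (rule \<nu>_int) simp
          also have "\<dots> \<le> (\<integral>\<omega>. L * \<xi> k (e \<omega>) + max (h j (\<pi> \<omega>) - L0) 0 \<partial>P)"
          proof (rule integral_mono)
            show "integrable P (\<lambda>\<omega>. h j (\<pi> \<omega>) / a j * \<xi> k (e \<omega>))"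
            proof (rule Bochner_Integration.integrable_bound[OF h\<pi>_int[of j]])
              show "AE \<omega> in P. norm (h j (\<pi> \<omega>) / a j * \<xi> k (e \<omega>)) \<le> norm (h j (\<pi> \<omega>))"
              proof (rule AE_I2)
                fix \<omega> assume \<omega>: "\<omega> \<in> space P"
                have "h j (\<pi> \<omega>) / a j * \<xi> k (e \<omega>) \<le> h j (\<pi> \<omega>) / 1 * 1"
                  using h\<pi>_ge[OF \<omega>, of j] a_ge[of j] \<xi>01 by (intro mult_mono divide_left_mono) auto
                moreover have "0 \<le> h j (\<pi> \<omega>) / a j * \<xi> k (e \<omega>)"
                  using h\<pi>_ge[OF \<omega>, of j] a_ge[of j] \<xi>01 by (intro mult_nonneg_nonneg divide_nonneg_nonneg) auto
                ultimately show "norm (h j (\<pi> \<omega>) / a j * \<xi> k (e \<omega>)) \<le> norm (h j (\<pi> \<omega>))"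
                  unfolding real_norm_def by linarith
              qed
            qed measurable
            show "integrable P (\<lambda>\<omega>. L * \<xi> k (e \<omega>) + max (h j (\<pi> \<omega>) - L0) 0)" using \<xi>e_int max_int by simp
          qed (rule pt)
          also have "\<dots> = L * (\<integral>\<omega>. \<xi> k (e \<omega>) \<partial>P) + (\<integral>\<omega>. max (h j (\<pi> \<omega>) - L0) 0 \<partial>P)"
            using \<xi>e_int max_int by simp
          also have "(\<integral>\<omega>. max (h j (\<pi> \<omega>) - L0) 0 \<partial>P) = (\<integral>x. max (h j x - L0) 0 \<partial>\<mu>)"
            by (rule integral_\<mu>[symmetric]) (intro continuous_measurable continuous_intros cont)
          also have "L * (\<integral>\<omega>. \<xi> k (e \<omega>) \<partial>P) \<le> L * (\<epsilon> / L)"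
            using k L by (intro mult_left_mono) auto
          finally show ?thesis using L0[of j] L by simp
        qed
        have "measure N' Z = (\<integral>x. indicator Z x \<partial>N')" by simp
        also have "\<dots> \<le> (\<integral>x. \<xi> k x \<partial>N')"
        proof (rule integral_mono)
          show "integrable N' (indicator Z :: real \<Rightarrow> real)"
            by (rule N'.integrable_const_bound[where B = 1]) auto
          show "integrable N' (\<xi> k)"
            by (rule N'.integrable_const_bound[where B = 1]) (use \<xi>_bd in auto)
          show "indicator Z x \<le> \<xi> k x" for x using \<xi>_Z[of x k] \<xi>01[of k x] by (simp add: indicator_def)
        qed
        also have "\<dots> \<le> 2 * \<epsilon>"
          by (rule LIMSEQ_le_const2[OF lim[OF \<xi>_cont \<xi>_bd]]) (use le in blast)
        finally show ?thesis by (simp add: N'.emeasure_eq_measure ennreal_leI)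
      qed
      note small = this
      have "measure N' Z \<le> 0 + \<epsilon>" if "\<epsilon> > 0" for \<epsilon>
        using small[of "\<epsilon> / 2"] that by (simp add: N'.emeasure_eq_measure)
      then have "measure N' Z \<le> 0" by (rule field_le_epsilon)
      then show ?thesis using N'.emeasure_eq_measure[of Z] measure_nonneg[of N' Z] by simp
    qed simp
    have "emeasure N' ?A = (SUP Z\<in>{Z. Z \<subseteq> ?A \<and> compact Z}. emeasure N' Z)"
      by (rule inner_regular) (use A' N'.emeasure_finite in auto)
    also have "\<dots> \<le> 0" by (rule SUP_least) (use Z0 in auto)
    finally have "emeasure N' ?A = 0" by simp
    then show "A \<in> null_sets N" using emeasure_N[OF A(1)] A(1) sets_N by (auto simp: null_sets_def)
  qed
  show thesis by (rule that[OF s fin_N sets_N conv ac])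
qed

end

section \<open>Signed measures\<close>

text \<open>Countable additivity for the sequence consisting of \<open>A\<close>, \<open>B\<close>
  and then only empty sets.\<close>

lemma finite_variation_additive:
  fixes \<nu> :: "'k::metric_space set \<Rightarrow> real"
  assumes \<nu>: "finite_variation_measure K \<nu>"
    and AB: "A \<in> sets (restrict_space borel K)" "B \<in> sets (restrict_space borel K)" "A \<inter> B = {}"
  shows "\<nu> (A \<union> B) = \<nu> A + \<nu> B"
proof -
  have "range (binaryset A B) \<subseteq> sets (restrict_space borel K)" "disjoint_family (binaryset A B)"
    using AB by (auto simp: binaryset_def disjoint_family_on_def)
  then have "(\<lambda>n. \<nu> (binaryset A B n)) sums \<nu> (\<Union>n. binaryset A B n)"
    using \<nu> unfolding finite_variation_measure_def by blast
  moreover have "(\<lambda>n. \<nu> (binaryset A B n)) sums (\<Sum>n\<in>{0, 1}. \<nu> (binaryset A B n))"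
    by (rule sums_finite) (use \<nu> in \<open>auto simp: binaryset_def finite_variation_measure_def\<close>)
  ultimately show ?thesis
    using sums_unique2 by (fastforce simp: UN_binaryset_eq binaryset_def)
qed

text \<open>If \<open>\<nu>\<close> were unbounded on the subsets of a set, the set could be split so that one part has
  \<open>|\<nu>| \<ge> 1\<close> while \<open>\<nu>\<close> is unbounded on the other; iterating contradicts countable additivity.\<close>

lemma finite_variation_bounded:
  fixes \<nu> :: "'k::metric_space set \<Rightarrow> real"
  assumes \<nu>: "finite_variation_measure K \<nu>"
  obtains M where "\<And>A. A \<in> sets (restrict_space borel K) \<Longrightarrow> \<bar>\<nu> A\<bar> \<le> M"
proof -
  let ?\<Sigma> = "sets (restrict_space borel K)"
  define unb where "unb A \<longleftrightarrow> (\<forall>m. \<exists>B\<in>?\<Sigma>. B \<subseteq> A \<and> m < \<bar>\<nu> B\<bar>)" for A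
  have step: "\<exists>A'. (A' \<in> ?\<Sigma> \<and> unb A') \<and> A' \<subseteq> A \<and> 1 \<le> \<bar>\<nu> (A - A')\<bar>" if A: "A \<in> ?\<Sigma>" "unb A" for A
  proof -
    \<comment> \<open>With this margin both \<open>B\<close> and \<open>A - B\<close> have absolute
      value at least 1, so whichever of the two is still unbounded can be kept.\<close>
    obtain B where B: "B \<in> ?\<Sigma>" "B \<subseteq> A" "\<bar>\<nu> A\<bar> + 1 < \<bar>\<nu> B\<bar>" using A(2) unfolding unb_def by blast
    have AB: "A - B \<in> ?\<Sigma>" using A B by auto
    have "\<nu> (B \<union> (A - B)) = \<nu> B + \<nu> (A - B)"
      by (rule finite_variation_additive[OF \<nu> B(1) AB]) blast
    moreover have "B \<union> (A - B) = A" using B(2) by blast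
    ultimately have eq: "\<nu> A = \<nu> B + \<nu> (A - B)" by simp
    have ge: "1 \<le> \<bar>\<nu> (A - B)\<bar>" "1 \<le> \<bar>\<nu> B\<bar>" using B(3) eq by linarith+
    show ?thesis
    proof (cases "unb B")
      case True
      then show ?thesis using B ge by blast
    next
      case False
      have "unb (A - B)"
      proof (rule ccontr)
        assume "\<not> unb (A - B)"
        then obtain m1 where m1: "\<And>C. C \<in> ?\<Sigma> \<Longrightarrow> C \<subseteq> A - B \<Longrightarrow> \<not> m1 < \<bar>\<nu> C\<bar>"
          unfolding unb_def by blast
        obtain m2 where m2: "\<And>C. C \<in> ?\<Sigma> \<Longrightarrow> C \<subseteq> B \<Longrightarrow> \<not> m2 < \<bar>\<nu> C\<bar>"
          using False unfolding unb_def by blast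
        obtain C where C: "C \<in> ?\<Sigma>" "C \<subseteq> A" "m1 + m2 < \<bar>\<nu> C\<bar>" using A(2) unfolding unb_def by blast
        have s: "C \<inter> B \<in> ?\<Sigma>" "C - B \<in> ?\<Sigma>" using B C by auto
        have "\<nu> ((C \<inter> B) \<union> (C - B)) = \<nu> (C \<inter> B) + \<nu> (C - B)"
          by (rule finite_variation_additive[OF \<nu> s]) blast
        moreover have "(C \<inter> B) \<union> (C - B) = C" by blast
        ultimately have "\<bar>\<nu> C\<bar> \<le> \<bar>\<nu> (C \<inter> B)\<bar> + \<bar>\<nu> (C - B)\<bar>" by simp
        also have "\<bar>\<nu> (C \<inter> B)\<bar> \<le> m2" using m2[OF s(1)] by force
        also have "\<bar>\<nu> (C - B)\<bar> \<le> m1" using m1[OF s(2)] C(2) by force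
        finally show False using C(3) by simp
      qed
      moreover have "A - (A - B) = B" using B(2) by blast
      ultimately show ?thesis using AB ge by (intro exI[of _ "A - B"]) auto
    qed
  qed
  have "\<not> unb K"
  proof
    assume "unb K"
    moreover have "K \<in> ?\<Sigma>" using sets.top[of "restrict_space borel K"] by (simp add: space_restrict_space)
    ultimately obtain X where X: "\<And>n. X n \<in> ?\<Sigma> \<and> unb (X n)"
        "\<And>n. X (Suc n) \<subseteq> X n \<and> 1 \<le> \<bar>\<nu> (X n - X (Suc n))\<bar>"
      using dependent_nat_choice[of "\<lambda>_ A. A \<in> ?\<Sigma> \<and> unb A" "\<lambda>_ A A'. A' \<subseteq> A \<and> 1 \<le> \<bar>\<nu> (A - A')\<bar>"] step
      by metis
    have mono: "X n \<subseteq> X m" if "m \<le> n" for m n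
      using that by (induction rule: dec_induct) (use X(2) in blast)+
    have "disjoint_family (\<lambda>n. X n - X (Suc n))"
      unfolding disjoint_family_on_def
    proof (intro ballI impI)
      fix m n :: nat assume "m \<noteq> n"
      then have "Suc m \<le> n \<or> Suc n \<le> m" by linarith
      then show "(X m - X (Suc m)) \<inter> (X n - X (Suc n)) = {}" using mono by blast
    qed
    moreover have "range (\<lambda>n. X n - X (Suc n)) \<subseteq> ?\<Sigma>" using X(1) by auto
    ultimately have "(\<lambda>n. \<nu> (X n - X (Suc n))) sums \<nu> (\<Union>n. X n - X (Suc n))"
      using \<nu> unfolding finite_variation_measure_def by blast
    then have "(\<lambda>n. \<nu> (X n - X (Suc n))) \<longlonglongrightarrow> 0" by (intro summable_LIMSEQ_zero sums_summable)
    then have "\<forall>\<^sub>F n in sequentially. dist (\<nu> (X n - X (Suc n))) 0 < 1" by (rule tendstoD) simp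
    then obtain n where "dist (\<nu> (X n - X (Suc n))) 0 < 1"
      using eventually_happens'[OF sequentially_bot] by blast
    then show False using X(2)[of n] by simp
  qed
  then obtain m where m: "\<And>B. B \<in> ?\<Sigma> \<Longrightarrow> B \<subseteq> K \<Longrightarrow> \<not> m < \<bar>\<nu> B\<bar>" unfolding unb_def by blast
  show thesis
  proof
    fix A assume "A \<in> ?\<Sigma>"
    then show "\<bar>\<nu> A\<bar> \<le> m"
      using m[of A] sets.sets_into_space[of A "restrict_space borel K"] by (simp add: space_restrict_space not_less)
  qed
qed

lemma finite_variation_uminus:
  fixes \<nu> :: "'k::metric_space set \<Rightarrow> real"
  shows "finite_variation_measure K \<nu> \<Longrightarrow> finite_variation_measure K (\<lambda>A. - \<nu> A)"
  unfolding finite_variation_measure_def by (auto intro: sums_minus)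

lemma finite_variation_inner:
  fixes \<nu> :: "'k::metric_space set \<Rightarrow> 'b::euclidean_space"
  assumes "finite_variation_measure K \<nu>"
  shows "finite_variation_measure K (\<lambda>A. \<nu> A \<bullet> b)"
  using assms bounded_linear.sums[OF bounded_linear_inner_left, of _ _ b]
  unfolding finite_variation_measure_def by auto

section \<open>Jordan decomposition and densities\<close>

lemma sets_positive_variation: "sets (positive_variation K \<nu>) = sets (restrict_space borel K)"
proof -
  have "sets (positive_variation K \<nu>) = sigma_sets K (sets (restrict_space borel K))"
    unfolding positive_variation_def
    using sets.space_closed[of "restrict_space borel K"] by (intro sets_measure_of) (simp add: space_restrict_space)
  also have "\<dots> = sets (restrict_space borel K)"
    using sets.sigma_sets_eq[of "restrict_space borel K"] by (simp add: space_restrict_space)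
  finally show ?thesis .
qed

text \<open>The uniform bound on \<nu> bounds the supremum, and it also holds for the default value
  0 of a set function that is not a measure; \<open>emeasure_measure_of_conv\<close> treats both
  cases at once.\<close>

lemma finite_positive_variation:
  fixes \<nu> :: "'k::metric_space set \<Rightarrow> real"
  assumes \<nu>: "finite_variation_measure K \<nu>"
  shows "finite_measure (positive_variation K \<nu>)"
proof
  obtain M where M: "\<And>A. A \<in> sets (restrict_space borel K) \<Longrightarrow> \<bar>\<nu> A\<bar> \<le> M"
    using finite_variation_bounded[OF \<nu>] by blast
  have "emeasure (positive_variation K \<nu>) A \<le> ennreal M" for A
    unfolding positive_variation_def emeasure_measure_of_conv
    by (auto intro!: SUP_least ennreal_leI) (use M in \<open>force simp: abs_le_iff\<close>)
  then show "emeasure (positive_variation K \<nu>) (space (positive_variation K \<nu>)) \<noteq> \<infinity>"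
    by (metis ennreal_less_top infinity_ennreal_def leD)
qed

text \<open>The supremum over subsets of \<open>A\<close> is attained at the part of
  \<open>A\<close> where \<open>f\<close> is positive, an explicit Hahn decomposition.\<close>

lemma positive_variation_density:
  fixes f :: "'k::metric_space \<Rightarrow> real"
  assumes Q: "sets Q = sets (restrict_space borel K)" and f: "integrable Q f"
    and \<nu>: "\<And>A. A \<in> sets (restrict_space borel K) \<Longrightarrow> \<nu> A = (\<integral>x. indicator A x * f x \<partial>Q)"
  shows "positive_variation K \<nu> = density Q (\<lambda>x. ennreal (max (f x) 0))"
proof -
  let ?D = "density Q (\<lambda>x. ennreal (max (f x) 0))"
  have f_meas [measurable]: "f \<in> borel_measurable Q" using f by simp
  have sp: "space Q = K" using sets_eq_imp_space_eq[OF Q] by (simp add: space_restrict_space)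
  have int: "integrable Q (\<lambda>x. indicator A x * f x)" "integrable Q (\<lambda>x. indicator A x * max (f x) 0)"
    if "A \<in> sets Q" for A
    using that f integrable_mult_indicator[of A Q f] integrable_mult_indicator[of A Q "\<lambda>x. max (f x) 0"] by auto
  have val: "(SUP B\<in>{B \<in> sets (restrict_space borel K). B \<subseteq> A}. ennreal (\<nu> B)) = emeasure ?D A"
    if A: "A \<in> sets Q" for A
  proof -
    have eD: "emeasure ?D A = ennreal (\<integral>x. indicator A x * max (f x) 0 \<partial>Q)"
    proof -
      have "emeasure ?D A = (\<integral>\<^sup>+x. ennreal (max (f x) 0) * indicator A x \<partial>Q)"
        by (rule emeasure_density) (use A in measurable)
      also have "\<dots> = (\<integral>\<^sup>+x. ennreal (indicator A x * max (f x) 0) \<partial>Q)"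
        by (intro nn_integral_cong) (auto simp: indicator_def)
      also have "\<dots> = ennreal (\<integral>x. indicator A x * max (f x) 0 \<partial>Q)"
        by (rule nn_integral_eq_integral) (use int(2)[OF A] in auto)
      finally show ?thesis .
    qed
    show ?thesis
    proof (rule antisym)
      show "(SUP B\<in>{B \<in> sets (restrict_space borel K). B \<subseteq> A}. ennreal (\<nu> B)) \<le> emeasure ?D A"
      proof (rule SUP_least)
        fix B assume "B \<in> {B \<in> sets (restrict_space borel K). B \<subseteq> A}"
        then have B: "B \<in> sets (restrict_space borel K)" "B \<in> sets Q" "B \<subseteq> A" using Q by auto
        have "\<nu> B \<le> (\<integral>x. indicator A x * max (f x) 0 \<partial>Q)"
          unfolding \<nu>[OF B(1)]
          by (rule integral_mono) (use int(1)[OF B(2)] int(2)[OF A] B(3) in \<open>auto simp: indicator_def\<close>)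
        then show "ennreal (\<nu> B) \<le> emeasure ?D A" unfolding eD by (rule ennreal_leI)
      qed
      let ?B = "A \<inter> {x \<in> space Q. 0 < f x}"
      have B: "?B \<in> sets Q" using A by measurable
      then have B': "?B \<in> sets (restrict_space borel K)" using Q by simp
      have "\<nu> ?B = (\<integral>x. indicator A x * max (f x) 0 \<partial>Q)"
        unfolding \<nu>[OF B'] by (rule Bochner_Integration.integral_cong) (auto simp: indicator_def)
      then have "emeasure ?D A = ennreal (\<nu> ?B)" unfolding eD by simp
      also have "\<dots> \<le> (SUP B\<in>{B \<in> sets (restrict_space borel K). B \<subseteq> A}. ennreal (\<nu> B))"
        by (rule SUP_upper) (use B' in auto)
      finally show "emeasure ?D A \<le> (SUP B\<in>{B \<in> sets (restrict_space borel K). B \<subseteq> A}. ennreal (\<nu> B))" .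
    qed
  qed
  have "positive_variation K \<nu> = measure_of K (sets (restrict_space borel K)) (emeasure ?D)"
    unfolding positive_variation_def
  proof (rule measure_of_eq)
    show "sets (restrict_space borel K) \<subseteq> Pow K"
      using sets.space_closed[of "restrict_space borel K"] by (simp add: space_restrict_space)
    fix A assume "A \<in> sigma_sets K (sets (restrict_space borel K))"
    then have "A \<in> sets Q"
      using sets.sigma_sets_eq[of "restrict_space borel K"] Q by (simp add: space_restrict_space)
    then show "(SUP B\<in>{B \<in> sets (restrict_space borel K). B \<subseteq> A}. ennreal (\<nu> B)) = emeasure ?D A" by (rule val)
  qed
  also have "\<dots> = ?D"
    using measure_of_of_measure[of ?D] Q sp by simp
  finally show ?thesis .
qed

text \<open>The Jordan parts have the positive and the negative part of \<open>f\<close> as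
  densities, and the two integrals recombine.\<close>

lemma signed_integral_density:
  fixes f g :: "'k::metric_space \<Rightarrow> real"
  assumes Q: "sets Q = sets (restrict_space borel K)" and f: "integrable Q f"
    and \<nu>: "\<And>A. A \<in> sets (restrict_space borel K) \<Longrightarrow> \<nu> A = (\<integral>x. indicator A x * f x \<partial>Q)"
    and g: "g \<in> borel_measurable Q" and gf: "integrable Q (\<lambda>x. f x * g x)"
  shows "signed_integral K \<nu> g = (\<integral>x. f x * g x \<partial>Q)"
proof -
  note [measurable] = g
  have f_meas [measurable]: "f \<in> borel_measurable Q" using f by simp
  have "- \<nu> A = (\<integral>x. indicator A x * (- f x) \<partial>Q)" if "A \<in> sets (restrict_space borel K)" for A
    using \<nu>[OF that] by simp
  from positive_variation_density[OF Q _ this]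
  have neg: "positive_variation K (\<lambda>A. - \<nu> A) = density Q (\<lambda>x. ennreal (max (- f x) 0))"
    using f by simp
  have pos: "positive_variation K \<nu> = density Q (\<lambda>x. ennreal (max (f x) 0))"
    by (rule positive_variation_density[OF Q f \<nu>])
  have int: "integrable Q (\<lambda>x. max (f x) 0 * g x)" "integrable Q (\<lambda>x. max (- f x) 0 * g x)"
    by (rule Bochner_Integration.integrable_bound[OF gf]; auto simp: abs_mult intro!: AE_I2 mult_right_mono)+
  have "signed_integral K \<nu> g = (\<integral>x. max (f x) 0 *\<^sub>R g x \<partial>Q) - (\<integral>x. max (- f x) 0 *\<^sub>R g x \<partial>Q)"
    unfolding signed_integral_def pos neg by (intro arg_cong2[where f = "(-)"] integral_density g) auto
  also have "\<dots> = (\<integral>x. max (f x) 0 * g x - max (- f x) 0 * g x \<partial>Q)"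
    using int by simp
  also have "\<dots> = (\<integral>x. f x * g x \<partial>Q)"
    by (rule Bochner_Integration.integral_cong) (auto simp: max_def)
  finally show ?thesis .
qed

lemma real_density:
  fixes M N :: "'k measure"
  assumes M: "finite_measure M" and N: "finite_measure N" and ac: "absolutely_continuous M N" and s: "sets N = sets M"
  obtains f :: "'k \<Rightarrow> real" where "integrable M f" "\<And>x. 0 \<le> f x" "N = density M (\<lambda>x. ennreal (f x))"
proof -
  interpret M: finite_measure M by fact
  interpret N: finite_measure N by fact
  obtain f where f: "f \<in> borel_measurable M" "AE x in M. RN_deriv M N x = ennreal (f x)" "\<And>x. 0 \<le> f x"
    using M.real_RN_deriv[OF N ac s] by metis
  have d: "N = density M (\<lambda>x. ennreal (f x))"
    using M.density_RN_deriv[OF ac s] density_cong[OF borel_measurable_RN_deriv _ f(2)] f(1) by simp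
  have "(\<integral>\<^sup>+x. ennreal (f x) \<partial>M) = emeasure N (space M)"
    unfolding d by (subst emeasure_density) (use f(1) in \<open>auto intro!: nn_integral_cong\<close>)
  then have "(\<integral>\<^sup>+x. ennreal (f x) \<partial>M) < \<infinity>" by (simp add: less_top[symmetric])
  then have "integrable M f" by (intro integrableI_nonneg f(1)) (use f(3) in auto)
  then show thesis using that f(3) d by blast
qed

text \<open>\<open>N1 + N2\<close> dominates both measures, so that both have densities with respect
  to one measure.\<close>

lemma sum_measure:
  fixes N1 N2 :: "'k measure"
  assumes N: "finite_measure N1" "finite_measure N2" and s: "sets N2 = sets N1"
  obtains Q where "finite_measure Q" "sets Q = sets N1" "absolutely_continuous Q N1" "absolutely_continuous Q N2"
proof -
  define Q where "Q = measure_of (space N1) (sets N1) (\<lambda>A. emeasure N1 A + emeasure N2 A)"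
  have sets_Q: "sets Q = sets N1" unfolding Q_def by (rule sets.sets_measure_of_eq)
  have eQ: "emeasure Q A = emeasure N1 A + emeasure N2 A" if "A \<in> sets N1" for A
    unfolding Q_def
  proof (rule emeasure_measure_of_sigma[OF sets.sigma_algebra_axioms _ _ that])
    show "positive (sets N1) (\<lambda>A. emeasure N1 A + emeasure N2 A)" by (simp add: positive_def)
    show "countably_additive (sets N1) (\<lambda>A. emeasure N1 A + emeasure N2 A)"
    proof (rule countably_additiveI)
      fix A :: "nat \<Rightarrow> 'k set" assume A: "range A \<subseteq> sets N1" "disjoint_family A"
      have "(\<Sum>i. emeasure N1 (A i) + emeasure N2 (A i)) = (\<Sum>i. emeasure N1 (A i)) + (\<Sum>i. emeasure N2 (A i))"
        by (rule suminf_add[symmetric]) auto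
      also have "\<dots> = emeasure N1 (\<Union>i. A i) + emeasure N2 (\<Union>i. A i)"
        using A s by (simp add: suminf_emeasure)
      finally show "(\<Sum>i. emeasure N1 (A i) + emeasure N2 (A i)) = emeasure N1 (\<Union>i. A i) + emeasure N2 (\<Union>i. A i)" .
    qed
  qed
  have fin: "finite_measure Q"
    by (rule finite_measureI)
      (use eQ[of "space N1"] finite_measure.emeasure_finite[OF N(1)] finite_measure.emeasure_finite[OF N(2)]
        sets_eq_imp_space_eq[OF sets_Q] in \<open>simp add: ennreal_add_eq_top\<close>)
  have "absolutely_continuous Q N1" "absolutely_continuous Q N2"
    unfolding absolutely_continuous_def null_sets_def using eQ sets_Q s by auto
  with fin sets_Q show thesis by (rule that)
qed

text \<open>\<open>N1\<close> and \<open>N2\<close> may overlap and then differ from the Jordan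
  parts of their difference. With densities \<open>f1\<close> and \<open>f2\<close> for a common
  measure, the common mass cancels inside \<open>f1 - f2\<close>.\<close>

lemma signed_integral_difference:
  fixes N1 N2 :: "'k::metric_space measure" and g :: "'k \<Rightarrow> real"
  assumes N: "finite_measure N1" "finite_measure N2"
    and s: "sets N1 = sets (restrict_space borel K)" "sets N2 = sets (restrict_space borel K)"
    and g: "g \<in> borel_measurable (restrict_space borel K)" "\<And>x. x \<in> K \<Longrightarrow> \<bar>g x\<bar> \<le> C"
  shows "signed_integral K (\<lambda>A. measure N1 A - measure N2 A) g = (\<integral>x. g x \<partial>N1) - (\<integral>x. g x \<partial>N2)"
proof -
  obtain Q where Q: "finite_measure Q" "sets Q = sets N1" "absolutely_continuous Q N1" "absolutely_continuous Q N2"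
    using sum_measure[OF N] s by metis
  have sQ: "sets Q = sets (restrict_space borel K)" using Q(2) s(1) by simp
  have sp: "space Q = K" using sets_eq_imp_space_eq[OF sQ] by (simp add: space_restrict_space)
  obtain f1 where f1: "integrable Q f1" "\<And>x. 0 \<le> f1 x" "N1 = density Q (\<lambda>x. ennreal (f1 x))"
    using real_density[OF Q(1) N(1) Q(3)] s sQ by metis
  obtain f2 where f2: "integrable Q f2" "\<And>x. 0 \<le> f2 x" "N2 = density Q (\<lambda>x. ennreal (f2 x))"
    using real_density[OF Q(1) N(2) Q(4)] s sQ by metis
  have [measurable]: "f1 \<in> borel_measurable Q" "f2 \<in> borel_measurable Q" using f1 f2 by auto
  have g_meas [measurable]: "g \<in> borel_measurable Q" using g(1) measurable_cong_sets[OF sQ refl] by blast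
  have fg: "integrable Q (\<lambda>x. f x * g x)" if "integrable Q f" for f :: "'k \<Rightarrow> real"
  proof (rule Bochner_Integration.integrable_bound[of Q "\<lambda>x. \<bar>C\<bar> * f x"])
    show "(\<lambda>x. f x * g x) \<in> borel_measurable Q" using that by measurable
    show "AE x in Q. norm (f x * g x) \<le> norm (\<bar>C\<bar> * f x)"
    proof (rule AE_I2)
      fix x assume "x \<in> space Q"
      then have "\<bar>g x\<bar> \<le> \<bar>C\<bar>" using g(2)[of x] by (simp add: sp)
      then show "norm (f x * g x) \<le> norm (\<bar>C\<bar> * f x)"
        using mult_right_mono[of "\<bar>g x\<bar>" "\<bar>C\<bar>" "\<bar>f x\<bar>"] by (simp add: abs_mult mult.commute)
    qed
  qed (use that in simp)
  have m: "measure (density Q (\<lambda>x. ennreal (f x))) A = (\<integral>x. indicator A x * f x \<partial>Q)"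
    if f: "integrable Q f" "\<And>x. 0 \<le> f x" and A: "A \<in> sets Q" for f A
  proof -
    have [measurable]: "f \<in> borel_measurable Q" using f by simp
    have "emeasure (density Q (\<lambda>x. ennreal (f x))) A = (\<integral>\<^sup>+x. ennreal (indicator A x * f x) \<partial>Q)"
      using A by (subst emeasure_density) (auto intro!: nn_integral_cong simp: indicator_def)
    also have "\<dots> = ennreal (\<integral>x. indicator A x * f x \<partial>Q)"
      using integrable_mult_indicator[OF A f(1)] f(2) by (intro nn_integral_eq_integral) auto
    finally show ?thesis
      using f(2) by (simp add: measure_def integral_nonneg_AE)
  qed
  have "signed_integral K (\<lambda>A. measure N1 A - measure N2 A) g = (\<integral>x. (f1 x - f2 x) * g x \<partial>Q)"
  proof (rule signed_integral_density[OF sQ])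
    show "integrable Q (\<lambda>x. f1 x - f2 x)" using f1 f2 by simp
    show "integrable Q (\<lambda>x. (f1 x - f2 x) * g x)" using fg f1 f2 by simp
    fix A assume "A \<in> sets (restrict_space borel K)"
    then have A: "A \<in> sets Q" using sQ by simp
    show "measure N1 A - measure N2 A = (\<integral>x. indicator A x * (f1 x - f2 x) \<partial>Q)"
      unfolding f1(3) f2(3) m[OF f1(1,2) A] m[OF f2(1,2) A]
      using integrable_mult_indicator[OF A f1(1)] integrable_mult_indicator[OF A f2(1)]
      by (simp add: right_diff_distrib)
  qed (rule g_meas)
  also have "\<dots> = (\<integral>x. f1 x * g x \<partial>Q) - (\<integral>x. f2 x * g x \<partial>Q)"
    using fg f1 f2 by (simp add: left_diff_distrib)
  also have "\<dots> = (\<integral>x. g x \<partial>N1) - (\<integral>x. g x \<partial>N2)"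
    unfolding f1(3) f2(3) using f1(2) f2(2) by (simp add: integral_density)
  finally show ?thesis .
qed

lemma finite_variation_difference:
  assumes N: "finite_measure N1" "finite_measure N2"
    and s: "sets N1 = sets (restrict_space borel K)" "sets N2 = sets (restrict_space borel K)"
  shows "finite_variation_measure K (\<lambda>A. measure N1 A - measure N2 A)"
  unfolding finite_variation_measure_def
  using s finite_measure.finite_measure_UNION[OF N(1)] finite_measure.finite_measure_UNION[OF N(2)]
  by (auto intro!: sums_diff)

section \<open>Components of vector-valued harmonic functions\<close>

lemma le_one_plus_powr:
  fixes a q :: real
  assumes "0 \<le> a" "1 < q"
  shows "a \<le> 1 + a powr q"
proof (cases "a \<le> 1")
  case False
  then have "a powr 1 \<le> a powr q" using assms by (intro powr_mono) auto
  then show ?thesis using False by simp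
qed (simp add: add_increasing2)

lemma Lp_norm_mono:
  assumes p: "p \<noteq> \<infinity>"
    and le: "(\<integral>\<^sup>+x. ennreal (norm (f x) powr enn2real p) \<partial>M) \<le> (\<integral>\<^sup>+x. ennreal (norm (g x) powr enn2real p) \<partial>M)"
  shows "Lp_norm M p f \<le> Lp_norm M p g"
proof (cases "(\<integral>\<^sup>+x. ennreal (norm (g x) powr enn2real p) \<partial>M) = \<infinity>")
  case False
  then have g: "(\<integral>\<^sup>+x. ennreal (norm (g x) powr enn2real p) \<partial>M) < \<top>" by (simp add: less_top)
  then have f: "(\<integral>\<^sup>+x. ennreal (norm (f x) powr enn2real p) \<partial>M) \<noteq> \<infinity>" using le by auto
  have "enn2real (\<integral>\<^sup>+x. ennreal (norm (f x) powr enn2real p) \<partial>M) \<le> enn2real (\<integral>\<^sup>+x. ennreal (norm (g x) powr enn2real p) \<partial>M)"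
    by (rule enn2real_mono[OF le g])
  then show ?thesis
    using p f False by (simp add: Lp_norm_def Let_def ennreal_leI powr_mono2)
qed (use p in \<open>simp add: Lp_norm_def\<close>)

lemma Lp_norm_leD:
  assumes p: "p \<noteq> \<infinity>" "0 < p" and c: "0 \<le> c" and le: "Lp_norm M p f \<le> ennreal c"
  shows "(\<integral>\<^sup>+x. ennreal (norm (f x) powr enn2real p) \<partial>M) \<le> ennreal (c powr enn2real p)"
proof -
  let ?I = "\<integral>\<^sup>+x. ennreal (norm (f x) powr enn2real p) \<partial>M"
  have q: "0 < enn2real p" using p by (simp add: enn2real_positive_iff less_top)
  have I: "?I \<noteq> \<infinity>" using le p by (auto simp: Lp_norm_def top_unique)
  then have "ennreal (enn2real ?I powr (1 / enn2real p)) \<le> ennreal c" using le p by (simp add: Lp_norm_def Let_def)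
  then have "enn2real ?I powr (1 / enn2real p) \<le> c" using c by (simp add: ennreal_le_iff)
  then have "(enn2real ?I powr (1 / enn2real p)) powr enn2real p \<le> c powr enn2real p"
    using q by (intro powr_mono2) auto
  then have "enn2real ?I \<le> c powr enn2real p" using q by (simp add: powr_powr)
  then show ?thesis using I by (metis ennreal_enn2real ennreal_leI infinity_ennreal_def less_top)
qed

lemma Lp_norm_1: "Lp_norm M 1 f = (\<integral>\<^sup>+x. ennreal (norm (f x)) \<partial>M)"
  by (simp add: Lp_norm_def Let_def less_top)

lemma Lp_norm_infty_leD: "Lp_norm M \<infinity> f \<le> ennreal c \<Longrightarrow> 0 \<le> c \<Longrightarrow> AE x in M. norm (f x) \<le> c"
  using esssup_AE[of "\<lambda>x. ennreal (norm (f x))" M]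
  by (auto simp: Lp_norm_def elim!: eventually_mono) (metis ennreal_le_iff order_trans)

lemma Lp_norm_infty_leI:
  assumes "f \<in> borel_measurable M" "AE x in M. norm (f x) \<le> c"
  shows "Lp_norm M \<infinity> f \<le> ennreal c"
  unfolding Lp_norm_def using assms by (auto intro!: esssup_I elim!: eventually_mono ennreal_leI)

text \<open>The inner product is expanded in \<open>Basis\<close>. As all coordinate energies are
  nonnegative, each of them is bounded by the energy of the vector-valued function.\<close>

lemma energy_components:
  fixes u :: "'k \<Rightarrow> 'b::euclidean_space"
  shows "energy S F V0 D r m u = (\<Sum>b\<in>Basis. energy S F V0 D r m (\<lambda>x. u x \<bullet> b))"
proof -
  have "(\<Sum>p\<in>V0. \<Sum>q\<in>V0. D p q * (v p \<bullet> v q)) = (\<Sum>b\<in>Basis. \<Sum>p\<in>V0. \<Sum>q\<in>V0. D p q * ((v p \<bullet> b) * (v q \<bullet> b)))"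
    for v :: "'k \<Rightarrow> 'b"
  proof -
    have "(\<Sum>p\<in>V0. \<Sum>q\<in>V0. D p q * (v p \<bullet> v q)) =
        (\<Sum>p\<in>V0. \<Sum>q\<in>V0. \<Sum>b\<in>Basis. D p q * ((v p \<bullet> b) * (v q \<bullet> b)))"
      by (intro sum.cong refl) (subst euclidean_inner, simp add: sum_distrib_left)
    also have "\<dots> = (\<Sum>p\<in>V0. \<Sum>b\<in>Basis. \<Sum>q\<in>V0. D p q * ((v p \<bullet> b) * (v q \<bullet> b)))"
      by (intro sum.cong refl sum.swap)
    also have "\<dots> = (\<Sum>b\<in>Basis. \<Sum>p\<in>V0. \<Sum>q\<in>V0. D p q * ((v p \<bullet> b) * (v q \<bullet> b)))"
      by (rule sum.swap)
    finally show ?thesis .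
  qed
  then show ?thesis
    unfolding energy_def by (subst sum.swap) (simp add: sum_divide_distrib sum_negf)
qed

context fractal_structure
begin

lemma component_dom:
  fixes u :: "'k \<Rightarrow> 'b::{real_normed_field, euclidean_space}"
  assumes u: "u \<in> form_domain K S F V0 D r" and b: "b \<in> Basis"
  shows "(\<lambda>x. u x \<bullet> b) \<in> dom"
proof -
  have "continuous_on K u" "convergent (\<lambda>m. energy S F V0 D r m u)"
    using u by (simp_all add: form_domain_def)
  then obtain B where B: "\<And>m. energy S F V0 D r m u \<le> B"
    using convergent_imp_Bseq Bseq_def by (metis abs_le_D1 real_norm_def)
  show ?thesis
  proof (rule domI)
    show "continuous_on K (\<lambda>x. u x \<bullet> b)" using \<open>continuous_on K u\<close> by (intro continuous_intros)
    fix m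
    have "E m (\<lambda>x. u x \<bullet> b) (\<lambda>x. u x \<bullet> b) \<le> (\<Sum>b\<in>Basis. E m (\<lambda>x. u x \<bullet> b) (\<lambda>x. u x \<bullet> b))"
      by (rule member_le_sum[where f = "\<lambda>b. E m (\<lambda>x. u x \<bullet> b) (\<lambda>x. u x \<bullet> b)"]) (use b E_nonneg in auto)
    also have "\<dots> = energy S F V0 D r m u"
      unfolding energy_components[of S F V0 D r m u] energy_real ..
    finally show "E m (\<lambda>x. u x \<bullet> b) (\<lambda>x. u x \<bullet> b) \<le> B" using B[of m] by simp
  qed
qed

text \<open>\<open>of_real\<close> is isometric for the inner product, so a real test function keeps
  its energy when read as a scalar-valued one.\<close>

lemma of_real_dom0:
  assumes v: "v \<in> dom0"
  shows "(\<lambda>x. of_real (v x) :: 'b::{real_normed_field, euclidean_space}) \<in> form_domain0 K S F V0 D r"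
proof -
  have "of_real a \<bullet> (of_real b :: 'b) = a * b" for a b
    by (simp add: of_real_def dot_square_norm)
  then have "energy S F V0 D r m (\<lambda>x. of_real (v x) :: 'b) = energy S F V0 D r m v" for m
    unfolding energy_def by simp
  moreover have "convergent (\<lambda>m. energy S F V0 D r m v)" "continuous_on K v"
    using v by (auto simp: form_domain0_def form_domain_def)
  ultimately show ?thesis
    using dom0_D(2)[OF v] by (auto simp: form_domain0_def form_domain_def intro: continuous_intros)
qed

text \<open>Multiplication by \<open>of_real\<close> acts as real scaling, which commutes with
  taking coordinates.\<close>

lemma Em_component:
  fixes u :: "'k \<Rightarrow> 'b::{real_normed_field, euclidean_space}"
  shows "Em S F V0 D r m u (\<lambda>x. of_real (v x)) \<bullet> b = E m (\<lambda>x. u x \<bullet> b) v"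
proof -
  have 1: "x * of_real a * of_real c = (a * c) *\<^sub>R x" for x :: 'b and a c
    by (simp add: scaleR_conv_of_real mult_ac)
  show ?thesis
    unfolding Em_def E0_def o_def 1 by (simp add: inner_sum_left mult_ac)
qed

text \<open>A component of a vector-valued Laplacian is obtained by testing with real functions.\<close>

lemma component_lap:
  fixes u g :: "'k \<Rightarrow> 'b::{real_normed_field, euclidean_space}"
  assumes ug: "has_laplacian K S F V0 D r \<mu> u g" and b: "b \<in> Basis"
  shows "lap (\<lambda>x. u x \<bullet> b) (\<lambda>x. g x \<bullet> b)"
proof (rule lapI)
  have u: "u \<in> form_domain K S F V0 D r" and g: "continuous_on K g"
    and eq: "\<And>v. v \<in> form_domain0 K S F V0 D r \<Longrightarrow> dirichlet_form S F V0 D r u v = - (\<integral>x. g x * v x \<partial>\<mu>)"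
    using ug unfolding has_laplacian_def by blast+
  show "(\<lambda>x. u x \<bullet> b) \<in> dom" by (rule component_dom[OF u b])
  show "continuous_on K (\<lambda>x. g x \<bullet> b)" using g by (intro continuous_intros)
  fix v assume v: "v \<in> dom0"
  let ?v = "\<lambda>x. of_real (v x) :: 'b"
  have comp: "(\<lambda>m. Em S F V0 D r m u ?v \<bullet> b') \<longlonglongrightarrow> form (\<lambda>x. u x \<bullet> b') v" if "b' \<in> Basis" for b'
    unfolding Em_component by (rule E_tendsto[OF component_dom[OF u that] dom0_D(1)[OF v]])
  have "(\<lambda>m. \<Sum>b'\<in>Basis. (Em S F V0 D r m u ?v \<bullet> b') *\<^sub>R b') \<longlonglongrightarrow> (\<Sum>b'\<in>Basis. form (\<lambda>x. u x \<bullet> b') v *\<^sub>R b')"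
    by (intro tendsto_sum tendsto_scaleR comp tendsto_const)
  then have "dirichlet_form S F V0 D r u ?v = (\<Sum>b'\<in>Basis. form (\<lambda>x. u x \<bullet> b') v *\<^sub>R b')"
    unfolding dirichlet_form_def euclidean_representation by (rule limI)
  then have "form (\<lambda>x. u x \<bullet> b) v = dirichlet_form S F V0 D r u ?v \<bullet> b"
    using b by (simp add: inner_sum_left_Basis)
  also have "\<dots> = - ((\<integral>x. v x *\<^sub>R g x \<partial>\<mu>) \<bullet> b)"
    unfolding eq[OF of_real_dom0[OF v]] by (simp add: scaleR_conv_of_real mult.commute)
  also have "(\<integral>x. v x *\<^sub>R g x \<partial>\<mu>) \<bullet> b = (\<integral>x. (v x *\<^sub>R g x) \<bullet> b \<partial>\<mu>)"
    by (rule integral_inner_left[symmetric])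
      (intro continuous_integrable continuous_intros g dom_cont[OF dom0_D(1)[OF v]])
  finally show "form (\<lambda>x. u x \<bullet> b) v = - (\<integral>x. (g x \<bullet> b) * v x \<partial>\<mu>)"
    by (simp add: mult.commute)
qed

lemma component_harmonic:
  fixes u :: "real \<Rightarrow> 'k \<Rightarrow> 'b::{real_normed_field, euclidean_space}"
  assumes u: "dirichlet_harmonic_function K S F V0 D r \<mu> u" and b: "b \<in> Basis"
  shows "real_harmonic (\<lambda>t x. u t x \<bullet> b)"
proof -
  have cont: "continuous_on ({0<..} \<times> K) (\<lambda>(t, x). u t x)"
    and C2: "\<And>x. x \<in> K \<Longrightarrow> C2_on_positive (\<lambda>t. u t x)"
    and "\<forall>t>0. \<exists>g. has_laplacian K S F V0 D r \<mu> (u t) g \<and>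
        (\<forall>x\<in>K - V0. first_deriv (first_deriv (\<lambda>s. u s x)) t + g x = 0)"
    and V0: "\<And>t p. t > 0 \<Longrightarrow> p \<in> V0 \<Longrightarrow> u t p = 0"
    using u unfolding dirichlet_harmonic_function_def harmonic_function_def by blast+
  then obtain g where g: "\<And>t. t > 0 \<Longrightarrow> has_laplacian K S F V0 D r \<mu> (u t) (g t)"
    "\<And>t x. t > 0 \<Longrightarrow> x \<in> K - V0 \<Longrightarrow> first_deriv (first_deriv (\<lambda>s. u s x)) t + g t x = 0"
    by metis
  have deriv: "((\<lambda>s. f s \<bullet> b) has_real_derivative first_deriv f t \<bullet> b) (at t)"
    if "f differentiable (at t)" for f :: "real \<Rightarrow> 'b" and t
    using bounded_linear.has_vector_derivative[OF bounded_linear_inner_left, of f _ "at t" b] that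
    unfolding has_real_derivative_iff_has_vector_derivative first_deriv_def vector_derivative_works by blast
  show ?thesis
    unfolding real_harmonic_def
  proof (intro conjI allI impI ballI exI)
    show "continuous_on ({0<..} \<times> K) (\<lambda>(t, x). u t x \<bullet> b)"
      using cont unfolding case_prod_unfold by (intro continuous_intros)
    show "u t p \<bullet> b = 0" if "t > 0" "p \<in> V0" for t p using V0[OF that] by simp
    fix t :: real assume t: "t > 0"
    show "lap (\<lambda>x. u t x \<bullet> b) (\<lambda>x. g t x \<bullet> b)" by (rule component_lap[OF g(1)[OF t] b])
    fix x assume x: "x \<in> K - V0"
    then have c2: "C2_on_positive (\<lambda>t. u t x)" using C2 by blast
    show "((\<lambda>s. u s x \<bullet> b) has_real_derivative first_deriv (\<lambda>s. u s x) t \<bullet> b) (at t)"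
      by (rule deriv) (use c2 t in \<open>simp add: C2_on_positive_def\<close>)
    show "((\<lambda>s. first_deriv (\<lambda>s. u s x) s \<bullet> b) has_real_derivative
        first_deriv (first_deriv (\<lambda>s. u s x)) t \<bullet> b) (at t)"
      by (rule deriv) (use c2 t in \<open>simp add: C2_on_positive_def\<close>)
    show "first_deriv (first_deriv (\<lambda>s. u s x)) t \<bullet> b + g t x \<bullet> b = 0"
      using g(2)[OF t x] by (simp flip: inner_add_left)
  qed
qed

text \<open>For finite exponent \<open>q\<close> the excess over a level \<open>L\<close> is
  controlled by \<open>max (a - L) 0 \<le> a powr q * L powr (1 - q)\<close>, and the last factor is
  small for large \<open>L\<close>. The bounds depend on \<open>c\<close> and \<epsilon> but not on
  \<open>v\<close>, hence not on time later on.\<close>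

lemma Lp_uniform_integrable:
  assumes p: "1 < p" and c: "0 \<le> c"
  obtains M L where
    "\<And>v :: 'k \<Rightarrow> 'c::euclidean_space. continuous_on K v \<Longrightarrow> Lp_norm \<mu> p v \<le> ennreal c \<Longrightarrow> (\<integral>x. norm (v x) \<partial>\<mu>) \<le> M"
    "\<And>\<epsilon>. \<And>v :: 'k \<Rightarrow> 'c. \<epsilon> > 0 \<Longrightarrow> continuous_on K v \<Longrightarrow> Lp_norm \<mu> p v \<le> ennreal c \<Longrightarrow>
        (\<integral>x. max (norm (v x) - L \<epsilon>) 0 \<partial>\<mu>) \<le> \<epsilon>"
proof (cases "p = \<infinity>")
  case True
  show thesis
  \<comment> \<open>For infinite \<open>p\<close> the excess over the level \<open>c\<close>
    vanishes almost everywhere.\<close>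
  proof (rule that[of c "\<lambda>_. c"])
    fix v :: "'k \<Rightarrow> 'c" assume v: "continuous_on K v" "Lp_norm \<mu> p v \<le> ennreal c"
    have ae: "AE x in \<mu>. norm (v x) \<le> c" using Lp_norm_infty_leD v(2) c True by blast
    have int: "integrable \<mu> (\<lambda>x. norm (v x))" by (intro continuous_integrable continuous_intros v(1))
    have "(\<integral>x. norm (v x) \<partial>\<mu>) \<le> (\<integral>x. c \<partial>\<mu>)" by (rule integral_mono_AE[OF int _ ae]) simp
    then show "(\<integral>x. norm (v x) \<partial>\<mu>) \<le> c" by (simp add: prob_space)
    fix \<epsilon> :: real assume "\<epsilon> > 0"
    have "AE x in \<mu>. max (norm (v x) - c) 0 = 0" using ae by eventually_elim simp
    then show "(\<integral>x. max (norm (v x) - c) 0 \<partial>\<mu>) \<le> \<epsilon>"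
      using integral_eq_zero_AE[of "\<lambda>x. max (norm (v x) - c) 0" \<mu>] \<open>\<epsilon> > 0\<close> by simp
  qed
next
  case False
  define q where "q = enn2real p"
  have pq: "p = ennreal q" using False by (simp add: q_def less_top)
  have q: "q > 1" using p unfolding pq by (simp add: ennreal_less_iff flip: ennreal_1)
  have key: "integrable \<mu> (\<lambda>x. norm (v x) powr q) \<and> (\<integral>x. norm (v x) powr q \<partial>\<mu>) \<le> c powr q"
    if v: "continuous_on K v" "Lp_norm \<mu> p v \<le> ennreal c" for v :: "'k \<Rightarrow> 'c"
  proof -
    have cont: "continuous_on K (\<lambda>x. norm (v x) powr q)"
      by (rule continuous_on_powr') (use v(1) q in \<open>auto intro!: continuous_intros\<close>)
    then have int: "integrable \<mu> (\<lambda>x. norm (v x) powr q)" by (rule continuous_integrable)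
    have "ennreal (\<integral>x. norm (v x) powr q \<partial>\<mu>) = (\<integral>\<^sup>+x. ennreal (norm (v x) powr q) \<partial>\<mu>)"
      by (rule nn_integral_eq_integral[symmetric, OF int]) simp
    also have "\<dots> \<le> ennreal (c powr q)"
      using Lp_norm_leD[OF False _ c v(2)] p unfolding q_def by (meson order_less_trans zero_less_one)
    finally show ?thesis using int by (simp add: ennreal_le_iff)
  qed
  \<comment> \<open>The solution of \<open>L powr (1 - q) = \<epsilon> / (c powr q + 1)\<close>,
    which turns the bound \<open>c powr q\<close> into one below \<epsilon>.\<close>
  define L where "L \<epsilon> = ((c powr q + 1) / \<epsilon>) powr (1 / (q - 1))" for \<epsilon>
  show thesis
  proof (rule that[of "1 + c powr q" L])
    fix v :: "'k \<Rightarrow> 'c" assume v: "continuous_on K v" "Lp_norm \<mu> p v \<le> ennreal c"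
    note k = key[OF v]
    have int: "integrable \<mu> (\<lambda>x. norm (v x))" by (intro continuous_integrable continuous_intros v(1))
    have "(\<integral>x. norm (v x) \<partial>\<mu>) \<le> (\<integral>x. 1 + norm (v x) powr q \<partial>\<mu>)"
      by (rule integral_mono) (use int k q in \<open>auto intro: le_one_plus_powr\<close>)
    also have "\<dots> \<le> 1 + c powr q" using k by (simp add: prob_space)
    finally show "(\<integral>x. norm (v x) \<partial>\<mu>) \<le> 1 + c powr q" .
    fix \<epsilon> :: real assume \<epsilon>: "\<epsilon> > 0"
    have c1: "c powr q + 1 > 0" by (simp add: add_nonneg_pos)
    have L: "L \<epsilon> > 0" using c1 \<epsilon> by (simp add: L_def)
    have L_pow: "L \<epsilon> powr (1 - q) = \<epsilon> / (c powr q + 1)"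
    proof -
      have "L \<epsilon> powr (1 - q) = ((c powr q + 1) / \<epsilon>) powr (1 / (q - 1) * (1 - q))"
        unfolding L_def by (rule powr_powr)
      also have "1 / (q - 1) * (1 - q) = - 1" using q by (simp add: field_simps)
      finally show ?thesis using c1 \<epsilon> by (simp add: powr_minus)
    qed
    have pt: "max (norm (v x) - L \<epsilon>) 0 \<le> norm (v x) powr q * L \<epsilon> powr (1 - q)" for x
    proof (cases "norm (v x) \<le> L \<epsilon>")
      case False
      then have a: "norm (v x) > 0" using L by linarith
      have "norm (v x) powr (1 - q) \<le> L \<epsilon> powr (1 - q)"
        using False L q by (intro powr_mono2') auto
      then have "norm (v x) powr q * norm (v x) powr (1 - q) \<le> norm (v x) powr q * L \<epsilon> powr (1 - q)"
        by (rule mult_left_mono) simp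
      moreover have "norm (v x) powr q * norm (v x) powr (1 - q) = norm (v x)"
        using a by (simp flip: powr_add)
      ultimately show ?thesis using L False by simp
    qed simp
    have "(\<integral>x. max (norm (v x) - L \<epsilon>) 0 \<partial>\<mu>) \<le> (\<integral>x. norm (v x) powr q * L \<epsilon> powr (1 - q) \<partial>\<mu>)"
      by (rule integral_mono) (use int k pt in auto)
    also have "\<dots> = (\<integral>x. norm (v x) powr q \<partial>\<mu>) * L \<epsilon> powr (1 - q)" by simp
    also have "\<dots> \<le> c powr q * (\<epsilon> / (c powr q + 1))"
      unfolding L_pow using k c1 \<epsilon> by (intro mult_right_mono) auto
    also have "\<dots> \<le> \<epsilon>" using c1 \<epsilon> by (simp add: field_simps)
    finally show "(\<integral>x. max (norm (v x) - L \<epsilon>) 0 \<partial>\<mu>) \<le> \<epsilon>" .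
  qed
qed

end

context fractal_eigensystem
begin

text \<open>The coefficients of \<open>w\<close> at time \<open>\<tau> j\<close> tend to
  \<open>B n\<close> and also to the difference of the integrals of \<open>\<phi> n\<close> against
  \<open>N1\<close> and \<open>N2\<close>. So \<open>w\<close> and the kernel integrals have the
  same series.\<close>

lemma real_harmonic_limit_measures:
  assumes w: "real_harmonic w" and bd: "\<And>t. t > 0 \<Longrightarrow> (\<integral>x. \<bar>w t x\<bar> \<partial>\<mu>) \<le> M"
  obtains N1 N2 where "finite_measure N1" "sets N1 = sets (restrict_space borel K)"
    "finite_measure N2" "sets N2 = sets (restrict_space borel K)"
    "\<And>t x. t > 0 \<Longrightarrow> x \<in> K \<Longrightarrow> w t x = (\<integral>y. pk t x y \<partial>N1) - (\<integral>y. pk t x y \<partial>N2)"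
    "(\<And>\<epsilon>. \<epsilon> > 0 \<Longrightarrow> \<exists>L. \<forall>t>0. (\<integral>x. max (\<bar>w t x\<bar> - L) 0 \<partial>\<mu>) \<le> \<epsilon>) \<Longrightarrow>
        absolutely_continuous \<mu> N1 \<and> absolutely_continuous \<mu> N2"
proof -
  obtain B where B: "\<And>t n. t > 0 \<Longrightarrow> coeff (w t) n = decay t n * B n"
    "\<And>t x. t > 0 \<Longrightarrow> x \<in> K \<Longrightarrow> (\<lambda>n. decay t n * \<phi> n x * B n) sums w t x"
    using real_harmonic_expansion[OF w bd] by blast
  define \<tau> where "\<tau> j = inverse (real (Suc j))" for j
  have \<tau>: "\<tau> j > 0" for j by (simp add: \<tau>_def)
  \<comment> \<open>The sign \<sigma> selects the positive or the negative part; the summand 1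
    supplies the lower bound that \<open>weak_limit\<close> asks for.\<close>
  define h where "h \<sigma> j x = max (\<sigma> * w (\<tau> j) x) 0 + 1" for \<sigma> j x
  have w_cont: "continuous_on K (w (\<tau> j))" for j by (rule real_harmonicD(3)[OF w \<tau>])
  have h_cont: "continuous_on K (h \<sigma> j)" for \<sigma> j unfolding h_def by (intro continuous_intros w_cont)
  have h_ge: "1 \<le> h \<sigma> j x" for \<sigma> j x by (simp add: h_def)
  have w_int: "integrable \<mu> (\<lambda>x. \<bar>w (\<tau> j) x\<bar>)" for j by (intro continuous_integrable continuous_intros w_cont)
  have h_le: "h \<sigma> j x \<le> \<bar>w (\<tau> j) x\<bar> + 1" if "\<bar>\<sigma>\<bar> = 1" for \<sigma> j x
    using that by (auto simp: h_def abs_if split: if_splits)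
  have h_bd: "(\<integral>x. h \<sigma> j x \<partial>\<mu>) \<le> M + 1" if "\<bar>\<sigma>\<bar> = 1" for \<sigma> j
  proof -
    have "(\<integral>x. h \<sigma> j x \<partial>\<mu>) \<le> (\<integral>x. \<bar>w (\<tau> j) x\<bar> + 1 \<partial>\<mu>)"
      by (rule integral_mono) (use continuous_integrable[OF h_cont] w_int h_le[OF that] in auto)
    also have "\<dots> \<le> M + 1" using w_int bd[OF \<tau>] by (simp add: prob_space)
    finally show ?thesis .
  qed
  have UI: "\<exists>L. \<forall>j. (\<integral>x. max (h \<sigma> j x - L) 0 \<partial>\<mu>) \<le> \<epsilon>"
    if \<epsilon>: "\<epsilon> > 0" and \<sigma>: "\<bar>\<sigma>\<bar> = 1"
      and u: "\<And>\<epsilon>. \<epsilon> > 0 \<Longrightarrow> \<exists>L. \<forall>t>0. (\<integral>x. max (\<bar>w t x\<bar> - L) 0 \<partial>\<mu>) \<le> \<epsilon>" for \<epsilon> \<sigma>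
  proof -
    obtain L where L: "\<And>t. t > 0 \<Longrightarrow> (\<integral>x. max (\<bar>w t x\<bar> - L) 0 \<partial>\<mu>) \<le> \<epsilon>" using u[OF \<epsilon>] by blast
    have "(\<integral>x. max (h \<sigma> j x - (L + 1)) 0 \<partial>\<mu>) \<le> \<epsilon>" for j
    proof -
      have "(\<integral>x. max (h \<sigma> j x - (L + 1)) 0 \<partial>\<mu>) \<le> (\<integral>x. max (\<bar>w (\<tau> j) x\<bar> - L) 0 \<partial>\<mu>)"
      proof (rule integral_mono)
        show "max (h \<sigma> j x - (L + 1)) 0 \<le> max (\<bar>w (\<tau> j) x\<bar> - L) 0" for x
          using h_le[OF \<sigma>, of j x] by auto
      qed (intro continuous_integrable continuous_intros h_cont w_cont)+
      then show ?thesis using L[OF \<tau>, of j] by linarith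
    qed
    then show ?thesis by blast
  qed
  obtain s1 :: "nat \<Rightarrow> nat" and N1 where s1: "strict_mono s1" and N1: "finite_measure N1" "sets N1 = sets (restrict_space borel K)"
    and lim1: "\<And>\<psi> :: 'k \<Rightarrow> real. continuous_on K \<psi> \<Longrightarrow> (\<lambda>j. \<integral>x. \<psi> x * h 1 (s1 j) x \<partial>\<mu>) \<longlonglongrightarrow> (\<integral>x. \<psi> x \<partial>N1)"
    and ac1: "(\<And>\<epsilon>. \<epsilon> > 0 \<Longrightarrow> \<exists>L. \<forall>j. (\<integral>x. max (h 1 j x - L) 0 \<partial>\<mu>) \<le> \<epsilon>) \<Longrightarrow> absolutely_continuous \<mu> N1"
    by (rule weak_limit[of "h 1" "M + 1"]) (use h_cont h_ge h_bd[of 1] in auto)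
  \<comment> \<open>The second limit is extracted inside the first subsequence, so that both hold
    along the common times \<open>\<tau> (s1 (s2 j))\<close>.\<close>
  obtain s2 :: "nat \<Rightarrow> nat" and N2 where s2: "strict_mono s2" and N2: "finite_measure N2" "sets N2 = sets (restrict_space borel K)"
    and lim2: "\<And>\<psi> :: 'k \<Rightarrow> real. continuous_on K \<psi> \<Longrightarrow> (\<lambda>j. \<integral>x. \<psi> x * h (-1) (s1 (s2 j)) x \<partial>\<mu>) \<longlonglongrightarrow> (\<integral>x. \<psi> x \<partial>N2)"
    and ac2: "(\<And>\<epsilon>. \<epsilon> > 0 \<Longrightarrow> \<exists>L. \<forall>j. (\<integral>x. max (h (-1) (s1 j) x - L) 0 \<partial>\<mu>) \<le> \<epsilon>) \<Longrightarrow> absolutely_continuous \<mu> N2"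
    by (rule weak_limit[of "\<lambda>j. h (-1) (s1 j)" "M + 1"]) (use h_cont h_ge h_bd[of "-1"] in auto)
  have B_eq: "B n = (\<integral>x. \<phi> n x \<partial>N1) - (\<integral>x. \<phi> n x \<partial>N2)" for n
  proof -
    let ?s = "\<lambda>j. s1 (s2 j)"
    have l: "(\<lambda>j. (\<integral>x. \<phi> n x * h 1 (?s j) x \<partial>\<mu>) - (\<integral>x. \<phi> n x * h (-1) (?s j) x \<partial>\<mu>)) \<longlonglongrightarrow>
        (\<integral>x. \<phi> n x \<partial>N1) - (\<integral>x. \<phi> n x \<partial>N2)"
      using LIMSEQ_subseq_LIMSEQ[OF lim1[OF \<phi>_cont] s2] lim2[OF \<phi>_cont]
      by (intro tendsto_diff) (simp_all add: o_def)
    \<comment> \<open>The two summands 1 cancel, and positive minus negative part gives back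
      \<open>w\<close>.\<close>
    have eq: "(\<integral>x. \<phi> n x * h 1 j x \<partial>\<mu>) - (\<integral>x. \<phi> n x * h (-1) j x \<partial>\<mu>) = decay (\<tau> j) n * B n" for j
    proof -
      have "(\<integral>x. \<phi> n x * h 1 j x \<partial>\<mu>) - (\<integral>x. \<phi> n x * h (-1) j x \<partial>\<mu>) =
          (\<integral>x. \<phi> n x * h 1 j x - \<phi> n x * h (-1) j x \<partial>\<mu>)"
        by (rule Bochner_Integration.integral_diff[symmetric])
          (intro continuous_integrable continuous_intros \<phi>_cont h_cont)+
      also have "\<dots> = (\<integral>x. w (\<tau> j) x * \<phi> n x \<partial>\<mu>)"
        by (rule Bochner_Integration.integral_cong[OF refl]) (auto simp: h_def max_def algebra_simps)
      also have "\<dots> = decay (\<tau> j) n * B n" using B(1)[OF \<tau>] by (simp add: coeff_def)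
      finally show ?thesis .
    qed
    have "(\<lambda>j. decay (\<tau> j) n * B n) \<longlonglongrightarrow> exp (- sqrt (lam n) * 0) * B n"
      unfolding decay_def \<tau>_def by (intro tendsto_intros LIMSEQ_inverse_real_of_nat)
    then have "(\<lambda>j. decay (\<tau> (?s j)) n * B n) \<longlonglongrightarrow> B n"
      using LIMSEQ_subseq_LIMSEQ[OF _ strict_mono_o[OF s1 s2]] by (fastforce simp: o_def)
    with l show ?thesis unfolding eq by (rule LIMSEQ_unique[rotated])
  qed
  show thesis
  proof (rule that[OF N1 N2])
    fix t x assume t: "(t::real) > 0" and x: "x \<in> K"
    \<comment> \<open>The kernel expansion with the constant function 1 in place of
      \<open>h\<close>, once for each limit measure.\<close>
    have "(\<lambda>n. decay t n * \<phi> n x * (\<integral>y. 1 * \<phi> n y \<partial>N1) - decay t n * \<phi> n x * (\<integral>y. 1 * \<phi> n y \<partial>N2)) sums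
        ((\<integral>y. pk t x y * 1 \<partial>N1) - (\<integral>y. pk t x y * 1 \<partial>N2))"
      by (intro sums_diff pk_integral_sums t x N1 N2 finite_measure.integrable_const)
    then have "(\<lambda>n. decay t n * \<phi> n x * B n) sums ((\<integral>y. pk t x y \<partial>N1) - (\<integral>y. pk t x y \<partial>N2))"
      by (simp add: B_eq right_diff_distrib)
    with B(2)[OF t x] show "w t x = (\<integral>y. pk t x y \<partial>N1) - (\<integral>y. pk t x y \<partial>N2)" by (rule sums_unique2)
  next
    assume u: "\<And>\<epsilon>. \<epsilon> > 0 \<Longrightarrow> \<exists>L. \<forall>t>0. (\<integral>x. max (\<bar>w t x\<bar> - L) 0 \<partial>\<mu>) \<le> \<epsilon>"
    have "absolutely_continuous \<mu> N1" by (rule ac1) (rule UI[OF _ _ u], auto)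
    moreover have "absolutely_continuous \<mu> N2"
    proof (rule ac2)
      fix \<epsilon> :: real assume "\<epsilon> > 0"
      then have "\<exists>L. \<forall>j. (\<integral>x. max (h (-1) j x - L) 0 \<partial>\<mu>) \<le> \<epsilon>" by (rule UI[OF _ _ u]) simp
      then show "\<exists>L. \<forall>j. (\<integral>x. max (h (-1) (s1 j) x - L) 0 \<partial>\<mu>) \<le> \<epsilon>" by blast
    qed
    ultimately show "absolutely_continuous \<mu> N1 \<and> absolutely_continuous \<mu> N2" by blast
  qed
qed

text \<open>Uniform integrability makes both limit measures absolutely continuous; the boundary
  function is the difference of their densities.\<close>

lemma real_harmonic_density:
  assumes w: "real_harmonic w" and bd: "\<And>t. t > 0 \<Longrightarrow> (\<integral>x. \<bar>w t x\<bar> \<partial>\<mu>) \<le> M"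
    and UI: "\<And>\<epsilon>. \<epsilon> > 0 \<Longrightarrow> \<exists>L. \<forall>t>0. (\<integral>x. max (\<bar>w t x\<bar> - L) 0 \<partial>\<mu>) \<le> \<epsilon>"
  obtains f where "integrable \<mu> f" "\<And>t x. t > 0 \<Longrightarrow> x \<in> K \<Longrightarrow> w t x = PI f t x"
proof -
  obtain N1 N2 where N1: "finite_measure N1" "sets N1 = sets (restrict_space borel K)"
    and N2: "finite_measure N2" "sets N2 = sets (restrict_space borel K)"
    and eq: "\<And>t x. t > 0 \<Longrightarrow> x \<in> K \<Longrightarrow> w t x = (\<integral>y. pk t x y \<partial>N1) - (\<integral>y. pk t x y \<partial>N2)"
    and ac: "absolutely_continuous \<mu> N1" "absolutely_continuous \<mu> N2"
    using real_harmonic_limit_measures[OF w bd] UI by metis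
  obtain f1 where f1: "integrable \<mu> f1" "\<And>x. 0 \<le> f1 x" "N1 = density \<mu> (\<lambda>x. ennreal (f1 x))"
    using real_density[OF finite_measure_axioms N1(1) ac(1)] N1(2) sets_\<mu> by metis
  obtain f2 where f2: "integrable \<mu> f2" "\<And>x. 0 \<le> f2 x" "N2 = density \<mu> (\<lambda>x. ennreal (f2 x))"
    using real_density[OF finite_measure_axioms N2(1) ac(2)] N2(2) sets_\<mu> by metis
  show thesis
  proof (rule that[of "\<lambda>x. f1 x - f2 x"])
    show "integrable \<mu> (\<lambda>x. f1 x - f2 x)" using f1 f2 by simp
    fix t x assume t: "(t::real) > 0" and x: "x \<in> K"
    have d: "(\<integral>y. pk t x y \<partial>density \<mu> (\<lambda>x. ennreal (f x))) = (\<integral>y. pk t x y * f y \<partial>\<mu>)"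
      if "integrable \<mu> f" "\<And>x. 0 \<le> f x" for f
      using that pk_measurable[OF sets_\<mu>, of t x] by (subst integral_density) (auto simp: mult.commute)
    have "integrable \<mu> (\<lambda>y. pk t x y * f1 y)" "integrable \<mu> (\<lambda>y. pk t x y * f2 y)"
      using pk_integrable[OF sets_\<mu> t x f1(1)] pk_integrable[OF sets_\<mu> t x f2(1)] by auto
    then show "w t x = PI (\<lambda>x. f1 x - f2 x) t x"
      unfolding eq[OF t x] f1(3) f2(3) d[OF f1(1,2)] d[OF f2(1,2)]
      by (simp add: PI_real right_diff_distrib)
  qed
qed

end

section \<open>The representation theorem\<close>

context fractal_eigensystem
begin

lemma harmonic_cont:
  fixes u :: "real \<Rightarrow> 'k \<Rightarrow> 'b::{real_normed_field, euclidean_space}"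
  assumes "dirichlet_harmonic_function K S F V0 D r \<mu> u" "t > 0"
  shows "continuous_on K (u t)"
  using assms
  unfolding dirichlet_harmonic_function_def harmonic_function_def has_laplacian_def form_domain_def by blast

lemma Lp_norm_cong:
  fixes f g :: "'k \<Rightarrow> 'b::real_normed_vector"
  assumes "f \<in> borel_measurable \<mu>" "g \<in> borel_measurable \<mu>" "\<And>x. x \<in> K \<Longrightarrow> f x = g x"
  shows "Lp_norm \<mu> p f = Lp_norm \<mu> p g"
proof -
  have "(\<integral>\<^sup>+x. ennreal (norm (f x) powr enn2real p) \<partial>\<mu>) = (\<integral>\<^sup>+x. ennreal (norm (g x) powr enn2real p) \<partial>\<mu>)"
    by (rule nn_integral_cong) (simp add: space_\<mu> assms(3))
  moreover have "esssup \<mu> (\<lambda>x. ennreal (norm (f x))) = esssup \<mu> (\<lambda>x. ennreal (norm (g x)))"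
    by (rule esssup_AE_cong) (use assms in \<open>auto simp: space_\<mu>\<close>)
  ultimately show ?thesis by (simp add: Lp_norm_def)
qed

text \<open>For infinite \<open>p\<close> the kernel mass bound applies directly. For finite
  \<open>p\<close> integrability of \<open>f\<close> comes first, from
  \<open>norm (f x) \<le> 1 + norm (f x) powr q\<close>, and then \<open>PI_contraction\<close>
  applies.\<close>

lemma Lp_norm_PI_le:
  fixes f :: "'k \<Rightarrow> 'b::euclidean_space"
  assumes p: "1 < p" and f: "f \<in> Lp_space \<mu> p" and t: "t > 0"
  shows "Lp_norm \<mu> p (PI f t) \<le> Lp_norm \<mu> p f"
proof (cases "p = \<infinity>")
  case True
  have meas: "f \<in> borel_measurable \<mu>" and fin: "Lp_norm \<mu> p f < \<infinity>" using f by (auto simp: Lp_space_def)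
  obtain c where c: "0 \<le> c" "Lp_norm \<mu> p f = ennreal c"
    using fin by (cases "Lp_norm \<mu> p f") auto
  have ae: "AE x in \<mu>. norm (f x) \<le> c" using Lp_norm_infty_leD[of \<mu> f c] c True by simp
  have int: "integrable \<mu> f" by (rule integrable_const_bound[OF ae meas])
  have "Lp_norm \<mu> \<infinity> (PI f t) \<le> ennreal c"
  proof (rule Lp_norm_infty_leI[OF PI_measurable[OF meas]])
    show "AE x in \<mu>. norm (PI f t x) \<le> c"
    proof (rule AE_I2)
      fix x assume "x \<in> space \<mu>"
      then have x: "x \<in> K" by (simp add: space_\<mu>)
      have "norm (PI f t x) \<le> (\<integral>y. \<bar>pk t x y\<bar> * norm (f y) \<partial>\<mu>)" by (rule norm_PI_le[OF int t x])
      also have "\<dots> \<le> (\<integral>y. \<bar>pk t x y\<bar> * c \<partial>\<mu>)"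
      proof (rule integral_mono_AE)
        show "integrable \<mu> (\<lambda>y. \<bar>pk t x y\<bar> * norm (f y))"
          using integrable_abs_pk_mult[OF integrable_norm[OF int] t x] by simp
        show "integrable \<mu> (\<lambda>y. \<bar>pk t x y\<bar> * c)" using integrable_pk[OF t x] by simp
        show "AE y in \<mu>. \<bar>pk t x y\<bar> * norm (f y) \<le> \<bar>pk t x y\<bar> * c"
          using ae by eventually_elim (rule mult_left_mono, auto)
      qed
      also have "\<dots> = (\<integral>y. \<bar>pk t x y\<bar> \<partial>\<mu>) * c" by simp
      also have "\<dots> \<le> 1 * c" by (rule mult_right_mono[OF integral_abs_pk_le[OF t x] c(1)])
      finally show "norm (PI f t x) \<le> c" by simp
    qed
  qed
  then show ?thesis using True c by simp
next
  case False
  define q where "q = enn2real p"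
  have pq: "p = ennreal q" using False by (simp add: q_def less_top)
  have q: "q > 1" using p unfolding pq by (simp add: ennreal_less_iff flip: ennreal_1)
  have meas [measurable]: "f \<in> borel_measurable \<mu>" and fin: "Lp_norm \<mu> p f < \<infinity>" using f by (auto simp: Lp_space_def)
  have "(\<integral>\<^sup>+x. ennreal (norm (f x) powr q) \<partial>\<mu>) \<noteq> \<infinity>"
    using fin False by (auto simp: Lp_norm_def q_def)
  then have fq: "integrable \<mu> (\<lambda>x. norm (f x) powr q)"
    by (intro integrableI_nonneg) (auto simp: less_top)
  have int: "integrable \<mu> f"
  proof (rule Bochner_Integration.integrable_bound)
    show "integrable \<mu> (\<lambda>x. 1 + norm (f x) powr q)" using fq by simp
    show "AE x in \<mu>. norm (f x) \<le> norm (1 + norm (f x) powr q)"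
      using le_one_plus_powr[OF norm_ge_zero q] by (intro AE_I2) simp
  qed (rule meas)
  show ?thesis
    by (rule Lp_norm_mono[OF False]) (use PI_contraction[OF int t, of q] q in \<open>simp add: q_def\<close>)
qed

lemma poisson_integral_Lp_iff:
  fixes u :: "real \<Rightarrow> 'k \<Rightarrow> 'b::{real_normed_field, euclidean_space}"
  assumes u: "dirichlet_harmonic_function K S F V0 D r \<mu> u" and p: "1 < p"
  shows "(\<exists>f \<in> Lp_space \<mu> p. \<forall>t>0. \<forall>x\<in>K. u t x = PI f t x) \<longleftrightarrow> (SUP t\<in>{0<..}. Lp_norm \<mu> p (u t)) < \<infinity>"
proof
  assume "\<exists>f \<in> Lp_space \<mu> p. \<forall>t>0. \<forall>x\<in>K. u t x = PI f t x"
  then obtain f where f: "f \<in> Lp_space \<mu> p" "\<And>t x. t > 0 \<Longrightarrow> x \<in> K \<Longrightarrow> u t x = PI f t x" by blast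
  have "(SUP t\<in>{0<..}. Lp_norm \<mu> p (u t)) \<le> Lp_norm \<mu> p f"
  proof (rule SUP_least)
    fix t :: real assume "t \<in> {0<..}"
    then have t: "t > 0" by simp
    have "Lp_norm \<mu> p (u t) = Lp_norm \<mu> p (PI f t)"
      by (rule Lp_norm_cong[OF continuous_measurable[OF harmonic_cont[OF u t]] PI_measurable f(2)[OF t]])
        (use f(1) in \<open>simp add: Lp_space_def\<close>)
    also have "\<dots> \<le> Lp_norm \<mu> p f" by (rule Lp_norm_PI_le[OF p f(1) t])
    finally show "Lp_norm \<mu> p (u t) \<le> Lp_norm \<mu> p f" .
  qed
  also have "\<dots> < \<infinity>" using f(1) by (simp add: Lp_space_def)
  finally show "(SUP t\<in>{0<..}. Lp_norm \<mu> p (u t)) < \<infinity>" .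
next
  assume "(SUP t\<in>{0<..}. Lp_norm \<mu> p (u t)) < \<infinity>"
  then obtain c where c: "0 \<le> c" "(SUP t\<in>{0<..}. Lp_norm \<mu> p (u t)) = ennreal c"
    by (cases "SUP t\<in>{0<..}. Lp_norm \<mu> p (u t)") auto
  have u_le: "Lp_norm \<mu> p (u t) \<le> ennreal c" if "t > 0" for t
    unfolding c(2)[symmetric] using that by (intro SUP_upper) simp
  note u_cont = harmonic_cont[OF u]
  obtain M L where M: "\<And>v :: 'k \<Rightarrow> 'b. continuous_on K v \<Longrightarrow> Lp_norm \<mu> p v \<le> ennreal c \<Longrightarrow> (\<integral>x. norm (v x) \<partial>\<mu>) \<le> M"
    and L: "\<And>\<epsilon>. \<And>v :: 'k \<Rightarrow> 'b. \<epsilon> > 0 \<Longrightarrow> continuous_on K v \<Longrightarrow> Lp_norm \<mu> p v \<le> ennreal c \<Longrightarrow>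
        (\<integral>x. max (norm (v x) - L \<epsilon>) 0 \<partial>\<mu>) \<le> \<epsilon>"
    using Lp_uniform_integrable[OF p c(1), where ?'c = 'b] by blast
  have "\<exists>f. integrable \<mu> f \<and> (\<forall>t>0. \<forall>x\<in>K. u t x \<bullet> b = PI f t x)" if b: "b \<in> Basis" for b
  proof -
    have comp_le: "\<bar>u t x \<bullet> b\<bar> \<le> norm (u t x)" for t x by (rule Basis_le_norm[OF b])
    have le_M: "(\<integral>x. \<bar>u t x \<bullet> b\<bar> \<partial>\<mu>) \<le> M" if t: "t > 0" for t
    proof -
      have "(\<integral>x. \<bar>u t x \<bullet> b\<bar> \<partial>\<mu>) \<le> (\<integral>x. norm (u t x) \<partial>\<mu>)"
        by (rule integral_mono)
          (use comp_le in \<open>auto intro!: continuous_integrable continuous_intros u_cont[OF t]\<close>)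
      then show ?thesis using M[OF u_cont[OF t] u_le[OF t]] by linarith
    qed
    have UI: "\<exists>L. \<forall>t>0. (\<integral>x. max (\<bar>u t x \<bullet> b\<bar> - L) 0 \<partial>\<mu>) \<le> \<epsilon>" if \<epsilon>: "\<epsilon> > 0" for \<epsilon>
    proof (intro exI[of _ "L \<epsilon>"] allI impI)
      fix t :: real assume t: "t > 0"
      have "(\<integral>x. max (\<bar>u t x \<bullet> b\<bar> - L \<epsilon>) 0 \<partial>\<mu>) \<le> (\<integral>x. max (norm (u t x) - L \<epsilon>) 0 \<partial>\<mu>)"
      proof (rule integral_mono)
        show "max (\<bar>u t x \<bullet> b\<bar> - L \<epsilon>) 0 \<le> max (norm (u t x) - L \<epsilon>) 0" for x
          using comp_le[of t x] by auto
      qed (intro continuous_integrable continuous_intros u_cont[OF t])+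
      then show "(\<integral>x. max (\<bar>u t x \<bullet> b\<bar> - L \<epsilon>) 0 \<partial>\<mu>) \<le> \<epsilon>"
        using L[OF \<epsilon> u_cont[OF t] u_le[OF t]] by linarith
    qed
    obtain f where "integrable \<mu> f" "\<And>t x. t > 0 \<Longrightarrow> x \<in> K \<Longrightarrow> u t x \<bullet> b = PI f t x"
      by (rule real_harmonic_density[OF component_harmonic[OF u b] le_M UI]) blast+
    then show ?thesis by blast
  qed
  then obtain fb where fb: "\<And>b. b \<in> Basis \<Longrightarrow> integrable \<mu> (fb b)"
      "\<And>b t x. b \<in> Basis \<Longrightarrow> t > 0 \<Longrightarrow> x \<in> K \<Longrightarrow> u t x \<bullet> b = PI (fb b) t x"
    by metis
  define f :: "'k \<Rightarrow> 'b" where "f x = (\<Sum>b\<in>Basis. fb b x *\<^sub>R b)" for x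
  have f_int: "integrable \<mu> f" unfolding f_def using fb(1) by (intro Bochner_Integration.integrable_sum) simp
  then have f_meas [measurable]: "f \<in> borel_measurable \<mu>" by simp
  have uf: "u t x = PI f t x" if t: "t > 0" and x: "x \<in> K" for t x
  proof (rule euclidean_eqI)
    fix b :: 'b assume b: "b \<in> Basis"
    have "PI f t x \<bullet> b = PI (\<lambda>y. f y \<bullet> b) t x" by (rule PI_inner[OF f_int t x])
    also have "(\<lambda>y. f y \<bullet> b) = fb b" using b by (simp add: f_def inner_sum_left_Basis)
    finally show "u t x \<bullet> b = PI f t x \<bullet> b" using fb(2)[OF b t x] by simp
  qed
  \<comment> \<open>At times tending to 0 the functions \<open>u t\<close> recover \<open>f\<close>
    almost everywhere, so the bounds on \<open>u\<close> can be passed to \<open>f\<close>.\<close>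
  obtain k :: "nat \<Rightarrow> nat" where k: "AE x in \<mu>. (\<lambda>j. PI f (inverse (real (Suc (k j)))) x) \<longlonglongrightarrow> f x"
    using PI_AE_subseq[OF f_int] by blast
  define \<tau> where "\<tau> j = inverse (real (Suc (k j)))" for j
  have \<tau>: "\<tau> j > 0" for j by (simp add: \<tau>_def)
  have lim: "AE x in \<mu>. (\<lambda>j. u (\<tau> j) x) \<longlonglongrightarrow> f x"
    using k AE_space
  proof eventually_elim
    case (elim x)
    then show ?case using uf[OF \<tau>, of x] by (simp add: \<tau>_def space_\<mu>)
  qed
  have "Lp_norm \<mu> p f < \<infinity>"
  proof (cases "p = \<infinity>")
    case True
    have "AE x in \<mu>. \<forall>j. norm (u (\<tau> j) x) \<le> c"
      using Lp_norm_infty_leD[of \<mu> "u (\<tau> _)" c] u_le[OF \<tau>] c(1) True by (simp add: AE_all_countable)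
    with lim have "AE x in \<mu>. norm (f x) \<le> c"
    proof eventually_elim
      case (elim x)
      then show ?case by (intro LIMSEQ_le_const2[OF tendsto_norm[OF elim(1)]]) blast
    qed
    then have "Lp_norm \<mu> p f \<le> ennreal c" unfolding True by (rule Lp_norm_infty_leI[OF f_meas])
    then show ?thesis by (simp add: le_less_trans)
  next
    case False
    define q where "q = enn2real p"
    have pq: "p = ennreal q" using False by (simp add: q_def less_top)
    have q: "q > 1" using p unfolding pq by (simp add: ennreal_less_iff flip: ennreal_1)
    have u_meas [measurable]: "u (\<tau> j) \<in> borel_measurable \<mu>" for j
      by (rule continuous_measurable[OF u_cont[OF \<tau>]])
    have "(\<integral>\<^sup>+x. ennreal (norm (f x) powr q) \<partial>\<mu>) = (\<integral>\<^sup>+x. liminf (\<lambda>j. ennreal (norm (u (\<tau> j) x) powr q)) \<partial>\<mu>)"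
    proof (rule nn_integral_cong_AE)
      show "AE x in \<mu>. ennreal (norm (f x) powr q) = liminf (\<lambda>j. ennreal (norm (u (\<tau> j) x) powr q))"
        using lim
      proof eventually_elim
        case (elim x)
        have "(\<lambda>j. ennreal (norm (u (\<tau> j) x) powr q)) \<longlonglongrightarrow> ennreal (norm (f x) powr q)"
          by (intro tendsto_ennrealI tendsto_powr' tendsto_norm[OF elim] tendsto_const) (use q in auto)
        then show ?case by (rule lim_imp_Liminf[symmetric, rotated]) simp
      qed
    qed
    also have "\<dots> \<le> liminf (\<lambda>j. \<integral>\<^sup>+x. ennreal (norm (u (\<tau> j) x) powr q) \<partial>\<mu>)"
      by (rule nn_integral_liminf) measurable
    also have "\<dots> \<le> ennreal (c powr q)"
    proof (rule Liminf_le)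
      show "\<forall>\<^sub>F j in sequentially. (\<integral>\<^sup>+x. ennreal (norm (u (\<tau> j) x) powr q) \<partial>\<mu>) \<le> ennreal (c powr q)"
        using Lp_norm_leD[OF False _ c(1) u_le[OF \<tau>]] p unfolding q_def
        by (intro always_eventually allI) (meson order_less_trans zero_less_one)
    qed simp
    finally have "(\<integral>\<^sup>+x. ennreal (norm (f x) powr q) \<partial>\<mu>) \<noteq> \<infinity>" by (auto simp: top_unique)
    then show ?thesis using False by (simp add: Lp_norm_def Let_def q_def)
  qed
  then have "f \<in> Lp_space \<mu> p" by (simp add: Lp_space_def)
  then show "\<exists>f \<in> Lp_space \<mu> p. \<forall>t>0. \<forall>x\<in>K. u t x = PI f t x" using uf by blast
qed

section \<open>Poisson integrals of measures\<close>

lemma abs_signed_integral_pk_le: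
  assumes \<nu>: "finite_variation_measure K \<nu>" and t: "t > 0" and x: "x \<in> K"
  shows "ennreal \<bar>signed_integral K \<nu> (pk t x)\<bar> \<le>
    (\<integral>\<^sup>+y. ennreal \<bar>pk t x y\<bar> \<partial>positive_variation K \<nu>) + (\<integral>\<^sup>+y. ennreal \<bar>pk t x y\<bar> \<partial>positive_variation K (\<lambda>A. - \<nu> A))"
proof -
  let ?N1 = "positive_variation K \<nu>" and ?N2 = "positive_variation K (\<lambda>A. - \<nu> A)"
  have fin: "finite_measure ?N1" "finite_measure ?N2"
    using finite_positive_variation \<nu> finite_variation_uminus by blast+
  have le: "ennreal \<bar>\<integral>y. pk t x y \<partial>N\<bar> \<le> (\<integral>\<^sup>+y. ennreal \<bar>pk t x y\<bar> \<partial>N)"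
    if "finite_measure N" "sets N = sets (restrict_space borel K)" for N
    using integral_norm_bound_ennreal[of N "pk t x"]
      pk_integrable[OF that(2) t x finite_measure.integrable_const[OF that(1), of "1::real"]] by simp
  have "\<bar>signed_integral K \<nu> (pk t x)\<bar> \<le> \<bar>\<integral>y. pk t x y \<partial>?N1\<bar> + \<bar>\<integral>y. pk t x y \<partial>?N2\<bar>"
    unfolding signed_integral_def by (rule abs_triangle_ineq4)
  then have "ennreal \<bar>signed_integral K \<nu> (pk t x)\<bar> \<le> ennreal \<bar>\<integral>y. pk t x y \<partial>?N1\<bar> + ennreal \<bar>\<integral>y. pk t x y \<partial>?N2\<bar>"
    by (simp add: ennreal_leI flip: ennreal_plus)
  also have "\<dots> \<le> (\<integral>\<^sup>+y. ennreal \<bar>pk t x y\<bar> \<partial>?N1) + (\<integral>\<^sup>+y. ennreal \<bar>pk t x y\<bar> \<partial>?N2)"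
    by (intro add_mono le fin sets_positive_variation)
  finally show ?thesis .
qed

text \<open>Each coordinate contributes its positive and its negative variation; integrating the
  kernel in \<open>x\<close> by the Schur bound leaves a right side that is finite and free of
  \<open>t\<close>.\<close>

lemma poisson_integral_measure_L1_le:
  fixes \<nu> :: "'k set \<Rightarrow> 'b::euclidean_space"
  assumes \<nu>: "finite_variation_measure K \<nu>" and t: "t > 0"
  shows "(\<integral>\<^sup>+x. ennreal (norm (poisson_integral_measure K lam \<phi> \<nu> t x)) \<partial>\<mu>) \<le>
    (\<Sum>b\<in>Basis. emeasure (positive_variation K (\<lambda>A. \<nu> A \<bullet> b)) K + emeasure (positive_variation K (\<lambda>A. - (\<nu> A \<bullet> b))) K)"
proof -
  let ?N1 = "\<lambda>b. positive_variation K (\<lambda>A. \<nu> A \<bullet> b)" and ?N2 = "\<lambda>b. positive_variation K (\<lambda>A. - (\<nu> A \<bullet> b))"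
  have fv: "finite_variation_measure K (\<lambda>A. \<nu> A \<bullet> b)" for b by (rule finite_variation_inner[OF \<nu>])
  have fin: "finite_measure (?N1 b)" "finite_measure (?N2 b)" for b
    using finite_positive_variation fv finite_variation_uminus by blast+
  let ?J = "\<lambda>N x. \<integral>\<^sup>+y. ennreal \<bar>pk t x y\<bar> \<partial>N"
  have J_meas: "?J N \<in> borel_measurable \<mu>" if N: "finite_measure N" "sets N = sets (restrict_space borel K)" for N
  proof -
    interpret N: finite_measure N by fact
    have [measurable]: "(\<lambda>(x, y). pk t x y) \<in> borel_measurable (\<mu> \<Otimes>\<^sub>M N)"
      by (rule pk_measurable_pair[OF sets_\<mu> N(2)])
    show ?thesis by measurable
  qed
  have J_le: "(\<integral>\<^sup>+x. ?J N x \<partial>\<mu>) \<le> emeasure N K" if N: "finite_measure N" "sets N = sets (restrict_space borel K)" for N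
  proof -
    have "space N = K" using sets_eq_imp_space_eq[OF N(2)] by (simp add: space_restrict_space)
    then show ?thesis using nn_integral_kernel_le[OF N(2,1) t, of "\<lambda>_. 1"] by simp
  qed
  have "(\<integral>\<^sup>+x. ennreal (norm (poisson_integral_measure K lam \<phi> \<nu> t x)) \<partial>\<mu>) \<le>
      (\<integral>\<^sup>+x. (\<Sum>b\<in>(Basis :: 'b set). ?J (?N1 b) x + ?J (?N2 b) x) \<partial>\<mu>)"
  proof (rule nn_integral_mono)
    fix x assume "x \<in> space \<mu>"
    then have x: "x \<in> K" by (simp add: space_\<mu>)
    have "norm (poisson_integral_measure K lam \<phi> \<nu> t x) \<le> (\<Sum>b\<in>Basis. \<bar>signed_integral K (\<lambda>A. \<nu> A \<bullet> b) (pk t x)\<bar>)"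
      unfolding poisson_integral_measure_def measure_integral_def
      by (rule order_trans[OF norm_sum]) (rule sum_mono, simp)
    then have "ennreal (norm (poisson_integral_measure K lam \<phi> \<nu> t x)) \<le>
        (\<Sum>b\<in>Basis. ennreal \<bar>signed_integral K (\<lambda>A. \<nu> A \<bullet> b) (pk t x)\<bar>)"
      by (simp add: ennreal_leI sum_ennreal)
    also have "\<dots> \<le> (\<Sum>b\<in>Basis. ?J (?N1 b) x + ?J (?N2 b) x)"
      by (rule sum_mono) (rule abs_signed_integral_pk_le[OF fv t x])
    finally show "ennreal (norm (poisson_integral_measure K lam \<phi> \<nu> t x)) \<le> (\<Sum>b\<in>Basis. ?J (?N1 b) x + ?J (?N2 b) x)" .
  qed
  also have "\<dots> = (\<Sum>b\<in>Basis. \<integral>\<^sup>+x. ?J (?N1 b) x + ?J (?N2 b) x \<partial>\<mu>)"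
    by (rule nn_integral_sum) (intro borel_measurable_add J_meas fin sets_positive_variation)
  also have "\<dots> = (\<Sum>b\<in>Basis. (\<integral>\<^sup>+x. ?J (?N1 b) x \<partial>\<mu>) + (\<integral>\<^sup>+x. ?J (?N2 b) x \<partial>\<mu>))"
    by (intro sum.cong refl nn_integral_add J_meas fin sets_positive_variation)
  also have "\<dots> \<le> (\<Sum>b\<in>Basis. emeasure (?N1 b) K + emeasure (?N2 b) K)"
    by (intro sum_mono add_mono J_le fin sets_positive_variation)
  finally show ?thesis .
qed

lemma poisson_integral_measure_iff:
  fixes u :: "real \<Rightarrow> 'k \<Rightarrow> 'b::{real_normed_field, euclidean_space}"
  assumes u: "dirichlet_harmonic_function K S F V0 D r \<mu> u"
  shows "(\<exists>\<nu>. finite_variation_measure K \<nu> \<and> (\<forall>t>0. \<forall>x\<in>K. u t x = poisson_integral_measure K lam \<phi> \<nu> t x)) \<longleftrightarrow>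
    (SUP t\<in>{0<..}. Lp_norm \<mu> 1 (u t)) < \<infinity>"
proof
  assume "\<exists>\<nu>. finite_variation_measure K \<nu> \<and> (\<forall>t>0. \<forall>x\<in>K. u t x = poisson_integral_measure K lam \<phi> \<nu> t x)"
  then obtain \<nu> where \<nu>: "finite_variation_measure K \<nu>"
    and eq: "\<And>t x. t > 0 \<Longrightarrow> x \<in> K \<Longrightarrow> u t x = poisson_integral_measure K lam \<phi> \<nu> t x" by blast
  let ?B = "\<Sum>b\<in>(Basis :: 'b set). emeasure (positive_variation K (\<lambda>A. \<nu> A \<bullet> b)) K + emeasure (positive_variation K (\<lambda>A. - (\<nu> A \<bullet> b))) K"
  have "(SUP t\<in>{0<..}. Lp_norm \<mu> 1 (u t)) \<le> ?B"
  proof (rule SUP_least)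
    fix t :: real assume "t \<in> {0<..}"
    then have t: "t > 0" by simp
    have "Lp_norm \<mu> 1 (u t) = (\<integral>\<^sup>+x. ennreal (norm (poisson_integral_measure K lam \<phi> \<nu> t x)) \<partial>\<mu>)"
      unfolding Lp_norm_1 by (rule nn_integral_cong) (simp add: space_\<mu> eq[OF t])
    then show "Lp_norm \<mu> 1 (u t) \<le> ?B" using poisson_integral_measure_L1_le[OF \<nu> t] by simp
  qed
  also have "?B < \<infinity>"
  proof -
    have "emeasure (positive_variation K (\<lambda>A. \<nu> A \<bullet> b)) K + emeasure (positive_variation K (\<lambda>A. - (\<nu> A \<bullet> b))) K \<noteq> \<infinity>" for b
      using finite_measure.emeasure_finite[OF finite_positive_variation[OF finite_variation_inner[OF \<nu>]], of b K]
        finite_measure.emeasure_finite[OF finite_positive_variation[OF finite_variation_uminus[OF finite_variation_inner[OF \<nu>]]], of b K]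
      by (simp add: ennreal_add_eq_top)
    then show ?thesis by (simp add: less_top[symmetric])
  qed
  finally show "(SUP t\<in>{0<..}. Lp_norm \<mu> 1 (u t)) < \<infinity>" .
next
  assume "(SUP t\<in>{0<..}. Lp_norm \<mu> 1 (u t)) < \<infinity>"
  then obtain c where c: "0 \<le> c" "(SUP t\<in>{0<..}. Lp_norm \<mu> 1 (u t)) = ennreal c"
    by (cases "SUP t\<in>{0<..}. Lp_norm \<mu> 1 (u t)") auto
  note u_cont = harmonic_cont[OF u]
  have u_le: "(\<integral>x. norm (u t x) \<partial>\<mu>) \<le> c" if t: "t > 0" for t
  proof -
    have "ennreal (\<integral>x. norm (u t x) \<partial>\<mu>) = Lp_norm \<mu> 1 (u t)"
      unfolding Lp_norm_1
      by (rule nn_integral_eq_integral[symmetric]) (auto intro!: continuous_integrable continuous_intros u_cont[OF t])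
    also have "\<dots> \<le> ennreal c"
      unfolding c(2)[symmetric] using t by (intro SUP_upper) simp
    finally show ?thesis using c(1) by (simp add: ennreal_le_iff)
  qed
  define Q where "Q b N1 N2 \<longleftrightarrow> (finite_measure N1 \<and> sets N1 = sets (restrict_space borel K)) \<and>
      (finite_measure N2 \<and> sets N2 = sets (restrict_space borel K)) \<and>
      (\<forall>t>0. \<forall>x\<in>K. u t x \<bullet> b = (\<integral>y. pk t x y \<partial>N1) - (\<integral>y. pk t x y \<partial>N2))" for b N1 N2
  have "\<exists>N1 N2. Q b N1 N2" if b: "b \<in> Basis" for b
  proof -
    have "(\<integral>x. \<bar>u t x \<bullet> b\<bar> \<partial>\<mu>) \<le> c" if t: "t > 0" for t
    proof -
      have "(\<integral>x. \<bar>u t x \<bullet> b\<bar> \<partial>\<mu>) \<le> (\<integral>x. norm (u t x) \<partial>\<mu>)"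
        by (rule integral_mono)
          (use Basis_le_norm[OF b] in \<open>auto intro!: continuous_integrable continuous_intros u_cont[OF t]\<close>)
      then show ?thesis using u_le[OF t] by linarith
    qed
    then obtain N1 N2 where "finite_measure N1" "sets N1 = sets (restrict_space borel K)"
        "finite_measure N2" "sets N2 = sets (restrict_space borel K)"
        "\<And>t x. t > 0 \<Longrightarrow> x \<in> K \<Longrightarrow> u t x \<bullet> b = (\<integral>y. pk t x y \<partial>N1) - (\<integral>y. pk t x y \<partial>N2)"
      by (rule real_harmonic_limit_measures[OF component_harmonic[OF u b]]) blast+
    then show ?thesis unfolding Q_def by blast
  qed
  then obtain N1 N2 where Q: "\<And>b. b \<in> Basis \<Longrightarrow> Q b (N1 b) (N2 b)" by metis
  then have
    N1: "\<And>b. b \<in> (Basis :: 'b set) \<Longrightarrow> finite_measure (N1 b)" "\<And>b. b \<in> (Basis :: 'b set) \<Longrightarrow> sets (N1 b) = sets (restrict_space borel K)"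
    and N2: "\<And>b. b \<in> (Basis :: 'b set) \<Longrightarrow> finite_measure (N2 b)" "\<And>b. b \<in> (Basis :: 'b set) \<Longrightarrow> sets (N2 b) = sets (restrict_space borel K)"
    and eq: "\<And>b t x. b \<in> (Basis :: 'b set) \<Longrightarrow> t > 0 \<Longrightarrow> x \<in> K \<Longrightarrow> u t x \<bullet> b = (\<integral>y. pk t x y \<partial>N1 b) - (\<integral>y. pk t x y \<partial>N2 b)"
    unfolding Q_def by blast+
  \<comment> \<open>The pairs of limit measures are assembled coordinate by coordinate;
    \<open>signed_integral_difference\<close> evaluates integrals against the result.\<close>
  define \<nu> :: "'k set \<Rightarrow> 'b" where "\<nu> A = (\<Sum>b\<in>Basis. (measure (N1 b) A - measure (N2 b) A) *\<^sub>R b)" for A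
  have \<nu>_comp: "(\<lambda>A. \<nu> A \<bullet> b) = (\<lambda>A. measure (N1 b) A - measure (N2 b) A)" if "b \<in> Basis" for b
    using that by (simp add: \<nu>_def inner_sum_left_Basis)
  have fv: "finite_variation_measure K (\<lambda>A. measure (N1 b) A - measure (N2 b) A)" if "b \<in> (Basis :: 'b set)" for b
    by (rule finite_variation_difference[OF N1(1)[OF that] N2(1)[OF that] N1(2)[OF that] N2(2)[OF that]])
  have "finite_variation_measure K \<nu>"
    unfolding finite_variation_measure_def
  proof (intro conjI allI impI)
    show "\<nu> {} = 0" by (simp add: \<nu>_def)
    fix A :: "nat \<Rightarrow> 'k set" assume A: "range A \<subseteq> sets (restrict_space borel K)" "disjoint_family A"
    show "(\<lambda>n. \<nu> (A n)) sums \<nu> (\<Union>n. A n)"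
      unfolding \<nu>_def
      by (intro sums_sum sums_scaleR_left) (use fv A in \<open>simp add: finite_variation_measure_def\<close>)
  qed
  moreover have "u t x = poisson_integral_measure K lam \<phi> \<nu> t x" if t: "t > 0" and x: "x \<in> K" for t x
  proof -
    have "poisson_integral_measure K lam \<phi> \<nu> t x = (\<Sum>b\<in>Basis. (u t x \<bullet> b) *\<^sub>R b)"
      unfolding poisson_integral_measure_def measure_integral_def
    proof (intro sum.cong refl)
      fix b :: 'b assume b: "b \<in> Basis"
      have "signed_integral K (\<lambda>A. measure (N1 b) A - measure (N2 b) A) (pk t x) =
          (\<integral>y. pk t x y \<partial>N1 b) - (\<integral>y. pk t x y \<partial>N2 b)"
        by (rule signed_integral_difference[OF N1(1)[OF b] N2(1)[OF b] N1(2)[OF b] N2(2)[OF b] pk_measurable[OF refl] pk_le[OF t x]])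
      then show "signed_integral K (\<lambda>A. \<nu> A \<bullet> b) (pk t x) *\<^sub>R b = (u t x \<bullet> b) *\<^sub>R b"
        unfolding \<nu>_comp[OF b] eq[OF b t x] by simp
    qed
    then show ?thesis by (simp add: euclidean_representation)
  qed
  ultimately show "\<exists>\<nu>. finite_variation_measure K \<nu> \<and> (\<forall>t>0. \<forall>x\<in>K. u t x = poisson_integral_measure K lam \<phi> \<nu> t x)"
    by blast
qed

end

theorem corollary4p7:
  fixes K :: "'k::metric_space set" and S :: "'i set" and F :: "'i \<Rightarrow> 'k \<Rightarrow> 'k"
    and \<pi> :: "(nat \<Rightarrow> 'i) \<Rightarrow> 'k" and V0 :: "'k set" and D :: "'k \<Rightarrow> 'k \<Rightarrow> real"
    and r :: "'i \<Rightarrow> real" and d :: real and \<mu> :: "'k measure"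
    and lam :: "nat \<Rightarrow> real" and \<phi> :: "nat \<Rightarrow> 'k \<Rightarrow> real"
    and u :: "real \<Rightarrow> 'k \<Rightarrow> 'b::{real_normed_field,euclidean_space}"
  assumes "self_similar_structure K S F \<pi>"
    and "V0 = boundary_set K S F" and "finite V0" and "V0 \<noteq> {}"
    and "regular_harmonic_structure S F V0 D r"
    and "(\<Sum>i\<in>S. r i powr d) = 1"
    and "\<mu> = self_similar_measure K S \<pi> r d"
    and "dirichlet_eigensystem K S F V0 D r \<mu> lam \<phi>"
    and "dirichlet_harmonic_function K S F V0 D r \<mu> u"
  shows "(\<forall>p::ennreal. 1 < p \<longrightarrow>
           ((\<exists>f \<in> Lp_space \<mu> p. \<forall>t>0. \<forall>x\<in>K. u t x = poisson_integral \<mu> lam \<phi> f t x) \<longleftrightarrow>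
            (SUP t\<in>{0<..}. Lp_norm \<mu> p (u t)) < \<infinity>)) \<and>
         ((\<exists>\<nu>. finite_variation_measure K \<nu> \<and>
             (\<forall>t>0. \<forall>x\<in>K. u t x = poisson_integral_measure K lam \<phi> \<nu> t x)) \<longleftrightarrow>
          (SUP t\<in>{0<..}. Lp_norm \<mu> 1 (u t)) < \<infinity>)"
proof -
  interpret fractal_eigensystem K S F \<pi> V0 D r d \<mu> lam \<phi>
    by (intro fractal_eigensystem.intro fractal_structure.intro fractal_eigensystem_axioms.intro assms(1-8))
  show ?thesis
    using poisson_integral_Lp_iff[OF assms(9)] poisson_integral_measure_iff[OF assms(9)] by blast
qed

end
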